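(* Let $q$ be a prime power, let $H=\mathrm{PG}(2,q)$ be embedded as a plane in $\mathrm{PG}(3,q)$, and let $\mathcal{K}$ be a $q$-arc in $H$. Define the incidence structure $(\mathcal{P},\mathcal{L},\mathcal{I})$, with incidence given by containment, as follows. The points $\mathcal{P}$ are the lines of $\mathrm{PG}(3,q)$ not contained in $H$ that pass through a point of $\mathcal{K}$. The lines $\mathcal{L}$ are (1) the affine points of $\mathrm{PG}(3,q)$, i.e. the points not in $H$, and (2) the planes of $\mathrm{PG}(3,q)$, different from $H$, that contain a tangent line to $\mathcal{K}$. Then $(\mathcal{P},\mathcal{L},\mathcal{I})$ is a generalised quadrangle of order $(q-1,q+1)$. Moreover, if $q$ is odd, it is isomorphic to the Ahrens–Szekeres generalised quadrangle $\mathrm{AS}(q)$.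
   Context: A $k$-arc in a projective plane is a set of $k$ points no three of which are collinear. A tangent line to an arc is a line meeting it in exactly one point. A generalised quadrangle (GQ) of order $(s,t)$ is a point-line incidence structure with the following properties: every line has $s+1$ points; every point is on $t+1$ lines; two points are on at most one common line; and for every point $P$ and line $L$ with $P$ not on $L$ there is a unique point on $L$ collinear with $P$. $\mathrm{AS}(q)$, for $q$ odd, denotes the generalised quadrangle of order $(q-1,q+1)$ constructed by Ahrens and Szekeres. *)

theory Defs
  imports "HOL-Analysis.Analysis" "HOL-Number_Theory.Prime_Powers"
begin

subsection \<open>Projective space over a field\<close>

text \<open>
  The subspaces of the projective space of dimension n over \<open>'a\<close> are the vector subspaces of
  \<open>'a^'d\<close>, where \<open>'d\<close> has n + 1 elements. Containment of subspaces is set inclusion, and the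
  vector space dimension is one more than the projective dimension.
\<close>

definition proj_point :: "('a::field ^ 'd) set \<Rightarrow> bool" where
  "proj_point P \<longleftrightarrow> vec.subspace P \<and> vec.dim P = 1"

definition proj_line :: "('a::field ^ 'd) set \<Rightarrow> bool" where
  "proj_line l \<longleftrightarrow> vec.subspace l \<and> vec.dim l = 2"

definition proj_plane :: "('a::field ^ 'd) set \<Rightarrow> bool" where
  "proj_plane E \<longleftrightarrow> vec.subspace E \<and> vec.dim E = 3"

definition arc_in_plane :: "nat \<Rightarrow> ('a::field ^ 'd) set \<Rightarrow> ('a ^ 'd) set set \<Rightarrow> bool" where
  "arc_in_plane k H K \<longleftrightarrow>
     (\<forall>P\<in>K. proj_point P \<and> P \<subseteq> H) \<and> finite K \<and> card K = k \<and>
     (\<forall>P\<in>K. \<forall>Q\<in>K. \<forall>R\<in>K. P \<noteq> Q \<and> P \<noteq> R \<and> Q \<noteq> R \<longrightarrow>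
        \<not> (\<exists>l. proj_line l \<and> P \<subseteq> l \<and> Q \<subseteq> l \<and> R \<subseteq> l))"

text \<open>
  Tangents are lines of the plane \<open>H\<close> in which the arc lives; a line of the ambient space that
  leaves \<open>H\<close> in a point of the arc is not a tangent.
\<close>

definition tangent_line :: "('a::field ^ 'd) set \<Rightarrow> ('a ^ 'd) set set \<Rightarrow> ('a ^ 'd) set \<Rightarrow> bool" where
  "tangent_line H K l \<longleftrightarrow> proj_line l \<and> l \<subseteq> H \<and> (\<exists>!P. P \<in> K \<and> P \<subseteq> l)"


subsection \<open>Incidence structures and generalised quadrangles\<close>

record ('p, 'l) incidence_structure =
  points :: "'p set"
  blocks :: "'l set"
  incident :: "'p \<Rightarrow> 'l \<Rightarrow> bool"

definition collinear_points :: "('p, 'l) incidence_structure \<Rightarrow> 'p \<Rightarrow> 'p \<Rightarrow> bool" where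
  "collinear_points S P Q \<longleftrightarrow> (\<exists>L\<in>blocks S. incident S P L \<and> incident S Q L)"

definition generalised_quadrangle :: "nat \<Rightarrow> nat \<Rightarrow> ('p, 'l) incidence_structure \<Rightarrow> bool" where
  "generalised_quadrangle s t S \<longleftrightarrow>
     (\<forall>L\<in>blocks S. card {P \<in> points S. incident S P L} = s + 1) \<and>
     (\<forall>P\<in>points S. card {L \<in> blocks S. incident S P L} = t + 1) \<and>
     (\<forall>P\<in>points S. \<forall>Q\<in>points S. P \<noteq> Q \<longrightarrow>
        (\<forall>L\<in>blocks S. \<forall>M\<in>blocks S.
           incident S P L \<and> incident S Q L \<and> incident S P M \<and> incident S Q M \<longrightarrow> L = M)) \<and>
     (\<forall>P\<in>points S. \<forall>L\<in>blocks S. \<not> incident S P L \<longrightarrow>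
        (\<exists>!Q. Q \<in> points S \<and> incident S Q L \<and> collinear_points S P Q))"

definition isomorphic_structures ::
  "('p, 'l) incidence_structure \<Rightarrow> ('r, 'm) incidence_structure \<Rightarrow> bool" where
  "isomorphic_structures S T \<longleftrightarrow>
     (\<exists>f g. bij_betw f (points S) (points T) \<and> bij_betw g (blocks S) (blocks T) \<and>
        (\<forall>P\<in>points S. \<forall>L\<in>blocks S. incident S P L \<longleftrightarrow> incident T (f P) (g L)))"

text \<open>
  The Ahrens--Szekeres quadrangle of order (q - 1, q + 1), q odd, in the coordinates of Payne and
  Thas (Finite Generalized Quadrangles): its points are the points of the affine space AG(3,q)
  and its lines are three families of curves, each curve being parametrised by \<open>\<sigma>\<close>.
\<close>

definition ahrens_szekeres ::
  "('a::field \<times> 'a \<times> 'a, ('a \<times> 'a \<times> 'a) set) incidence_structure" where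
  "ahrens_szekeres =
     \<lparr> points = UNIV,
       blocks = {range (\<lambda>\<sigma>. (\<sigma>, a, b)) | a b. True}
              \<union> {range (\<lambda>\<sigma>. (a, \<sigma>, b)) | a b. True}
              \<union> {range (\<lambda>\<sigma>. (c * \<sigma>\<^sup>2 - b * \<sigma> + a, - 2 * c * \<sigma> + b, \<sigma>)) | a b c. True},
       incident = (\<in>) \<rparr>"


subsection \<open>The incidence structure of an arc\<close>

text \<open>
  Incidence is symmetrised containment: a point of the structure is a line of the projective
  space, which contains the affine points incident with it and is contained in the planes
  incident with it.
\<close>

definition arc_structure ::
  "('a::field ^ 4) set \<Rightarrow> ('a ^ 4) set set \<Rightarrow> (('a ^ 4) set, ('a ^ 4) set) incidence_structure" where
  "arc_structure H K =
     \<lparr> points = {l. proj_line l \<and> \<not> l \<subseteq> H \<and> (\<exists>P\<in>K. P \<subseteq> l)},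
       blocks = {A. proj_point A \<and> \<not> A \<subseteq> H}
              \<union> {E. proj_plane E \<and> E \<noteq> H \<and> (\<exists>m. tangent_line H K m \<and> m \<subseteq> E)},
       incident = (\<lambda>l X. X \<subseteq> l \<or> l \<subseteq> X) \<rparr>"

end

theory Submission
  imports Defs "HOL-Number_Theory.Residues"
begin

text \<open>
  Coordinates on the plane \<open>H\<close> turn an affine point into a vector of \<open>'a^3\<close>, and a line through
  the arc point \<open>i\<close> into the pair of values that the two tangent forms at \<open>i\<close> take on it. Each \<open>i\<close> has
  exactly two tangents, since \<open>q - 1\<close> of the \<open>q + 1\<close> lines through it are secants; the quadrangle
  axioms follow, because every further line of \<open>H\<close> through \<open>i\<close> meets the arc in exactly one other point.

  For odd \<open>q\<close> the arc is a conic minus a point, and in coordinates in which the arc consists of the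
  points \<open>(\<sigma>\<^sup>2, 2\<sigma>, 1)\<close> the description above is literally \<open>AS(q)\<close>. That a \<open>q\<close>-arc lies on a conic is
  shown with Segre's lemma of tangents: by interpolation on the pencil of lines through \<open>i\<close>, the antisymmetric
  products of tangent forms yield linear relations between six points of the arc, which force six among any
  eight points onto a conic, and then every other point onto the same conic. For \<open>q = 7\<close> there are too few
  points for this argument and the claim is a finite check; for \<open>q \<le> 5\<close> a conic through five points exists anyway.
\<close>

section \<open>Vectors in three dimensions\<close>

text \<open>A point of a \<open>q\<close>-arc has two tangents, so the lemma of tangents controls
  only the product of their forms, and there is no single tangent from which to build a conic.
  Linear algebra gets around this. For six points the weights form an antisymmetric matrix M with M
  r = D r, where D is diagonal and r is the column of the six vectors. Pairing with r gives a form
  that is both symmetric and antisymmetric, so in odd characteristic the diagonal entries satisfy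
  \<Sum> d_i Q(r_i) = 0 for every quadratic form Q. If five of the six points lie on a conic that
  misses the sixth, this gives D = 0. When D vanishes for two six-subsets of seven points, their
  relations combine into one that is weighted by any conic of a pencil. A conic of the pencil
  through all but one of the seven points leaves a single term, which is absurd; a conic through all
  but two leaves two terms, hence a vanishing 2 by 2 minor of the weights. Comparing two such minors
  takes an eighth point, whence the bound 8.\<close>

definition dot3 :: "'a::field ^ 3 \<Rightarrow> 'a ^ 3 \<Rightarrow> 'a" where
  "dot3 x y = x $ 1 * y $ 1 + x $ 2 * y $ 2 + x $ 3 * y $ 3"

definition crs :: "'a::field ^ 3 \<Rightarrow> 'a ^ 3 \<Rightarrow> 'a ^ 3" where
  "crs x y = vector [x $ 2 * y $ 3 - x $ 3 * y $ 2, x $ 3 * y $ 1 - x $ 1 * y $ 3,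
    x $ 1 * y $ 2 - x $ 2 * y $ 1]"

definition det3 :: "'a::field ^ 3 \<Rightarrow> 'a ^ 3 \<Rightarrow> 'a ^ 3 \<Rightarrow> 'a" where
  "det3 x y z = dot3 x (crs y z)"

lemmas vec3_defs = dot3_def crs_def det3_def vector_3 vec_eq_iff forall_3

text \<open>Binet-Cauchy. When \<open>crs a b\<close> is an arc point, every bracket with this point
  is a 2 by 2 determinant in the values of two forms through it; all computations in a pencil of
  lines rest on this.\<close>

lemma det3_crs: "det3 (crs a b) x y = dot3 a x * dot3 b y - dot3 a y * dot3 b x"
  by (simp add: vec3_defs algebra_simps)

text \<open>Cramer's rule without division; it lets brackets with two fixed entries serve as
  homogeneous coordinates in the frame \<open>a\<close>, \<open>b\<close>, \<open>c\<close>.\<close>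

lemma det3_expand:
  "det3 a b c *s y = det3 y b c *s a + det3 a y c *s b + det3 a b y *s c"
  by (simp add: vec3_defs algebra_simps)

text \<open>The three-term Grassmann-Pluecker relation. It is used to recognise the third line pair
  through four points as a combination of the other two.\<close>

lemma det3_plucker:
  "det3 a b e * det3 c d e - det3 a c e * det3 b d e + det3 a d e * det3 b c e = 0"
  by (simp add: vec3_defs algebra_simps)

lemma crs_crs: "crs (crs a b) y = dot3 a y *s b - dot3 b y *s a"
  by (simp add: vec3_defs algebra_simps)

lemma det3_swap: "det3 y x z = - det3 x y z" "det3 x z y = - det3 x y z"
  by (simp_all add: vec3_defs algebra_simps)

lemma det3_refl [simp]: "det3 x x y = 0" "det3 x y x = 0" "det3 y x x = 0"
  by (simp_all add: vec3_defs algebra_simps)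

lemma dot3_add [simp]: "dot3 a (x + y) = dot3 a x + dot3 a y"
  and dot3_diff [simp]: "dot3 a (x - y) = dot3 a x - dot3 a y"
  and dot3_scale [simp]: "dot3 a (c *s x) = c * dot3 a x"
  and dot3_zero [simp]: "dot3 a 0 = 0"
  and dot3_diff_left [simp]: "dot3 (x - y) a = dot3 x a - dot3 y a"
  and dot3_scale_left [simp]: "dot3 (c *s x) a = c * dot3 x a"
  and dot3_crs_self [simp]: "dot3 a (crs a b) = 0" "dot3 b (crs a b) = 0"
  by (simp_all add: vec3_defs algebra_simps)

lemma crs_exists:
  assumes "x \<noteq> 0"
  shows "\<exists>a b. crs a b = x"
proof -
  consider "x $ 1 \<noteq> 0" | "x $ 2 \<noteq> 0" | "x $ 3 \<noteq> 0"
    using assms by (auto simp: vec_eq_iff forall_3)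
  then show ?thesis
  proof cases
    case 1
    then show ?thesis
      by (intro exI[of _ "vector [- x $ 2, x $ 1, 0]"] exI[of _ "vector [- x $ 3 / x $ 1, 0, 1]"])
        (simp add: vec3_defs)
  next
    case 2
    then show ?thesis
      by (intro exI[of _ "vector [0, - x $ 3, x $ 2]"] exI[of _ "vector [1, - x $ 1 / x $ 2, 0]"])
        (simp add: vec3_defs)
  next
    case 3
    then show ?thesis
      by (intro exI[of _ "vector [x $ 3, 0, - x $ 1]"] exI[of _ "vector [0, 1, - x $ 2 / x $ 3]"])
        (simp add: vec3_defs)
  qed
qed

lemma dot3_solve:
  assumes "crs a b \<noteq> 0"
  shows "\<exists>x. dot3 a x = s \<and> dot3 b x = t"
proof -
  obtain c where c: "dot3 c (crs a b) \<noteq> 0"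
  proof -
    have "\<exists>c. dot3 c (crs a b) \<noteq> 0"
    proof (rule ccontr)
      assume "\<nexists>c. dot3 c (crs a b) \<noteq> 0"
      then have "dot3 (vector [1,0,0]) (crs a b) = 0" "dot3 (vector [0,1,0]) (crs a b) = 0"
        "dot3 (vector [0,0,1]) (crs a b) = 0"
        by blast+
      then show False using assms by (simp add: dot3_def vec_eq_iff forall_3)
    qed
    then show ?thesis using that by blast
  qed
  \<comment> \<open>Cramer's rule for two equations, completed by the auxiliary form
    \<open>c\<close>; \<open>D\<close> is the determinant of the completed system.\<close>
  define D where "D = dot3 c (crs a b)"
  have "dot3 a (s *s crs b c + t *s crs c a) = s * D" "dot3 b (s *s crs b c + t *s crs c a) = t * D"
    by (simp_all add: vec3_defs D_def algebra_simps)
  then have "dot3 a (inverse D *s (s *s crs b c + t *s crs c a)) = s"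
    "dot3 b (inverse D *s (s *s crs b c + t *s crs c a)) = t"
    using c by (simp_all only: dot3_scale) (simp_all add: D_def)
  then show ?thesis by blast
qed

lemma crs_eq_0:
  assumes "crs r y = 0" "r \<noteq> 0"
  shows "\<exists>c. y = c *s r"
proof -
  have e: "r $ 2 * y $ 3 = r $ 3 * y $ 2" "r $ 3 * y $ 1 = r $ 1 * y $ 3" "r $ 1 * y $ 2 = r $ 2 * y $ 1"
    using assms(1) by (simp_all add: vec3_defs)
  consider "r $ 1 \<noteq> 0" | "r $ 2 \<noteq> 0" | "r $ 3 \<noteq> 0"
    using assms by (auto simp: vec_eq_iff forall_3)
  then show ?thesis
  proof cases
    case 1
    then show ?thesis using e
      by (intro exI[of _ "y $ 1 / r $ 1"]) (simp add: vec_eq_iff forall_3 field_simps)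
  next
    case 2
    then show ?thesis using e
      by (intro exI[of _ "y $ 2 / r $ 2"]) (simp add: vec_eq_iff forall_3 field_simps)
  next
    case 3
    then show ?thesis using e
      by (intro exI[of _ "y $ 3 / r $ 3"]) (simp add: vec_eq_iff forall_3 field_simps)
  qed
qed

lemma dot3_kernel:
  assumes "crs a b = r" "r \<noteq> 0" "dot3 a y = 0" "dot3 b y = 0"
  shows "\<exists>c. y = c *s r"
  using crs_crs[of a b y] assms by (intro crs_eq_0) auto

lemma card_cell:
  fixes a b :: "'a::{field,finite} ^ 3"
  assumes "crs a b \<noteq> 0"
  shows "card {x. dot3 a x = s \<and> dot3 b x = t} = CARD('a)"
proof -
  obtain x0 where x0: "dot3 a x0 = s" "dot3 b x0 = t"
    using dot3_solve[OF assms] by blast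
  have "{x. dot3 a x = s \<and> dot3 b x = t} = range (\<lambda>c. x0 + c *s crs a b)"
  proof (intro equalityI subsetI)
    fix x assume "x \<in> {x. dot3 a x = s \<and> dot3 b x = t}"
    then have "dot3 a (x - x0) = 0" "dot3 b (x - x0) = 0" using x0 by auto
    then obtain c where "x - x0 = c *s crs a b"
      using dot3_kernel[OF refl assms] by blast
    then have "x = x0 + c *s crs a b" by (simp add: algebra_simps)
    then show "x \<in> range (\<lambda>c. x0 + c *s crs a b)" by blast
  qed (use x0 in auto)
  moreover have "inj (\<lambda>c. x0 + c *s crs a b)"
    using assms by (auto simp: inj_def)
  ultimately show ?thesis by (simp add: card_image)
qed

lemma card_dot3_kernel:
  fixes w :: "'a::{field,finite} ^ 3"
  assumes "w \<noteq> 0"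
  shows "card {x. dot3 w x = c} = CARD('a) ^ 2"
proof -
  have "\<exists>v. crs w v \<noteq> 0"
  proof (rule ccontr)
    assume "\<nexists>v. crs w v \<noteq> 0"
    then have "crs w (vector [1, 0, 0]) = 0" "crs w (vector [0, 1, 0]) = 0" by blast+
    then show False using assms by (simp add: vec3_defs)
  qed
  then obtain v where v: "crs w v \<noteq> 0" by blast
  have "{x. dot3 w x = c} = (\<Union>b. {x. dot3 w x = c \<and> dot3 v x = b})" by auto
  also have "card \<dots> = (\<Sum>b::'a\<in>UNIV. CARD('a))"
    by (subst card_UN_disjoint) (auto simp: card_cell[OF v])
  finally show ?thesis by (simp add: power2_eq_square)
qed

lemma card_field_ge_2: "2 \<le> CARD('a::{field,finite})"
proof -
  have "card {0, 1::'a} \<le> CARD('a)" by (intro card_mono) auto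
  then show ?thesis by simp
qed

text \<open>\<open>indep\<close> stands beside \<open>no_three\<close> because for
  \<open>q = 2\<close> the arc has only two points, so there are no triples from which independence
  could follow.\<close>

locale vec_arc =
  fixes I :: "'i set" and r :: "'i \<Rightarrow> 'a::{field,finite} ^ 3"
  assumes fin: "finite I"
    and card_I: "card I = CARD('a)"
    and indep: "\<lbrakk>i \<in> I; j \<in> I; i \<noteq> j\<rbrakk> \<Longrightarrow> crs (r i) (r j) \<noteq> 0"
    and no_three: "\<lbrakk>i \<in> I; j \<in> I; k \<in> I; i \<noteq> j; i \<noteq> k; j \<noteq> k\<rbrakk> \<Longrightarrow> det3 (r i) (r j) (r k) \<noteq> 0"
begin

lemma two_le_card: "2 \<le> CARD('a)"
  by (rule card_field_ge_2)

lemma r_nonzero: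
  assumes "i \<in> I"
  shows "r i \<noteq> 0"
proof -
  have "I \<noteq> {i}" using two_le_card card_I by auto
  then obtain j where "j \<in> I" "j \<noteq> i" using assms by blast
  then show ?thesis using indep[OF assms, of j] by (auto simp: vec3_defs)
qed

text \<open>The lines through a point of the arc form a projective line with \<open>q + 1\<close> elements, of which
  the other arc points account for \<open>q - 1\<close>; the two missing ones are the tangents.\<close>

lemma tangent_forms:
  assumes i: "i \<in> I"
  shows "\<exists>a b. crs a b = r i \<and> (\<forall>j\<in>I - {i}. dot3 a (r j) \<noteq> 0 \<and> dot3 b (r j) \<noteq> 0)"
proof -
  obtain a b where ab: "crs a b = r i" using crs_exists[OF r_nonzero[OF i]] by blast
  \<comment> \<open>The line joining \<open>i\<close> to \<open>j\<close>, as a point of the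
    projective line \<open>'a option\<close> with \<open>q + 1\<close> elements; \<open>None\<close>
    stands for the kernel of \<open>a\<close>.\<close>
  define th where "th j = (if dot3 a (r j) = 0 then None else Some (dot3 b (r j) / dot3 a (r j)))" for j
  have inj: "inj_on th (I - {i})"
  proof (rule inj_onI, rule ccontr)
    fix j k assume *: "j \<in> I - {i}" "k \<in> I - {i}" "th j = th k" "j \<noteq> k"
    have "dot3 a (r j) * dot3 b (r k) - dot3 a (r k) * dot3 b (r j) \<noteq> 0"
      using no_three[of i j k] * i by (auto simp flip: ab simp: det3_crs)
    then show False using *(3) by (auto simp: th_def field_simps split: if_splits)
  qed
  have "card (- th ` (I - {i})) = 2"
    using i fin card_I by (simp add: Compl_eq_Diff_UNIV card_Diff_subset card_image[OF inj])
  then obtain m n where mn: "m \<noteq> n" "m \<notin> th ` (I - {i})" "n \<notin> th ` (I - {i})"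
    by (auto simp: card_2_iff)
  \<comment> \<open>The form whose kernel is the line with parameter \<open>m\<close>: it vanishes
    at \<open>r j\<close> only if \<open>th j = m\<close>.\<close>
  define fm where "fm m = (case m of None \<Rightarrow> a | Some c \<Rightarrow> b - c *s a)" for m
  have nz: "dot3 (fm m) (r j) \<noteq> 0" if "j \<in> I - {i}" "m \<notin> th ` (I - {i})" for j m
  proof
    assume 0: "dot3 (fm m) (r j) = 0"
    have "\<not> (dot3 a (r j) = 0 \<and> dot3 b (r j) = 0)"
      using indep[of i j] that(1) i crs_crs[of a b "r j"] by (auto simp: ab)
    with 0 have "th j = m"
      by (auto simp: fm_def th_def split: option.splits)
    then show False using that by auto
  qed
  have "\<exists>k. k \<noteq> 0 \<and> crs (fm m) (fm n) = k *s crs a b"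
  proof (cases m)
    case None
    then obtain c where "n = Some c" using mn by (cases n) auto
    with None show ?thesis
      by (intro exI[of _ 1]) (simp add: fm_def vec3_defs algebra_simps)
  next
    case (Some c)
    show ?thesis
    proof (cases n)
      case None
      with Some show ?thesis
        by (intro exI[of _ "-1"]) (simp add: fm_def vec3_defs algebra_simps)
    next
      case (Some d)
      with \<open>m = Some c\<close> mn show ?thesis
        by (intro exI[of _ "d - c"]) (auto simp add: fm_def vec3_defs algebra_simps)
    qed
  qed
  then obtain k where k: "k \<noteq> 0" "crs (fm m) (fm n) = k *s crs a b" by blast
  \<comment> \<open>Rescaling one of the forms makes the cross product equal to \<open>r i\<close>,
    not merely proportional to it.\<close>
  have "crs (inverse k *s fm m) (fm n) = inverse k *s crs (fm m) (fm n)"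
    by (simp add: vec3_defs algebra_simps)
  also have "\<dots> = r i" using k ab by simp
  finally show ?thesis using nz mn k
    by (intro exI[of _ "inverse k *s fm m"] exI[of _ "fm n"]) auto
qed

end

section \<open>The quadrangle in coordinates\<close>

text \<open>AG(3,q) with \<open>H\<close> at infinity. \<open>(i, a, b)\<close> is the affine line
  in the direction of the arc point \<open>i\<close> on which the tangent forms take the values
  \<open>a\<close> and \<open>b\<close>; \<open>Inl h\<close> is an affine point;
  \<open>Inr (i, s, c)\<close> is the plane on which \<open>f i s\<close> is \<open>c\<close>, which
  meets infinity in a tangent. Only the tangent forms enter, so the model can be built from any
  coordinates of the arc.\<close>

definition arc_model ::
  "'i set \<Rightarrow> ('i \<Rightarrow> bool \<Rightarrow> 'a::field ^ 3) \<Rightarrow>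
    ('i \<times> 'a \<times> 'a, 'a ^ 3 + 'i \<times> bool \<times> 'a) incidence_structure" where
  "arc_model I f =
     \<lparr> points = I \<times> UNIV,
       blocks = range Inl \<union> Inr ` (I \<times> UNIV),
       incident = (\<lambda>(i, a, b) X. case X of
           Inl h \<Rightarrow> dot3 (f i True) h = a \<and> dot3 (f i False) h = b
         | Inr (j, s, c) \<Rightarrow> i = j \<and> (if s then a else b) = c) \<rparr>"

lemma arc_model_simps [simp]:
  "points (arc_model I f) = I \<times> UNIV"
  "blocks (arc_model I f) = range Inl \<union> Inr ` (I \<times> UNIV)"
  "incident (arc_model I f) (i, a, b) (Inl h) \<longleftrightarrow>
     dot3 (f i True) h = a \<and> dot3 (f i False) h = b"
  "incident (arc_model I f) (i, a, b) (Inr (j, s, c)) \<longleftrightarrow> i = j \<and> (if s then a else b) = c"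
  by (auto simp: arc_model_def)

locale tangent_arc = vec_arc I r
  for I :: "'i set" and r :: "'i \<Rightarrow> 'a::{field,finite} ^ 3" +
  fixes f :: "'i \<Rightarrow> bool \<Rightarrow> 'a ^ 3"
  assumes crs_f: "i \<in> I \<Longrightarrow> crs (f i True) (f i False) = r i"
    and f_nonzero: "\<lbrakk>i \<in> I; j \<in> I; i \<noteq> j\<rbrakk> \<Longrightarrow> dot3 (f i s) (r j) \<noteq> 0"
begin

lemma det3_f:
  assumes "i \<in> I"
  shows "det3 (r i) x y =
    dot3 (f i True) x * dot3 (f i False) y - dot3 (f i True) y * dot3 (f i False) x"
  by (simp flip: crs_f[OF assms] add: det3_crs)

lemma f_self [simp]: "i \<in> I \<Longrightarrow> dot3 (f i s) (r i) = 0"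
  using crs_f[of i] by (cases s) (auto simp flip: crs_f)

lemma f_zero_iff: "\<lbrakk>i \<in> I; j \<in> I\<rbrakk> \<Longrightarrow> dot3 (f i s) (r j) = 0 \<longleftrightarrow> i = j"
  using f_nonzero by fastforce

lemma f_kernel:
  assumes "i \<in> I" "dot3 (f i True) y = 0" "dot3 (f i False) y = 0"
  shows "\<exists>c. y = c *s r i"
  using dot3_kernel[OF crs_f r_nonzero] assms by blast

lemma card_cell_f:
  "i \<in> I \<Longrightarrow> card {x. dot3 (f i True) x = a \<and> dot3 (f i False) x = b} = CARD('a)"
  using crs_f r_nonzero by (intro card_cell) auto

lemma cell_f:
  "i \<in> I \<Longrightarrow> \<exists>x. dot3 (f i True) x = a \<and> dot3 (f i False) x = b"
  using crs_f r_nonzero by (intro dot3_solve) auto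

text \<open>The tangents at \<open>i\<close> are the lines with ratio 0 and infinity, so the
  \<open>q - 1\<close> secants must share the \<open>q - 1\<close> nonzero ratios; being injective,
  they take each of them once.\<close>

lemma bij_ratio:
  assumes i: "i \<in> I"
  shows "bij_betw (\<lambda>j. dot3 (f i False) (r j) / dot3 (f i True) (r j)) (I - {i}) (UNIV - {0})"
proof -
  let ?s = "\<lambda>j. dot3 (f i False) (r j) / dot3 (f i True) (r j)"
  have inj: "inj_on ?s (I - {i})"
  proof (rule inj_onI, rule ccontr)
    fix j k assume *: "j \<in> I - {i}" "k \<in> I - {i}" "?s j = ?s k" "j \<noteq> k"
    then show False
      using no_three[of i j k] i f_nonzero[of i j True] f_nonzero[of i k True]
      by (auto simp: det3_f field_simps)
  qed
  moreover have "?s ` (I - {i}) = UNIV - {0}"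
  proof (rule card_subset_eq)
    show "?s ` (I - {i}) \<subseteq> UNIV - {0}"
      using i f_nonzero by auto
    show "card (?s ` (I - {i})) = card (UNIV - {0::'a})"
      using i fin card_I by (simp add: card_image[OF inj] card_Diff_singleton)
  qed simp
  ultimately show ?thesis by (simp add: bij_betw_def)
qed

text \<open>A direction on neither tangent has a nonzero finite ratio, and each such ratio belongs
  to one other arc point. This is the source of uniqueness in the last quadrangle axiom.\<close>

lemma ex1_secant:
  assumes i: "i \<in> I" and w: "dot3 (f i True) w \<noteq> 0" "dot3 (f i False) w \<noteq> 0"
  shows "\<exists>!j. j \<in> I - {i} \<and> det3 (r i) (r j) w = 0"
proof -
  let ?s = "\<lambda>j. dot3 (f i False) (r j) / dot3 (f i True) (r j)"
  have "\<exists>!j. j \<in> I - {i} \<and> ?s j = dot3 (f i False) w / dot3 (f i True) w"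
    using bij_ratio[OF i] w unfolding bij_betw_def inj_on_def
    by (smt (verit) DiffI UNIV_I divide_eq_0_iff imageE singletonD)
  moreover have "det3 (r i) (r j) w = 0 \<longleftrightarrow> ?s j = dot3 (f i False) w / dot3 (f i True) w"
    if "j \<in> I - {i}" for j
    using that i w f_nonzero[of i j True] by (auto simp: det3_f field_simps)
  ultimately show ?thesis by (metis (no_types, lifting))
qed

lemma collinear_same:
  assumes "i \<in> I"
  shows "collinear_points (arc_model I f) (i, a, b) (i, c, d) \<longleftrightarrow> a = c \<or> b = d"
proof
  assume "a = c \<or> b = d"
  then show "collinear_points (arc_model I f) (i, a, b) (i, c, d)"
  proof
    assume "a = c" then show ?thesis
      using assms by (auto simp: collinear_points_def intro!: bexI[of _ "Inr (i, True, a)"])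
  next
    assume "b = d" then show ?thesis
      using assms by (auto simp: collinear_points_def intro!: bexI[of _ "Inr (i, False, b)"])
  qed
qed (auto simp: collinear_points_def split: if_splits)

lemma collinear_different:
  assumes "i \<in> I" "j \<in> I" "i \<noteq> j"
  shows "collinear_points (arc_model I f) (i, a, b) (j, c, d) \<longleftrightarrow>
    (\<exists>h. dot3 (f i True) h = a \<and> dot3 (f i False) h = b \<and>
         dot3 (f j True) h = c \<and> dot3 (f j False) h = d)"
  using assms by (auto simp: collinear_points_def intro: bexI[of _ "Inl _"])

text \<open>The line through \<open>x\<close> in direction \<open>r i\<close> meets the line through
  \<open>h\<close> in direction \<open>r j\<close> just if \<open>x - h\<close> is a combination of
  the two directions.\<close>

lemma collinear_on_line:
  assumes "i \<in> I" "j \<in> I" "i \<noteq> j" and x: "dot3 (f i True) x = a" "dot3 (f i False) x = b"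
  shows "collinear_points (arc_model I f) (i, a, b) (j, dot3 (f j True) h, dot3 (f j False) h)
    \<longleftrightarrow> det3 (r i) (r j) (x - h) = 0"
proof
  assume "collinear_points (arc_model I f) (i, a, b) (j, dot3 (f j True) h, dot3 (f j False) h)"
  then obtain y where y: "dot3 (f i True) y = a" "dot3 (f i False) y = b"
    "dot3 (f j True) y = dot3 (f j True) h" "dot3 (f j False) y = dot3 (f j False) h"
    using assms by (auto simp: collinear_different)
  have "\<exists>c. y - h = c *s r j" "\<exists>c. x - y = c *s r i"
    using y x assms by (intro f_kernel; simp)+
  then obtain c d where "y - h = c *s r j" "x - y = d *s r i" by blast
  moreover have "x - h = (y - h) + (x - y)" by simp
  ultimately have "x - h = c *s r j + d *s r i" by metis
  then show "det3 (r i) (r j) (x - h) = 0"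
    using assms by (simp add: det3_f)
next
  assume 0: "det3 (r i) (r j) (x - h) = 0"
  \<comment> \<open>\<open>h + k *s r j\<close> is the meeting point: \<open>k\<close> adjusts the
    value of \<open>f i True\<close>, and the vanishing bracket makes \<open>f i False\<close> agree
    as well.\<close>
  define k where "k = dot3 (f i True) (x - h) / dot3 (f i True) (r j)"
  have "dot3 (f i True) (h + k *s r j) = a" "dot3 (f i False) (h + k *s r j) = b"
    using 0 assms f_nonzero[of i j True] by (auto simp: k_def det3_f field_simps)
  then show "collinear_points (arc_model I f) (i, a, b) (j, dot3 (f j True) h, dot3 (f j False) h)"
    using assms by (subst collinear_different) (auto intro!: exI[of _ "h + k *s r j"])
qed

lemma card_points_on_block:
  assumes "L \<in> blocks (arc_model I f)"
  shows "card {p \<in> points (arc_model I f). incident (arc_model I f) p L} = CARD('a)"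
proof -
  consider h where "L = Inl h" | i s c where "L = Inr (i, s, c)" "i \<in> I"
    using assms by auto
  then show ?thesis
  proof cases
    case (1 h)
    have "{p \<in> points (arc_model I f). incident (arc_model I f) p L} =
      (\<lambda>i. (i, dot3 (f i True) h, dot3 (f i False) h)) ` I"
      using 1 by auto
    then show ?thesis using card_I by (simp add: card_image inj_on_def)
  next
    case (2 i s c)
    have "{p \<in> points (arc_model I f). incident (arc_model I f) p L} =
      range (\<lambda>x. (i, if s then (c, x) else (x, c)))"
      using 2 by (auto split: if_splits)
    then show ?thesis by (simp add: card_image inj_on_def)
  qed
qed

text \<open>An affine line has \<open>q\<close> points and lies in one plane through each of the two
  tangents at its point at infinity.\<close>

lemma card_blocks_on_point:
  assumes "p \<in> points (arc_model I f)"
  shows "card {L \<in> blocks (arc_model I f). incident (arc_model I f) p L} = CARD('a) + 2"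
proof -
  obtain i a b where p: "p = (i, a, b)" "i \<in> I" using assms by auto
  let ?C = "{x. dot3 (f i True) x = a \<and> dot3 (f i False) x = b}"
  have "{L \<in> blocks (arc_model I f). incident (arc_model I f) p L} =
    Inl ` ?C \<union> {Inr (i, True, a), Inr (i, False, b)}"
    using p by (auto split: if_splits)
  moreover have "card (Inl ` ?C \<union> {Inr (i, True, a), Inr (i, False, b)}) = card ?C + 2"
    by (subst card_Un_disjoint) (auto simp: card_image)
  ultimately show ?thesis using card_cell_f[OF p(2)] by simp
qed

text \<open>Parallel lines can only share a tangent plane, and two of these would force equal values
  of both forms. Lines in different directions share at most one affine point, since a multiple of
  both \<open>r i\<close> and \<open>r j\<close> is 0.\<close>

lemma block_unique:
  assumes "p \<in> points (arc_model I f)" "q \<in> points (arc_model I f)" "p \<noteq> q"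
    and "L \<in> blocks (arc_model I f)" "M \<in> blocks (arc_model I f)"
    and "incident (arc_model I f) p L" "incident (arc_model I f) q L"
      "incident (arc_model I f) p M" "incident (arc_model I f) q M"
  shows "L = M"
proof -
  obtain i a b where p: "p = (i, a, b)" "i \<in> I"
    using assms(1) by auto
  obtain j c d where q: "q = (j, c, d)" "j \<in> I"
    using assms(2) by auto
  note pq = p q
  show ?thesis
  proof (cases "i = j")
    case True
    then show ?thesis using assms pq by (auto split: if_splits)
  next
    case False
    then obtain h h' where h: "L = Inl h" "M = Inl h'" using assms pq by auto
    have "\<exists>k. h - h' = k *s r i" "\<exists>k. h - h' = k *s r j"
      using h assms pq by (intro f_kernel; simp)+
    then obtain k l where k: "h - h' = k *s r i" "h - h' = l *s r j" by blast
    then have "dot3 (f i True) (l *s r j) = 0" using pq by (metis dot3_scale f_self mult_zero_right)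
    then have "l = 0" using f_nonzero[of i j True] False pq by auto
    then show ?thesis using k h by simp
  qed
qed

lemma collinear_unique:
  assumes "p \<in> points (arc_model I f)" "L \<in> blocks (arc_model I f)"
    and nin: "\<not> incident (arc_model I f) p L"
  shows "\<exists>!q. q \<in> points (arc_model I f) \<and> incident (arc_model I f) q L \<and>
    collinear_points (arc_model I f) p q"
proof -
  obtain i a b where p: "p = (i, a, b)" and i: "i \<in> I" using assms by auto
  obtain x where x: "dot3 (f i True) x = a" "dot3 (f i False) x = b"
    using cell_f[OF i] by blast
  consider h where "L = Inl h" | j s c where "L = Inr (j, s, c)" "j \<in> I"
    using assms by auto
  then show ?thesis
  proof cases
    case (1 h)
    let ?q = "\<lambda>j. (j, dot3 (f j True) h, dot3 (f j False) h)"
    let ?a = "dot3 (f i True) (x - h)" and ?b = "dot3 (f i False) (x - h)"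
    have on_L: "q \<in> points (arc_model I f) \<and> incident (arc_model I f) q L \<longleftrightarrow> (\<exists>j\<in>I. q = ?q j)" for q
      using 1 by auto
    have coll: "collinear_points (arc_model I f) p (?q j) \<longleftrightarrow>
      (if j = i then ?a = 0 \<or> ?b = 0 else det3 (r i) (r j) (x - h) = 0)" if "j \<in> I" for j
      using collinear_on_line[OF i that _ x, of h] collinear_same[OF i] x that i by (auto simp: p)
    have not0: "\<not> (?a = 0 \<and> ?b = 0)" using nin x by (auto simp: p 1)
    \<comment> \<open>The vector \<open>x - h\<close> decides. If it lies on a tangent at
      \<open>i\<close>, the answer is the parallel to \<open>p\<close> through \<open>h\<close>, in
      the same tangent plane as \<open>p\<close>; otherwise it is the line through \<open>h\<close>
      towards the second arc point on the secant through \<open>i\<close> and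
      \<open>x - h\<close>.\<close>
    have "\<exists>!j. j \<in> I \<and> collinear_points (arc_model I f) p (?q j)"
    proof (cases "?a = 0 \<or> ?b = 0")
      case True
      have "j = i" if "j \<in> I" "collinear_points (arc_model I f) p (?q j)" for j
      proof (rule ccontr)
        assume "j \<noteq> i"
        then have "det3 (r i) (r j) (x - h) = 0" using coll that by auto
        then show False
          using True not0 f_nonzero[of i j] \<open>j \<noteq> i\<close> i that
          by (simp add: det3_f del: dot3_diff) (metis mult_eq_0_iff diff_0_right right_minus_eq)
      qed
      then show ?thesis using True coll[OF i] i by metis
    next
      case False
      then have "\<exists>!j. j \<in> I - {i} \<and> det3 (r i) (r j) (x - h) = 0"
        by (intro ex1_secant i) auto
      moreover have "j \<in> I \<and> collinear_points (arc_model I f) p (?q j) \<longleftrightarrow>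
        j \<in> I - {i} \<and> det3 (r i) (r j) (x - h) = 0" for j
        using coll[of j] False by (cases "j = i") auto
      ultimately show ?thesis by presburger
    qed
    then obtain j where j: "j \<in> I" "collinear_points (arc_model I f) p (?q j)"
      "\<And>k. k \<in> I \<Longrightarrow> collinear_points (arc_model I f) p (?q k) \<Longrightarrow> k = j"
      by blast
    show ?thesis
    proof (rule ex1I[of _ "?q j"])
      show "?q j \<in> points (arc_model I f) \<and> incident (arc_model I f) (?q j) L \<and>
        collinear_points (arc_model I f) p (?q j)"
        using j(1,2) on_L[of "?q j"] by blast
      fix q assume q: "q \<in> points (arc_model I f) \<and> incident (arc_model I f) q L \<and>
        collinear_points (arc_model I f) p q"
      then obtain k where k: "k \<in> I" "q = ?q k" using on_L[of q] by blast
      then have "k = j" using q j(3)[of k] by blast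
      then show "q = ?q j" using k by blast
    qed
  next
    case (2 j s c)
    show ?thesis
    proof (cases "j = i")
      case True
      show ?thesis
        using nin 2 i True
        by (intro ex1I[of _ "(i, if s then (c, b) else (a, c))"])
          (auto simp: p collinear_same split: if_splits)
    next
      case False
      \<comment> \<open>As \<open>f j s\<close> does not vanish at \<open>r i\<close>, the line
        \<open>p\<close> meets the plane in a single affine point, \<open>x + k *s r i\<close>; the
        answer is the line through it in direction \<open>r j\<close>.\<close>
      define k where "k = (c - dot3 (f j s) x) / dot3 (f j s) (r i)"
      have k: "dot3 (f j s) (x + k *s r i) = c"
        using f_nonzero[of j i s] False i 2 by (simp add: k_def)
      let ?h = "x + k *s r i"
      have uniq: "h = ?h" if h: "dot3 (f i True) h = a" "dot3 (f i False) h = b" "dot3 (f j s) h = c" for h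
      proof -
        have "\<exists>m. h - ?h = m *s r i" using h x i by (intro f_kernel) simp_all
        then obtain m where m: "h - ?h = m *s r i" by blast
        have "dot3 (f j s) (h - ?h) = 0" using k h by simp
        then have "m = 0" using m f_nonzero[of j i s] False i 2 by simp
        then show ?thesis using m by simp
      qed
      show ?thesis
      proof (rule ex1I[of _ "(j, dot3 (f j True) ?h, dot3 (f j False) ?h)"], goal_cases)
        case 1
        then show ?case using k 2 False i x
          by (auto simp: p collinear_different intro!: exI[of _ ?h])
      next
        case (2 q)
        then obtain e d where q: "q = (j, e, d)" "(if s then e else d) = c"
          using \<open>L = Inr (j, s, c)\<close> by auto
        then obtain h where "dot3 (f i True) h = a" "dot3 (f i False) h = b"
          "dot3 (f j True) h = e" "dot3 (f j False) h = d"
          using 2 False i \<open>j \<in> I\<close> by (auto simp: p collinear_different)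
        moreover from this have "h = ?h" using q by (intro uniq) (auto split: if_splits)
        ultimately show ?case using q by auto
      qed
    qed
  qed
qed

lemma generalised_quadrangle_model:
  "generalised_quadrangle (CARD('a) - 1) (CARD('a) + 1) (arc_model I f)"
  unfolding generalised_quadrangle_def
proof (intro conjI ballI impI)
  fix L assume "L \<in> blocks (arc_model I f)"
  then show "card {p \<in> points (arc_model I f). incident (arc_model I f) p L} = CARD('a) - 1 + 1"
    by (subst card_points_on_block) (use two_le_card in simp_all)
next
  fix p assume "p \<in> points (arc_model I f)"
  then show "card {L \<in> blocks (arc_model I f). incident (arc_model I f) p L} = CARD('a) + 1 + 1"
    by (subst card_blocks_on_point) simp_all
next
  fix p q L M
  assume "p \<in> points (arc_model I f)" "q \<in> points (arc_model I f)" "p \<noteq> q"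
    "L \<in> blocks (arc_model I f)" "M \<in> blocks (arc_model I f)"
    "incident (arc_model I f) p L \<and> incident (arc_model I f) q L \<and>
      incident (arc_model I f) p M \<and> incident (arc_model I f) q M"
  then show "L = M" by (blast intro: block_unique)
next
  fix p L
  assume "p \<in> points (arc_model I f)" "L \<in> blocks (arc_model I f)"
    "\<not> incident (arc_model I f) p L"
  then show "\<exists>!q. q \<in> points (arc_model I f) \<and> incident (arc_model I f) q L \<and>
    collinear_points (arc_model I f) p q"
    by (rule collinear_unique)
qed

end

section \<open>Isomorphisms of incidence structures and transport of the quadrangle axioms\<close>

lemma isomorphic_sym:
  assumes "isomorphic_structures S T"
  shows "isomorphic_structures T S"
proof -
  obtain f g where fg: "bij_betw f (points S) (points T)" "bij_betw g (blocks S) (blocks T)"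
    "\<And>P L. P \<in> points S \<Longrightarrow> L \<in> blocks S \<Longrightarrow> incident S P L \<longleftrightarrow> incident T (f P) (g L)"
    using assms unfolding isomorphic_structures_def by blast
  let ?f = "inv_into (points S) f" and ?g = "inv_into (blocks S) g"
  have "incident T P L \<longleftrightarrow> incident S (?f P) (?g L)" if "P \<in> points T" "L \<in> blocks T" for P L
  proof -
    have "?f P \<in> points S" "f (?f P) = P"
      using that fg(1) by (auto simp: bij_betw_def inv_into_into f_inv_into_f)
    moreover have "?g L \<in> blocks S" "g (?g L) = L"
      using that fg(2) by (auto simp: bij_betw_def inv_into_into f_inv_into_f)
    ultimately show ?thesis using fg(3)[of "?f P" "?g L"] by simp
  qed
  then show ?thesis
    using bij_betw_inv_into[OF fg(1)] bij_betw_inv_into[OF fg(2)]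
    unfolding isomorphic_structures_def by (intro exI[of _ ?f] exI[of _ ?g]) simp
qed

lemma isomorphic_trans:
  assumes "isomorphic_structures S T" "isomorphic_structures T U"
  shows "isomorphic_structures S U"
proof -
  obtain f g where fg: "bij_betw f (points S) (points T)" "bij_betw g (blocks S) (blocks T)"
    "\<And>P L. P \<in> points S \<Longrightarrow> L \<in> blocks S \<Longrightarrow> incident S P L \<longleftrightarrow> incident T (f P) (g L)"
    using assms(1) unfolding isomorphic_structures_def by blast
  obtain f' g' where fg': "bij_betw f' (points T) (points U)" "bij_betw g' (blocks T) (blocks U)"
    "\<And>P L. P \<in> points T \<Longrightarrow> L \<in> blocks T \<Longrightarrow> incident T P L \<longleftrightarrow> incident U (f' P) (g' L)"
    using assms(2) unfolding isomorphic_structures_def by blast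
  have "incident S P L \<longleftrightarrow> incident U ((f' \<circ> f) P) ((g' \<circ> g) L)"
    if "P \<in> points S" "L \<in> blocks S" for P L
    using that fg fg' by (simp add: bij_betw_apply[of _ "points S"] bij_betw_apply[of _ "blocks S"])
  then show ?thesis
    using bij_betw_trans[OF fg(1) fg'(1)] bij_betw_trans[OF fg(2) fg'(2)]
    unfolding isomorphic_structures_def by (intro exI[of _ "f' \<circ> f"] exI[of _ "g' \<circ> g"]) simp
qed

lemma generalised_quadrangle_isomorphic:
  assumes iso: "isomorphic_structures S T" and gq: "generalised_quadrangle s t S"
  shows "generalised_quadrangle s t T"
proof -
  obtain f g where f: "bij_betw f (points T) (points S)" and g: "bij_betw g (blocks T) (blocks S)"
    and inc: "\<And>P L. P \<in> points T \<Longrightarrow> L \<in> blocks T \<Longrightarrow> incident T P L \<longleftrightarrow> incident S (f P) (g L)"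
    using isomorphic_sym[OF iso] unfolding isomorphic_structures_def by blast
  have fE: "f P \<in> points S" if "P \<in> points T" for P using f that bij_betwE by blast
  have gE: "g L \<in> blocks S" if "L \<in> blocks T" for L using g that bij_betwE by blast
  have f_eq: "f P = f Q \<longleftrightarrow> P = Q" if "P \<in> points T" "Q \<in> points T" for P Q
    using f that by (meson bij_betw_def inj_on_eq_iff)
  have g_eq: "g L = g M \<longleftrightarrow> L = M" if "L \<in> blocks T" "M \<in> blocks T" for L M
    using g that by (meson bij_betw_def inj_on_eq_iff)
  have f_surj: "\<exists>P\<in>points T. Q = f P" if "Q \<in> points S" for Q
    using f that by (auto simp: bij_betw_def)
  have g_surj: "\<exists>L\<in>blocks T. M = g L" if "M \<in> blocks S" for M
    using g that by (auto simp: bij_betw_def)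
  have coll: "collinear_points T P Q \<longleftrightarrow> collinear_points S (f P) (f Q)"
    if "P \<in> points T" "Q \<in> points T" for P Q
    unfolding collinear_points_def using that inc gE g_surj by metis
  have "card {P \<in> points T. incident T P L} = s + 1" if L: "L \<in> blocks T" for L
  proof -
    have "f ` {P \<in> points T. incident T P L} = {P \<in> points S. incident S P (g L)}"
    proof (intro equalityI subsetI)
      fix Q assume Q: "Q \<in> {P \<in> points S. incident S P (g L)}"
      then obtain P where "P \<in> points T" "Q = f P" using f_surj by blast
      then show "Q \<in> f ` {P \<in> points T. incident T P L}" using Q inc[of P L] L by simp
    qed (use inc L fE in auto)
    moreover have "inj_on f {P \<in> points T. incident T P L}"
      using f by (auto simp: bij_betw_def intro: inj_on_subset)
    ultimately have "card {P \<in> points T. incident T P L} = card {P \<in> points S. incident S P (g L)}"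
      using card_image by fastforce
    then show ?thesis using gq gE[OF L] unfolding generalised_quadrangle_def by simp
  qed
  moreover have "card {L \<in> blocks T. incident T P L} = t + 1" if P: "P \<in> points T" for P
  proof -
    have "g ` {L \<in> blocks T. incident T P L} = {L \<in> blocks S. incident S (f P) L}"
    proof (intro equalityI subsetI)
      fix M assume M: "M \<in> {L \<in> blocks S. incident S (f P) L}"
      then obtain L where "L \<in> blocks T" "M = g L" using g_surj by blast
      then show "M \<in> g ` {L \<in> blocks T. incident T P L}" using M inc[of P L] P by simp
    qed (use inc P gE in auto)
    moreover have "inj_on g {L \<in> blocks T. incident T P L}"
      using g by (auto simp: bij_betw_def intro: inj_on_subset)
    ultimately have "card {L \<in> blocks T. incident T P L} = card {L \<in> blocks S. incident S (f P) L}"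
      using card_image by fastforce
    then show ?thesis using gq fE[OF P] unfolding generalised_quadrangle_def by simp
  qed
  moreover have "L = M" if "P \<in> points T" "Q \<in> points T" "P \<noteq> Q" "L \<in> blocks T" "M \<in> blocks T"
    "incident T P L \<and> incident T Q L \<and> incident T P M \<and> incident T Q M" for P Q L M
  proof -
    have "incident S (f P) (g L) \<and> incident S (f Q) (g L) \<and>
      incident S (f P) (g M) \<and> incident S (f Q) (g M)" "f P \<noteq> f Q"
      using that inc f_eq by auto
    then have "g L = g M"
      using gq that fE gE unfolding generalised_quadrangle_def by blast
    then show ?thesis using g_eq that by blast
  qed
  moreover have "\<exists>!Q. Q \<in> points T \<and> incident T Q L \<and> collinear_points T P Q"
    if "P \<in> points T" "L \<in> blocks T" "\<not> incident T P L" for P L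
  proof -
    have "\<exists>!Q. Q \<in> points S \<and> incident S Q (g L) \<and> collinear_points S (f P) Q"
      using that gq fE gE inc unfolding generalised_quadrangle_def by simp
    then obtain Q' where Q': "Q' \<in> points S" "incident S Q' (g L)" "collinear_points S (f P) Q'"
      and uniq: "\<And>R. R \<in> points S \<Longrightarrow> incident S R (g L) \<Longrightarrow> collinear_points S (f P) R \<Longrightarrow> R = Q'"
      by blast
    obtain Q where Q: "Q \<in> points T" "Q' = f Q" using f_surj Q'(1) by blast
    show ?thesis
    proof (rule ex1I[of _ Q])
      show "Q \<in> points T \<and> incident T Q L \<and> collinear_points T P Q"
        using Q Q' that inc coll by simp
      fix R assume R: "R \<in> points T \<and> incident T R L \<and> collinear_points T P R"
      then have "f R = Q'" using that inc coll fE by (intro uniq) auto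
      then show "R = Q" using Q R f_eq by blast
    qed
  qed
  ultimately show ?thesis unfolding generalised_quadrangle_def by blast
qed

section \<open>Subspaces and coordinates\<close>

text \<open>Each new independent vector \<open>b\<close> multiplies the span by \<open>q\<close>,
  because the vectors \<open>c *s b + x\<close> with \<open>x\<close> in the old span are pairwise
  distinct.\<close>

lemma card_subspace:
  fixes S :: "('a::{field,finite} ^ 'n) set"
  assumes "vec.subspace S"
  shows "card S = CARD('a) ^ vec.dim S"
proof -
  have span: "card (vec.span B) = CARD('a) ^ card B" if "vec.independent B" for B :: "('a ^ 'n) set"
    using finite[of B] that
  proof (induction B rule: finite_induct)
    case (insert b B)
    then have b: "b \<notin> vec.span B" and B: "vec.independent B"
      by (simp_all add: vec.independent_insert)
    have "vec.span (insert b B) = (\<lambda>(c, x). c *s b + x) ` (UNIV \<times> vec.span B)"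
    proof (intro equalityI subsetI)
      fix y assume "y \<in> vec.span (insert b B)"
      then obtain c where "y - c *s b \<in> vec.span B" by (auto simp: vec.span_insert)
      then show "y \<in> (\<lambda>(c, x). c *s b + x) ` (UNIV \<times> vec.span B)"
        by (intro image_eqI[of _ _ "(c, y - c *s b)"]) auto
    next
      fix y assume "y \<in> (\<lambda>(c, x). c *s b + x) ` (UNIV \<times> vec.span B)"
      then obtain c x where "y = c *s b + x" "x \<in> vec.span B" by auto
      then show "y \<in> vec.span (insert b B)"
        by (auto simp: vec.span_insert intro!: exI[of _ c])
    qed
    moreover have "inj_on (\<lambda>(c, x). c *s b + x) (UNIV \<times> vec.span B)"
    proof (rule inj_onI, clarify)
      fix c x d y assume xy: "x \<in> vec.span B" "y \<in> vec.span B" and eq: "c *s b + x = d *s b + y"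
      have "c = d"
      proof (rule ccontr)
        assume "c \<noteq> d"
        moreover have "(c - d) *s b = y - x"
          using eq by (simp add: vec.scale_left_diff_distrib algebra_simps)
        then have "(c - d) *s b \<in> vec.span B" using vec.span_diff xy by simp
        then have "inverse (c - d) *s ((c - d) *s b) \<in> vec.span B" by (rule vec.span_scale)
        moreover have "inverse (c - d) * (c - d) = 1" using \<open>c \<noteq> d\<close> by simp
        ultimately show False using b by (simp only: vector_smult_assoc vector_smult_lid)
      qed
      then show "c = d \<and> x = y" using eq by simp
    qed
    ultimately show ?case using insert B by (simp add: card_image card_cartesian_product)
  qed simp
  obtain B where "B \<subseteq> S" "vec.independent B" "S \<subseteq> vec.span B" "card B = vec.dim S"
    using vec.basis_exists[of S] by blast
  moreover from this have "vec.span B = S" using assms vec.span_minimal by blast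
  ultimately show ?thesis using span by metis
qed

text \<open>With cardinalities in place of dimensions, later equalities of subspaces need only one
  inclusion and a count.\<close>

lemma proj_card_iff:
  fixes S :: "('a::{field,finite} ^ 'n) set"
  shows "proj_point S \<longleftrightarrow> vec.subspace S \<and> card S = CARD('a)"
    and "proj_line S \<longleftrightarrow> vec.subspace S \<and> card S = CARD('a) ^ 2"
    and "proj_plane S \<longleftrightarrow> vec.subspace S \<and> card S = CARD('a) ^ 3"
proof -
  have "CARD('a) ^ m = CARD('a) ^ n \<longleftrightarrow> m = n" for m n
    using card_field_ge_2[where 'a='a] by simp
  then have *: "card S = CARD('a) ^ n \<longleftrightarrow> vec.dim S = n" if "vec.subspace S" for n
    using card_subspace[OF that] by simp
  show "proj_point S \<longleftrightarrow> vec.subspace S \<and> card S = CARD('a)"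
    using *[of 1] by (auto simp: proj_point_def)
  show "proj_line S \<longleftrightarrow> vec.subspace S \<and> card S = CARD('a) ^ 2"
    using *[of 2] by (auto simp: proj_line_def)
  show "proj_plane S \<longleftrightarrow> vec.subspace S \<and> card S = CARD('a) ^ 3"
    using *[of 3] by (auto simp: proj_plane_def)
qed

text \<open>\<open>emb\<close> is a coordinate system of \<open>H\<close>, and \<open>n\<close>
  completes it to one of the whole space. The arc points serve as their own indices. The coordinates
  are parameters so that one arc can be described in two systems; \<open>K_eq\<close> leaves each
  \<open>r P\<close> free up to a scalar.\<close>

locale arc_coords = tangent_arc K r f
  for K :: "('a::{field,finite} ^ 4) set set" and r :: "('a ^ 4) set \<Rightarrow> 'a ^ 3" and f +
  fixes emb :: "'a ^ 3 \<Rightarrow> 'a ^ 4" and H :: "('a ^ 4) set" and n :: "'a ^ 4"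
  assumes emb_add: "emb (x + y) = emb x + emb y"
    and emb_scale: "emb (c *s x) = c *s emb x"
    and emb_inj: "inj emb"
    and range_emb: "range emb = H"
    and n_notin: "n \<notin> H"
    and K_eq: "P \<in> K \<Longrightarrow> P = range (\<lambda>c. emb (c *s r P))"
begin

lemma emb_0 [simp]: "emb 0 = 0"
  using emb_scale[of 0 0] by simp

lemma emb_eq_iff [simp]: "emb x = emb y \<longleftrightarrow> x = y"
  using emb_inj by (auto simp: inj_def)

lemma emb_in_H [simp]: "emb x \<in> H"
  using range_emb by blast

text \<open>Homogeneous coordinates in which \<open>H\<close> is the plane \<open>t = 0\<close> and
  affine points are normalised to \<open>t = 1\<close>.\<close>

definition lift :: "('a ^ 3) \<times> 'a \<Rightarrow> 'a ^ 4" where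
  "lift = (\<lambda>(x, t). emb x + t *s n)"

lemma lift_add: "lift (x, t) + lift (y, u) = lift (x + y, t + u)"
  by (simp add: lift_def emb_add vec.scale_left_distrib algebra_simps)

lemma lift_scale: "c *s lift (x, t) = lift (c *s x, c * t)"
  by (simp add: lift_def emb_scale vec.scale_right_distrib)

lemma lift_in_H: "lift (x, t) \<in> H \<longleftrightarrow> t = 0"
proof
  assume "lift (x, t) \<in> H"
  then obtain y where y: "lift (x, t) = emb y" using range_emb by blast
  show "t = 0"
  proof (rule ccontr)
    assume t: "t \<noteq> 0"
    have "lift (inverse t *s y, 0) = inverse t *s lift (x, t)"
      by (subst y) (simp add: lift_def emb_scale)
    also have "\<dots> = lift (inverse t *s x, 1)" using t by (simp add: lift_scale)
    finally have "emb (inverse t *s y) = emb (inverse t *s x) + n" by (simp add: lift_def)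
    then have "n = emb (inverse t *s y + (-1) *s (inverse t *s x))"
      unfolding emb_add emb_scale by (simp add: algebra_simps)
    then show False using n_notin by auto
  qed
qed (simp add: lift_def)

lemma inj_lift: "inj lift"
proof (rule injI, clarify)
  fix x t y u assume eq: "lift (x, t) = lift (y, u)"
  have "lift (x + (-1) *s y, t + (-1) * u) = lift (x, t) + (-1) *s lift (y, u)"
    by (simp only: lift_add lift_scale)
  also have "\<dots> = lift (0, 0)"
    unfolding eq lift_scale lift_add by simp
  finally have 0: "lift (x + (-1) *s y, t + (-1) * u) = lift (0, 0)" .
  then have "t = u"
    using lift_in_H[of "x + (-1) *s y" "t + (-1) * u"] lift_in_H[of 0 0] by simp
  then show "x = y \<and> t = u" using eq by (simp add: lift_def)
qed

lemma lift_eq_iff [simp]: "lift p = lift q \<longleftrightarrow> p = q"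
  using inj_lift by (rule inj_eq)

lemma lift_mem_iff [simp]: "lift p \<in> lift ` S \<longleftrightarrow> p \<in> S"
  by auto

lemma lift_surj: "\<exists>x t. y = lift (x, t)"
proof -
  have "range lift = UNIV"
    by (rule card_subset_eq) (simp_all add: card_image[OF inj_lift] power_Suc2[symmetric])
  then show ?thesis by (metis UNIV_I imageE surj_pair)
qed

lemma card_lift: "card (lift ` S) = card S"
  by (rule card_image) (use inj_lift inj_on_subset in blast)

lemma emb_eq_lift: "emb x = lift (x, 0)"
  by (simp add: lift_def)

lemma subspace_lift:
  assumes "(0, 0) \<in> S" "\<And>x t y u. (x, t) \<in> S \<Longrightarrow> (y, u) \<in> S \<Longrightarrow> (x + y, t + u) \<in> S"
    and "\<And>c x t. (x, t) \<in> S \<Longrightarrow> (c *s x, c * t) \<in> S"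
  shows "vec.subspace (lift ` S)"
proof (rule vec.subspaceI)
  show "0 \<in> lift ` S" using assms(1) by (intro image_eqI[of _ _ "(0, 0)"]) (auto simp: lift_def)
qed (use assms(2,3) in \<open>auto simp: lift_add lift_scale\<close>)

text \<open>Homogenisations of the affine loci \<open>f\<^sub>i x = (a, b)\<close>, \<open>x = h\<close> and \<open>f\<^sub>i\<^sub>s x = c\<close>.\<close>

definition cone_line :: "('a ^ 4) set \<times> 'a \<times> 'a \<Rightarrow> ('a ^ 4) set" where
  "cone_line = (\<lambda>(i, a, b). lift ` {(x, t). dot3 (f i True) x = t * a \<and> dot3 (f i False) x = t * b})"

definition cone_point :: "'a ^ 3 \<Rightarrow> ('a ^ 4) set" where
  "cone_point h = lift ` {(x, t). x = t *s h}"

definition cone_plane :: "('a ^ 4) set \<times> bool \<times> 'a \<Rightarrow> ('a ^ 4) set" where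
  "cone_plane = (\<lambda>(i, s, c). lift ` {(x, t). dot3 (f i s) x = t * c})"

lemma card_kernel:
  assumes "i \<in> K"
  shows "card {x. dot3 (f i s) x = c} = CARD('a) ^ 2"
proof (rule card_dot3_kernel)
  show "f i s \<noteq> 0"
    using crs_f[OF assms] r_nonzero[OF assms] by (cases s) (auto simp: vec3_defs)
qed

lemma card_cone_line: "i \<in> K \<Longrightarrow> card (cone_line (i, a, b)) = CARD('a) ^ 2"
proof -
  assume i: "i \<in> K"
  have "{(x, t). dot3 (f i True) x = t * a \<and> dot3 (f i False) x = t * b} =
    (\<Union>t. {x. dot3 (f i True) x = t * a \<and> dot3 (f i False) x = t * b} \<times> {t})"
    by auto
  also have "card \<dots> = (\<Sum>t::'a\<in>UNIV. CARD('a))"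
    by (subst card_UN_disjoint) (auto simp: card_cartesian_product card_cell_f[OF i])
  finally show ?thesis by (simp add: cone_line_def card_lift power2_eq_square)
qed

lemma card_cone_plane: "i \<in> K \<Longrightarrow> card (cone_plane (i, s, c)) = CARD('a) ^ 3"
proof -
  assume i: "i \<in> K"
  have "{(x, t). dot3 (f i s) x = t * c} = (\<Union>t. {x. dot3 (f i s) x = t * c} \<times> {t})"
    by auto
  also have "card \<dots> = (\<Sum>t::'a\<in>UNIV. CARD('a) ^ 2)"
    by (subst card_UN_disjoint) (auto simp: card_cartesian_product card_kernel[OF i])
  finally show ?thesis by (simp add: cone_plane_def card_lift power3_eq_cube power2_eq_square)
qed

lemma card_cone_point: "card (cone_point h) = CARD('a)"
proof -
  have "{(x, t). x = t *s h} = range (\<lambda>t. (t *s h, t))" by auto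
  then show ?thesis by (simp add: cone_point_def card_lift card_image inj_def)
qed

lemma subspace_cone_line: "vec.subspace (cone_line p)"
  unfolding cone_line_def by (cases p) (auto intro!: subspace_lift simp: algebra_simps)

lemma subspace_cone_point: "vec.subspace (cone_point h)"
  unfolding cone_point_def by (auto intro!: subspace_lift simp: vec.scale_left_distrib)

lemma subspace_cone_plane: "vec.subspace (cone_plane p)"
  unfolding cone_plane_def by (cases p) (auto intro!: subspace_lift simp: algebra_simps)

lemma card_less: "CARD('a) < CARD('a) ^ 2" "CARD('a) ^ 2 < CARD('a) ^ 3" "CARD('a) < CARD('a) ^ 3"
  using two_le_card power_strict_increasing_iff[of "CARD('a)" 1 2]
    power_strict_increasing_iff[of "CARD('a)" 2 3] power_strict_increasing_iff[of "CARD('a)" 1 3]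
  by simp_all

lemma card_H: "card H = CARD('a) ^ 3"
  using card_image[OF emb_inj] range_emb by simp

lemma lift_outside:
  assumes "vec.subspace S" "\<not> S \<subseteq> H"
  obtains x where "lift (x, 1) \<in> S"
proof -
  obtain y where y: "y \<in> S" "y \<notin> H" using assms by blast
  obtain x t where xt: "y = lift (x, t)" using lift_surj by blast
  then have "t \<noteq> 0" using y lift_in_H by auto
  then have "lift (inverse t *s x, 1) = inverse t *s y"
    by (simp add: xt lift_scale)
  then have "lift (inverse t *s x, 1) \<in> S" using y assms vec.subspace_scale by metis
  then show ?thesis using that by blast
qed

lemma r_in:
  assumes "i \<in> K"
  shows "emb (r i) \<in> i"
  using K_eq[OF assms] by (metis rangeI vec.scale_one)

lemma arc_point_subset_iff:
  assumes "i \<in> K" "vec.subspace S"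
  shows "i \<subseteq> S \<longleftrightarrow> emb (r i) \<in> S"
proof
  assume S: "emb (r i) \<in> S"
  show "i \<subseteq> S"
  proof
    fix y assume "y \<in> i"
    then obtain c where "y = emb (c *s r i)" using K_eq[OF assms(1)] by blast
    then show "y \<in> S" using S assms(2) by (simp add: emb_scale vec.subspace_scale)
  qed
qed (use r_in assms in blast)

text \<open>A line of the left-hand set is generated by its arc point \<open>i\<close> and one
  affine point \<open>x\<close>; the values of the tangent forms at \<open>x\<close> are the missing
  parameters \<open>a\<close> and \<open>b\<close>.\<close>

lemma lines_eq: "{l. proj_line l \<and> \<not> l \<subseteq> H \<and> (\<exists>P\<in>K. P \<subseteq> l)} = cone_line ` (K \<times> UNIV)"
proof (intro equalityI subsetI)
  fix l assume "l \<in> {l. proj_line l \<and> \<not> l \<subseteq> H \<and> (\<exists>P\<in>K. P \<subseteq> l)}"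
  then obtain i where l: "vec.subspace l" "card l = CARD('a) ^ 2" "\<not> l \<subseteq> H" and i: "i \<in> K" "i \<subseteq> l"
    by (auto simp: proj_card_iff)
  obtain x where x: "lift (x, 1) \<in> l" using lift_outside l by blast
  have "cone_line (i, dot3 (f i True) x, dot3 (f i False) x) \<subseteq> l"
  proof
    fix y assume "y \<in> cone_line (i, dot3 (f i True) x, dot3 (f i False) x)"
    then obtain z t where z: "y = lift (z, t)" "dot3 (f i True) z = t * dot3 (f i True) x"
      "dot3 (f i False) z = t * dot3 (f i False) x"
      by (auto simp: cone_line_def)
    then have "\<exists>c. z - t *s x = c *s r i" using i by (intro f_kernel) auto
    then obtain c where "z - t *s x = c *s r i" by blast
    then have "y = lift (c *s r i + t *s x, 0 + t * 1)" using z by (simp add: algebra_simps)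
    then have "y = c *s emb (r i) + t *s lift (x, 1)"
      by (simp add: emb_eq_lift lift_add lift_scale)
    then show "y \<in> l"
      using l x i arc_point_subset_iff by (simp add: vec.subspace_add vec.subspace_scale)
  qed
  then have "cone_line (i, dot3 (f i True) x, dot3 (f i False) x) = l"
    using l card_cone_line[OF i(1)] by (intro card_subset_eq) auto
  then show "l \<in> cone_line ` (K \<times> UNIV)" using i by blast
next
  fix l assume "l \<in> cone_line ` (K \<times> UNIV)"
  then obtain i a b where i: "i \<in> K" and l: "l = cone_line (i, a, b)" by auto
  obtain x where x: "dot3 (f i True) x = a \<and> dot3 (f i False) x = b" using cell_f[OF i] by blast
  have "lift (x, 1) \<in> l" "lift (x, 1) \<notin> H"
    using x by (auto simp: l cone_line_def lift_in_H)
  moreover have "i \<subseteq> l"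
    using i by (subst arc_point_subset_iff) (auto simp: l subspace_cone_line, simp add: cone_line_def emb_eq_lift)
  ultimately show "l \<in> {l. proj_line l \<and> \<not> l \<subseteq> H \<and> (\<exists>P\<in>K. P \<subseteq> l)}"
    using i card_cone_line subspace_cone_line by (auto simp: proj_card_iff l)
qed

lemma points_eq: "{A. proj_point A \<and> \<not> A \<subseteq> H} = range cone_point"
proof (intro equalityI subsetI)
  fix A assume "A \<in> {A. proj_point A \<and> \<not> A \<subseteq> H}"
  then have A: "vec.subspace A" "card A = CARD('a)" "\<not> A \<subseteq> H" by (auto simp: proj_card_iff)
  obtain x where x: "lift (x, 1) \<in> A" using lift_outside A by blast
  have "lift (t *s x, t) \<in> A" for t
    using vec.subspace_scale[OF A(1) x, of t] by (simp add: lift_scale)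
  then have "cone_point x \<subseteq> A" by (auto simp: cone_point_def)
  then have "cone_point x = A" using A card_cone_point by (intro card_subset_eq) auto
  then show "A \<in> range cone_point" by blast
next
  fix A assume "A \<in> range cone_point"
  then obtain h where h: "A = cone_point h" by blast
  have "lift (h, 1) \<in> A" "lift (h, 1) \<notin> H" by (auto simp: h cone_point_def lift_in_H)
  then show "A \<in> {A. proj_point A \<and> \<not> A \<subseteq> H}"
    using card_cone_point subspace_cone_point by (auto simp: proj_card_iff h)
qed

lemma tangent_kernel:
  assumes "i \<in> K"
  shows "tangent_line H K (emb ` {x. dot3 (f i s) x = 0})"
proof -
  let ?m = "emb ` {x. dot3 (f i s) x = 0}"
  have "?m = lift ` {(x, t). dot3 (f i s) x = 0 \<and> t = 0}"
    by (auto simp: lift_def image_iff)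
  then have sub: "vec.subspace ?m" by (auto intro!: subspace_lift)
  have "card ?m = CARD('a) ^ 2"
    using card_kernel[OF assms] card_image[OF inj_on_subset[OF emb_inj]] by simp
  moreover have "j \<subseteq> ?m \<longleftrightarrow> j = i" if "j \<in> K" for j
    using that assms f_zero_iff[of i j s]
    by (subst arc_point_subset_iff[OF that sub]) (auto simp: image_iff)
  ultimately show ?thesis
    using sub assms by (auto simp: tangent_line_def proj_card_iff)
qed

text \<open>Let \<open>u\<close> be a further vector of the tangent \<open>m\<close> at
  \<open>i\<close>. If neither form at \<open>i\<close> vanished at \<open>u\<close>, the line
  through \<open>i\<close> and \<open>u\<close> would be a secant and \<open>m\<close> would contain
  a second arc point. So one form kills \<open>u\<close>, and with it all of
  \<open>m\<close>.\<close>

lemma tangent_line_kernel: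
  assumes "tangent_line H K m"
  shows "\<exists>i\<in>K. \<exists>s. m = emb ` {x. dot3 (f i s) x = 0}"
proof -
  have m: "vec.subspace m" "card m = CARD('a) ^ 2" "m \<subseteq> H" and "\<exists>!P. P \<in> K \<and> P \<subseteq> m"
    using assms by (auto simp: tangent_line_def proj_card_iff)
  then obtain i where i: "i \<in> K" "i \<subseteq> m" and uniq: "\<And>j. j \<in> K \<Longrightarrow> j \<subseteq> m \<Longrightarrow> j = i" by blast
  have "\<not> m \<subseteq> i"
  proof
    assume "m \<subseteq> i"
    moreover have "card i \<le> CARD('a)"
      using card_image_le[of UNIV "\<lambda>c. emb (c *s r i)"] K_eq[OF i(1)] by simp
    ultimately have "card m \<le> CARD('a)" using card_mono[of i m] by simp
    then show False using m card_less by simp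
  qed
  then obtain u where u: "emb u \<in> m" "emb u \<notin> i" using m range_emb by blast
  have r_m: "emb (r i) \<in> m" using i r_in by blast
  have "dot3 (f i True) u = 0 \<or> dot3 (f i False) u = 0"
  proof (rule ccontr)
    assume nz: "\<not> (dot3 (f i True) u = 0 \<or> dot3 (f i False) u = 0)"
    then obtain j where j: "j \<in> K" "j \<noteq> i" "det3 (r i) (r j) u = 0"
      using ex1_secant[OF i(1), of u] by auto
    \<comment> \<open>This \<open>k\<close> makes both forms at \<open>i\<close> agree on
      \<open>r j\<close> and \<open>k *s u\<close>, so \<open>r j\<close> is a combination of
      \<open>r i\<close> and \<open>u\<close>.\<close>
    define k where "k = dot3 (f i True) (r j) / dot3 (f i True) u"
    have "\<exists>c. r j - k *s u = c *s r i"
      using i j nz by (intro f_kernel) (auto simp: k_def det3_f field_simps)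
    then obtain c where "r j - k *s u = c *s r i" by blast
    then have "r j = c *s r i + k *s u" by (simp add: algebra_simps)
    then have "emb (r j) \<in> m"
      using u r_m m by (simp add: emb_add emb_scale vec.subspace_add vec.subspace_scale)
    then show False using uniq[of j] j m arc_point_subset_iff by blast
  qed
  then obtain s where s: "dot3 (f i s) u = 0" by metis
  have ns: "dot3 (f i (\<not> s)) u \<noteq> 0"
  proof
    assume "dot3 (f i (\<not> s)) u = 0"
    then have "\<exists>c. u = c *s r i" using s i by (intro f_kernel) (cases s; simp)+
    then show False using u K_eq[OF i(1)] by blast
  qed
  have "emb ` {x. dot3 (f i s) x = 0} \<subseteq> m"
  proof clarify
    fix x assume x: "dot3 (f i s) x = 0"
    define k where "k = dot3 (f i (\<not> s)) x / dot3 (f i (\<not> s)) u"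
    have "dot3 (f i s) (x - k *s u) = 0" "dot3 (f i (\<not> s)) (x - k *s u) = 0"
      using x s ns by (simp_all add: k_def)
    then have "\<exists>c. x - k *s u = c *s r i" using i by (intro f_kernel) (cases s; simp)+
    then obtain c where "x - k *s u = c *s r i" by blast
    then have "x = c *s r i + k *s u" by (simp add: algebra_simps)
    then show "emb x \<in> m"
      using u r_m m by (simp add: emb_add emb_scale vec.subspace_add vec.subspace_scale)
  qed
  then have "emb ` {x. dot3 (f i s) x = 0} = m"
    using m card_kernel[OF i(1)] card_image[OF inj_on_subset[OF emb_inj]]
    by (intro card_subset_eq) auto
  then show ?thesis using i by blast
qed

lemma planes_eq:
  "{E. proj_plane E \<and> E \<noteq> H \<and> (\<exists>m. tangent_line H K m \<and> m \<subseteq> E)} = cone_plane ` (K \<times> UNIV)"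
proof (intro equalityI subsetI)
  fix E assume "E \<in> {E. proj_plane E \<and> E \<noteq> H \<and> (\<exists>m. tangent_line H K m \<and> m \<subseteq> E)}"
  then obtain m where E: "vec.subspace E" "card E = CARD('a) ^ 3" "E \<noteq> H"
    and m: "tangent_line H K m" "m \<subseteq> E"
    by (auto simp: proj_card_iff)
  obtain i s where i: "i \<in> K" and m_eq: "m = emb ` {x. dot3 (f i s) x = 0}"
    using tangent_line_kernel[OF m(1)] by blast
  have "\<not> E \<subseteq> H" using E card_H card_subset_eq[of H E] by auto
  then obtain x where x: "lift (x, 1) \<in> E" using lift_outside E by blast
  have "cone_plane (i, s, dot3 (f i s) x) \<subseteq> E"
  proof
    fix y assume "y \<in> cone_plane (i, s, dot3 (f i s) x)"
    then obtain z t where z: "y = lift (z, t)" "dot3 (f i s) z = t * dot3 (f i s) x"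
      by (auto simp: cone_plane_def)
    then have "emb (z - t *s x) \<in> E" using m m_eq by auto
    moreover have "y = emb (z - t *s x) + t *s lift (x, 1)"
      by (simp add: z emb_eq_lift lift_scale lift_add)
    ultimately show "y \<in> E" using E x by (simp add: vec.subspace_add vec.subspace_scale)
  qed
  then have "cone_plane (i, s, dot3 (f i s) x) = E"
    using E card_cone_plane[OF i] by (intro card_subset_eq) auto
  then show "E \<in> cone_plane ` (K \<times> UNIV)" using i by blast
next
  fix E assume "E \<in> cone_plane ` (K \<times> UNIV)"
  then obtain i s c where i: "i \<in> K" and E: "E = cone_plane (i, s, c)" by auto
  obtain x where "dot3 (f i True) x = c \<and> dot3 (f i False) x = c" using cell_f[OF i] by blast
  then have "dot3 (f i s) x = c" by (cases s) auto
  then have "lift (x, 1) \<in> E" "lift (x, 1) \<notin> H"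
    by (auto simp: E cone_plane_def lift_in_H)
  moreover have "emb ` {x. dot3 (f i s) x = 0} \<subseteq> E"
    by (auto simp: E cone_plane_def emb_eq_lift)
  ultimately show "E \<in> {E. proj_plane E \<and> E \<noteq> H \<and> (\<exists>m. tangent_line H K m \<and> m \<subseteq> E)}"
    using tangent_kernel[OF i] card_cone_plane[OF i] subspace_cone_plane by (auto simp: proj_card_iff E)
qed

lemma inj_cone_line: "inj_on cone_line (K \<times> UNIV)"
proof (rule inj_onI, clarify)
  fix i a b j c d assume i: "i \<in> K" and j: "j \<in> K" and eq: "cone_line (i, a, b) = cone_line (j, c, d)"
  have "lift (r i, 0) \<in> cone_line (i, a, b)" using i by (simp add: cone_line_def)
  then have "dot3 (f j True) (r i) = 0" unfolding eq by (simp add: cone_line_def)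
  then have "i = j" using f_zero_iff i j by blast
  obtain x where x: "dot3 (f i True) x = a \<and> dot3 (f i False) x = b" using cell_f[OF i] by blast
  then have "lift (x, 1) \<in> cone_line (i, a, b)" by (simp add: cone_line_def)
  then show "i = j \<and> (a, b) = (c, d)" unfolding eq using x \<open>i = j\<close> by (simp add: cone_line_def)
qed

lemma inj_cone_point: "inj cone_point"
proof (rule injI)
  fix h k assume eq: "cone_point h = cone_point k"
  have "lift (h, 1) \<in> cone_point h" by (simp add: cone_point_def)
  then show "h = k" unfolding eq by (simp add: cone_point_def)
qed

lemma inj_cone_plane: "inj_on cone_plane (K \<times> UNIV)"
proof (rule inj_onI, clarify)
  fix i s c j u d assume i: "i \<in> K" and j: "j \<in> K" and eq: "cone_plane (i, s, c) = cone_plane (j, u, d)"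
  have "lift (r i, 0) \<in> cone_plane (i, s, c)" using i by (simp add: cone_plane_def)
  then have "dot3 (f j u) (r i) = 0" unfolding eq by (simp add: cone_plane_def)
  then have ij: "i = j" using f_zero_iff i j by blast
  obtain x where x: "dot3 (f i True) x = (if s then 0 else 1) \<and> dot3 (f i False) x = (if s then 1 else 0)"
    using cell_f[OF i] by blast
  have "lift (x, 0) \<in> cone_plane (i, s, c)" using x by (cases s) (simp_all add: cone_plane_def)
  then have us: "u = s" unfolding eq using x ij by (cases s; cases u) (auto simp: cone_plane_def)
  obtain x where "dot3 (f i True) x = c \<and> dot3 (f i False) x = c" using cell_f[OF i] by blast
  then have x: "dot3 (f i s) x = c" by (cases s) auto
  then have "lift (x, 1) \<in> cone_plane (i, s, c)" by (simp add: cone_plane_def)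
  then show "i = j \<and> (s, c) = (u, d)" unfolding eq using x ij us by (simp add: cone_plane_def)
qed

text \<open>Cardinalities undo the symmetrised incidence: a line is never inside a point, nor a
  plane inside a line, so in each case one inclusion survives, and it is the equation of the model.
  They also keep the images of points and planes apart.\<close>

lemma isomorphic_model: "isomorphic_structures (arc_model K f) (arc_structure H K)"
proof -
  let ?g = "case_sum cone_point cone_plane"
  have points: "points (arc_structure H K) = cone_line ` (K \<times> UNIV)"
    by (simp add: arc_structure_def lines_eq)
  have blocks: "blocks (arc_structure H K) = range cone_point \<union> cone_plane ` (K \<times> UNIV)"
    by (simp add: arc_structure_def planes_eq points_eq)
  have "bij_betw cone_line (points (arc_model K f)) (points (arc_structure H K))"
    using inj_cone_line by (simp add: points bij_betw_def)
  moreover have "bij_betw ?g (blocks (arc_model K f)) (blocks (arc_structure H K))"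
    unfolding bij_betw_def
  proof
    have "cone_point h \<noteq> cone_plane (i, s, c)" if "i \<in> K" for h i s c
      using card_cone_point[of h] card_cone_plane[OF that, of s c] card_less(3) by (metis nat_neq_iff)
    then show "inj_on ?g (blocks (arc_model K f))"
      using inj_cone_point inj_cone_plane by (auto simp: inj_on_def) metis+
    show "?g ` blocks (arc_model K f) = blocks (arc_structure H K)"
      by (auto simp: blocks image_Un image_image)
  qed
  moreover have "incident (arc_model K f) p L \<longleftrightarrow> incident (arc_structure H K) (cone_line p) (?g L)"
    if p: "p \<in> points (arc_model K f)" and L: "L \<in> blocks (arc_model K f)" for p L
  proof -
    obtain i a b where i: "i \<in> K" and p_eq: "p = (i, a, b)" using p by auto
    have inc: "incident (arc_structure H K) (cone_line p) X \<longleftrightarrow> X \<subseteq> cone_line p \<or> cone_line p \<subseteq> X" for X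
      by (simp add: arc_structure_def)
    consider h where "L = Inl h" | j s c where "L = Inr (j, s, c)" "j \<in> K"
      using L by auto
    then show ?thesis
    proof cases
      case (1 h)
      have "\<not> cone_line p \<subseteq> cone_point h"
        using card_mono[of "cone_point h" "cone_line p"] card_cone_point card_cone_line[OF i] card_less p_eq by auto
      moreover have "cone_point h \<subseteq> cone_line p \<longleftrightarrow> dot3 (f i True) h = a \<and> dot3 (f i False) h = b"
      proof
        assume "cone_point h \<subseteq> cone_line p"
        moreover have "lift (h, 1) \<in> cone_point h" by (simp add: cone_point_def)
        ultimately have "lift (h, 1) \<in> cone_line p" by blast
        then show "dot3 (f i True) h = a \<and> dot3 (f i False) h = b" by (simp add: p_eq cone_line_def)
      qed (auto simp: cone_point_def cone_line_def p_eq)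
      ultimately show ?thesis using 1 inc by (simp add: p_eq)
    next
      case (2 j s c)
      have "\<not> cone_plane (j, s, c) \<subseteq> cone_line p"
        using card_mono[of "cone_line p" "cone_plane (j, s, c)"] card_cone_plane[OF 2(2)] card_cone_line[OF i] card_less p_eq by auto
      moreover have "cone_line p \<subseteq> cone_plane (j, s, c) \<longleftrightarrow> i = j \<and> (if s then a else b) = c"
      proof
        assume sub: "cone_line p \<subseteq> cone_plane (j, s, c)"
        have "lift (r i, 0) \<in> cone_line p" using i by (simp add: cone_line_def p_eq)
        then have "lift (r i, 0) \<in> cone_plane (j, s, c)" using sub by blast
        then have ij: "i = j" using f_zero_iff i 2(2) by (auto simp: cone_plane_def)
        obtain x where x: "dot3 (f i True) x = a \<and> dot3 (f i False) x = b"
          using cell_f[OF i] by blast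
        then have "lift (x, 1) \<in> cone_line p" by (simp add: cone_line_def p_eq)
        then have "lift (x, 1) \<in> cone_plane (j, s, c)" using sub by blast
        then show "i = j \<and> (if s then a else b) = c" using ij x by (auto simp: cone_plane_def)
      qed (auto simp: cone_plane_def cone_line_def p_eq split: if_splits)
      ultimately show ?thesis using 2 inc by (simp add: p_eq)
    qed
  qed
  ultimately show ?thesis unfolding isomorphic_structures_def by blast
qed

end

section \<open>Segre's lemma of tangents\<close>

lemma det3_dot3: "det3 u v w = dot3 (crs u v) w"
  by (simp add: vec3_defs algebra_simps)

lemma dot3_sum: "dot3 a (sum h S) = (\<Sum>x\<in>S. dot3 a (h x))"
  by (induction S rule: infinite_finite_induct) auto

text \<open>The sum is the coefficient of degree \<open>card S - 1\<close> in the Lagrange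
  interpolant of \<open>x ^ m\<close> on \<open>S\<close>. The interpolant is \<open>x ^ m\<close>
  itself, whose degree is smaller.\<close>

lemma sum_power_div_prod_diff:
  fixes S :: "'a::field set"
  assumes "finite S" "m + 2 \<le> card S"
  shows "(\<Sum>s\<in>S. s ^ m / (\<Prod>t\<in>S - {s}. s - t)) = 0"
proof -
  define w where "w s = s ^ m / (\<Prod>t\<in>S - {s}. s - t)" for s
  define L where "L s = (\<Prod>t\<in>S - {s}. [:- t, 1:])" for s
  have deg: "degree (L s) = card S - 1" if "s \<in> S" for s
    using that assms by (simp add: L_def degree_prod_eq_sum_degree)
  have "lead_coeff (L s) = 1" for s by (simp add: L_def lead_coeff_prod)
  then have coeff: "Polynomial.coeff (L s) (card S - 1) = 1" if "s \<in> S" for s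
    using deg[OF that] by metis
  have "(\<Sum>s\<in>S. Polynomial.smult (w s) (L s)) = Polynomial.monom 1 m"
  proof (rule poly_eqI_degree)
    fix x assume x: "x \<in> S"
    have "poly (L s) x = 0" if "s \<in> S" "s \<noteq> x" for s
      using that x assms by (auto simp: L_def poly_prod)
    then have "(\<Sum>s\<in>S. w s * poly (L s) x) = (\<Sum>s\<in>{x}. w s * poly (L s) x)"
      using assms x by (intro sum.mono_neutral_right) auto
    also have "\<dots> = x ^ m"
      using assms by (auto simp: w_def L_def poly_prod)
    finally show "poly (\<Sum>s\<in>S. Polynomial.smult (w s) (L s)) x = poly (Polynomial.monom 1 m) x"
      by (simp add: poly_sum poly_monom)
  next
    have "degree (\<Sum>s\<in>S. Polynomial.smult (w s) (L s)) \<le> card S - 1"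
      using deg assms by (intro degree_sum_le) (auto intro: order.trans[OF degree_smult_le])
    then show "degree (\<Sum>s\<in>S. Polynomial.smult (w s) (L s)) < card S" using assms by simp
    show "degree (Polynomial.monom (1::'a) m) < card S" using assms by (simp add: degree_monom_eq)
  qed
  then have "Polynomial.coeff (\<Sum>s\<in>S. Polynomial.smult (w s) (L s)) (card S - 1) = Polynomial.coeff (Polynomial.monom 1 m) (card S - 1)"
    by simp
  moreover have "m \<noteq> card S - 1" using assms by linarith
  ultimately show ?thesis using coeff by (simp add: coeff_sum w_def)
qed

lemma power_card_minus_1:
  fixes x :: "'a::{field,finite}"
  assumes "x \<noteq> 0"
  shows "x ^ (CARD('a) - 1) = 1"
proof -
  have "(\<Prod>u\<in>UNIV - {0}. u) = (\<Prod>u\<in>UNIV - {0}. x * u)"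
    using assms by (intro prod.reindex_bij_witness[of _ "\<lambda>u. x * u" "\<lambda>u. u / x"]) auto
  also have "\<dots> = x ^ (CARD('a) - 1) * (\<Prod>u\<in>UNIV - {0}. u)"
    by (simp add: prod.distrib card_Diff_singleton)
  finally show ?thesis by simp
qed

context tangent_arc
begin

abbreviation br :: "'i \<Rightarrow> 'i \<Rightarrow> 'i \<Rightarrow> 'a" where
  "br i j k \<equiv> det3 (r i) (r j) (r k)"

definition slope :: "'i \<Rightarrow> 'i \<Rightarrow> 'a" where
  "slope i j = dot3 (f i False) (r j) / dot3 (f i True) (r j)"

lemma bij_slope: "i \<in> I \<Longrightarrow> bij_betw (slope i) (I - {i}) (UNIV - {0})"
  using bij_ratio[of i] by (simp add: slope_def[abs_def])

text \<open>Up to one factor from \<open>j\<close> and one from \<open>k\<close>, a bracket is a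
  difference of slopes; this turns products of brackets into the denominators of interpolation in
  one variable.\<close>

lemma br_slope:
  assumes "i \<in> I" "j \<in> I - {i}" "k \<in> I - {i}"
  shows "br i j k = dot3 (f i True) (r j) * (dot3 (f i True) (r k) * (slope i k - slope i j))"
proof -
  have "dot3 (f i True) (r j) \<noteq> 0" "dot3 (f i True) (r k) \<noteq> 0"
    using assms f_nonzero by auto
  then show ?thesis using assms by (simp add: det3_f slope_def field_simps)
qed

text \<open>The product over all brackets stands in for the tangents: up to a factor that depends on
  \<open>i\<close> only, \<open>tang i j\<close> is the value at \<open>r j\<close> of the product of the two tangent forms at \<open>r i\<close>.
  Its antisymmetry is Segre's lemma of tangents.\<close>

definition tang :: "'i \<Rightarrow> 'i \<Rightarrow> 'a" where
  "tang i j = (\<Prod>k\<in>I - {i, j}. inverse (br i j k))"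

lemma br_nonzero: "\<lbrakk>i \<in> I; j \<in> I; i \<noteq> j; k \<in> I - {i, j}\<rbrakk> \<Longrightarrow> br i j k \<noteq> 0"
  using no_three by auto

lemma tang_nonzero: "\<lbrakk>i \<in> I; j \<in> I; i \<noteq> j\<rbrakk> \<Longrightarrow> tang i j \<noteq> 0"
  using fin br_nonzero[of i j] by (auto simp: tang_def)

text \<open>Each of the \<open>q - 2\<close> factors changes sign when \<open>i\<close> and
  \<open>j\<close> are exchanged, and \<open>q - 2\<close> is odd.\<close>

lemma tang_antisym:
  assumes "odd (CARD('a))" "i \<in> I" "j \<in> I" "i \<noteq> j"
  shows "tang j i = - tang i j"
proof -
  have "tang j i = (\<Prod>k\<in>I - {i, j}. - inverse (br i j k))"
    unfolding tang_def by (subst det3_swap(1)) (simp add: insert_commute)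
  also have "\<dots> = (-1) ^ card (I - {i, j}) * tang i j"
    unfolding tang_def by (subst prod_uminus) simp
  also have "card (I - {i, j}) = CARD('a) - 2"
    using assms fin card_I by (simp add: card_Diff_subset)
  also have "odd (CARD('a) - 2)" using assms two_le_card by simp
  then have "(-1) ^ (CARD('a) - 2) = (-1::'a)" by simp
  finally show ?thesis by simp
qed

text \<open>The slopes at \<open>i\<close> exhaust the nonzero field elements, so the product of all
  \<open>slope i k - slope i j\<close> is \<open>- W / slope i j\<close>, and the power
  \<open>a j ^ (CARD('a) - 2)\<close> is \<open>inverse (a j)\<close>. What is left depends on
  \<open>j\<close> only through the two tangent forms.\<close>

lemma tang_eq:
  assumes i: "i \<in> I"
  shows "\<exists>k. \<forall>j\<in>I - {i}. tang i j = k * (dot3 (f i True) (r j) * dot3 (f i False) (r j))"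
proof -
  define a where "a j = dot3 (f i True) (r j)" for j
  define A where "A = (\<Prod>k\<in>I - {i}. a k)"
  define W where "W = (\<Prod>u\<in>UNIV - {0}. u :: 'a)"
  have "tang i j = - inverse (A * W) * (a j * dot3 (f i False) (r j))" if j: "j \<in> I - {i}" for j
  proof -
    have a: "a k \<noteq> 0" if "k \<in> I - {i}" for k using that i f_nonzero by (auto simp: a_def)
    have s: "slope i j \<noteq> 0" using bij_slope[OF i] j by (auto simp: bij_betw_def)
    have card: "card (I - {i, j}) = CARD('a) - 2"
      using i j fin card_I by (auto simp: card_Diff_subset card_insert_if)
    have inj: "inj_on (slope i) (I - {i})" and img: "slope i ` (I - {i}) = UNIV - {0}"
      using bij_slope[OF i] by (auto simp: bij_betw_def)
    have set: "I - {i} - {j} = I - {i, j}" by auto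
    have "slope i ` (I - {i, j}) = UNIV - {0} - {slope i j}"
      using inj_on_image_set_diff[OF inj, of "I - {i}" "{j}"] j by (simp add: set img Diff_mono)
    moreover have "inj_on (slope i) (I - {i, j})" using inj by (rule inj_on_subset) auto
    ultimately have "(\<Prod>k\<in>I - {i, j}. slope i k - slope i j) = (\<Prod>t\<in>UNIV - {0} - {slope i j}. t - slope i j)"
      using prod.reindex[of "slope i" "I - {i, j}" "\<lambda>t. t - slope i j"] by simp
    \<comment> \<open>The shift by \<open>slope i j\<close> moves the omitted values
      \<open>0\<close> and \<open>slope i j\<close> to \<open>- slope i j\<close> and
      \<open>0\<close>.\<close>
    also have "\<dots> = (\<Prod>u\<in>UNIV - {0, - slope i j}. u)"
      by (rule prod.reindex_bij_witness[of _ "\<lambda>u. u + slope i j" "\<lambda>t. t - slope i j"])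
        (auto simp: eq_neg_iff_add_eq_0)
    finally have "(\<Prod>k\<in>I - {i, j}. slope i k - slope i j) = (\<Prod>u\<in>UNIV - {0, - slope i j}. u)" .
    moreover have "W = - slope i j * (\<Prod>u\<in>UNIV - {0, - slope i j}. u)"
    proof -
      have "UNIV - {0} - {- slope i j} = UNIV - {0, - slope i j}" by auto
      then show ?thesis
        unfolding W_def using s by (subst prod.remove[of _ "- slope i j"]) auto
    qed
    ultimately have diffs: "(\<Prod>k\<in>I - {i, j}. slope i k - slope i j) = - W / slope i j"
      using s by (simp add: field_simps)
    have "A = a j * (\<Prod>k\<in>I - {i} - {j}. a k)"
      unfolding A_def using j fin by (intro prod.remove) auto
    moreover have "I - {i} - {j} = I - {i, j}" by auto
    ultimately have rest: "(\<Prod>k\<in>I - {i, j}. a k) = A / a j" using a[OF j] by (simp add: field_simps)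
    have "(\<Prod>k\<in>I - {i, j}. br i j k) = (\<Prod>k\<in>I - {i, j}. a j * (a k * (slope i k - slope i j)))"
      using i j by (intro prod.cong) (auto simp: br_slope a_def)
    also have "\<dots> = a j ^ (CARD('a) - 2) * (A / a j * (- W / slope i j))"
      by (simp only: prod.distrib diffs rest prod_constant card)
    also have "a j ^ (CARD('a) - 2) = inverse (a j)"
    proof -
      have "CARD('a) - 1 = Suc (CARD('a) - 2)" using two_le_card by simp
      then have "a j * a j ^ (CARD('a) - 2) = 1"
        using power_card_minus_1[OF a[OF j]] by (simp del: One_nat_def)
      then show ?thesis by (rule inverse_unique[symmetric])
    qed
    finally have "inverse (\<Prod>k\<in>I - {i, j}. br i j k) =
      inverse (inverse (a j) * (A / a j * (- W / slope i j)))" by simp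
    also have "\<dots> = - inverse (A * W) * (a j * dot3 (f i False) (r j))"
      using a[OF j] by (simp add: slope_def a_def field_simps)
    finally show ?thesis by (simp add: tang_def prod_inversef[symmetric])
  qed
  then show ?thesis unfolding a_def by blast
qed

text \<open>The tangent product times the interpolation weight of the node \<open>j\<close> in the
  pencil at \<open>i\<close>. The value 0 on the diagonal lets sums run over all of \<open>A\<close>
  and fits antisymmetry.\<close>

definition lagrange_wt :: "'i set \<Rightarrow> 'i \<Rightarrow> 'i \<Rightarrow> 'a" where
  "lagrange_wt A i j = (if i = j then 0 else tang i j / (\<Prod>k\<in>A - {i, j}. br i j k))"

lemma lagrange_wt_nonzero:
  assumes "A \<subseteq> I" "i \<in> A" "j \<in> A" "i \<noteq> j"
  shows "lagrange_wt A i j \<noteq> 0"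
  using assms tang_nonzero[of i j] br_nonzero[of i j] fin finite_subset[OF assms(1)]
  by (auto simp: lagrange_wt_def)

lemma lagrange_wt_remove:
  assumes "A \<subseteq> I" "i \<in> A" "j \<in> A" "z \<in> A" "z \<noteq> i" "z \<noteq> j"
  shows "lagrange_wt (A - {z}) i j = lagrange_wt A i j * br i j z"
proof (cases "i = j")
  case False
  have "finite A" using assms fin finite_subset by blast
  then have "(\<Prod>k\<in>A - {i, j}. br i j k) = br i j z * (\<Prod>k\<in>A - {i, j} - {z}. br i j k)"
    using assms by (intro prod.remove) auto
  moreover have "A - {i, j} - {z} = A - {z} - {i, j}" by auto
  moreover have "br i j z \<noteq> 0" using assms False no_three by blast
  ultimately show ?thesis using False by (simp add: lagrange_wt_def field_simps)
qed (simp add: lagrange_wt_def)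

text \<open>With six points the denominator has four factors and keeps its sign, so the sign of
  \<open>tang\<close> survives.\<close>

lemma lagrange_wt_antisym:
  assumes "odd (CARD('a))" "A \<subseteq> I" "card A = 6" "i \<in> A" "j \<in> A"
  shows "lagrange_wt A j i = - lagrange_wt A i j"
proof (cases "i = j")
  case False
  have fA: "finite A" using assms fin finite_subset by blast
  have "(\<Prod>k\<in>A - {i, j}. br j i k) = (\<Prod>k\<in>A - {i, j}. - br i j k)"
    by (subst det3_swap(1)) simp
  also have "\<dots> = (-1) ^ card (A - {i, j}) * (\<Prod>k\<in>A - {i, j}. br i j k)"
    by (rule prod_uminus)
  also have "card (A - {i, j}) = 4" using assms fA False by (simp add: card_Diff_subset)
  finally show ?thesis
    using False tang_antisym[of i j] assms by (simp add: lagrange_wt_def insert_commute subset_iff)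
qed (simp add: lagrange_wt_def)

text \<open>After the powers of \<open>a j\<close> cancel, the numerator is a power of the slope:
  one factor from the tangent product and a second one for \<open>f i False\<close>. The other five
  points are the nodes, and exponents 1 and 2 are small enough for the interpolation sum to
  vanish.\<close>

lemma lagrange_wt_six_forms:
  assumes A: "A \<subseteq> I" "card A = 6" and i: "i \<in> A"
  shows "(\<Sum>j\<in>A. lagrange_wt A i j * dot3 (f i s) (r j)) = 0"
proof -
  have iI: "i \<in> I" and fA: "finite A" using A i fin finite_subset by auto
  obtain k where k: "\<And>j. j \<in> I - {i} \<Longrightarrow>
    tang i j = k * (dot3 (f i True) (r j) * dot3 (f i False) (r j))"
    using tang_eq[OF iI] by blast
  define a where "a j = dot3 (f i True) (r j)" for j
  define P where "P = (\<Prod>k\<in>A - {i}. a k)"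
  define S where "S = slope i ` (A - {i})"
  have inj: "inj_on (slope i) (A - {i})"
    using bij_slope[OF iI] A by (auto simp: bij_betw_def intro: inj_on_subset)
  have cardS: "card S = 5" using A i fA by (simp add: S_def card_image[OF inj])
  have eq: "lagrange_wt A i j * dot3 (f i s) (r j) =
      k / P * (slope i j ^ (if s then 1 else 2) / (\<Prod>t\<in>S - {slope i j}. slope i j - t))"
    if j: "j \<in> A - {i}" for j
  proof -
    have anz: "a l \<noteq> 0" if "l \<in> A - {i}" for l using that A iI f_nonzero by (auto simp: a_def)
    have card: "card (A - {i, j}) = 4" using A i j fA by (auto simp: card_Diff_subset card_insert_if)
    have set: "A - {i} - {j} = A - {i, j}" by auto
    have "P = a j * (\<Prod>k\<in>A - {i} - {j}. a k)"
      unfolding P_def using j fA by (intro prod.remove) auto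
    then have rest: "(\<Prod>k\<in>A - {i, j}. a k) = P / a j" using anz[OF j] set by (simp add: field_simps)
    have "S - {slope i j} = slope i ` (A - {i, j})"
      using inj_on_image_set_diff[OF inj, of "A - {i}" "{j}"] j by (simp add: S_def set Diff_mono)
    moreover have "inj_on (slope i) (A - {i, j})" using inj by (rule inj_on_subset) auto
    ultimately have "(\<Prod>t\<in>S - {slope i j}. slope i j - t) = (\<Prod>l\<in>A - {i, j}. slope i j - slope i l)"
      by (simp add: prod.reindex)
    also have "\<dots> = (\<Prod>l\<in>A - {i, j}. - (slope i l - slope i j))" by simp
    also have "\<dots> = (\<Prod>l\<in>A - {i, j}. slope i l - slope i j)"
      by (subst prod_uminus) (simp add: card)
    finally have diffs: "(\<Prod>l\<in>A - {i, j}. slope i l - slope i j) =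
      (\<Prod>t\<in>S - {slope i j}. slope i j - t)" ..
    have "(\<Prod>l\<in>A - {i, j}. br i j l) = (\<Prod>l\<in>A - {i, j}. a j * (a l * (slope i l - slope i j)))"
      using A i j by (intro prod.cong) (auto simp: br_slope a_def iI subsetD[OF A(1)])
    also have "\<dots> = a j ^ 4 * (P / a j * (\<Prod>t\<in>S - {slope i j}. slope i j - t))"
      by (simp only: prod.distrib diffs rest prod_constant card)
    finally have "lagrange_wt A i j = tang i j / (a j ^ 4 * (P / a j * (\<Prod>t\<in>S - {slope i j}. slope i j - t)))"
      using j by (auto simp: lagrange_wt_def)
    moreover have "dot3 (f i False) (r j) = a j * slope i j"
      using anz[OF j] by (simp add: slope_def a_def)
    moreover have "tang i j = k * (a j * dot3 (f i False) (r j))"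
      using k[of j] j A by (auto simp: a_def)
    ultimately show ?thesis
      using anz[OF j]
      by (cases s) (simp_all add: a_def[symmetric] power2_eq_square eval_nat_numeral)
  qed
  have "(\<Sum>j\<in>A. lagrange_wt A i j * dot3 (f i s) (r j)) = (\<Sum>j\<in>A - {i}. lagrange_wt A i j * dot3 (f i s) (r j))"
    using fA by (intro sum.mono_neutral_right) (auto simp: lagrange_wt_def)
  also have "\<dots> = (\<Sum>j\<in>A - {i}. k / P * (slope i j ^ (if s then 1 else 2) /
      (\<Prod>t\<in>S - {slope i j}. slope i j - t)))"
    using eq by (intro sum.cong) auto
  also have "\<dots> = k / P * (\<Sum>u\<in>S. u ^ (if s then 1 else 2) / (\<Prod>t\<in>S - {u}. u - t))"
    unfolding S_def by (simp add: sum.reindex[OF inj] sum_distrib_left)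
  also have "(\<Sum>u\<in>S. u ^ (if s then 1 else 2) / (\<Prod>t\<in>S - {u}. u - t)) = 0"
    using cardS fA by (intro sum_power_div_prod_diff) (auto simp: S_def)
  finally show ?thesis by simp
qed

text \<open>The diagonal entry at \<open>i\<close>: the weighted sum is killed by both tangent forms
  at \<open>i\<close> and is therefore a multiple of \<open>r i\<close>.\<close>

definition rel_coeff :: "'i set \<Rightarrow> 'i \<Rightarrow> 'a" where
  "rel_coeff A i = (SOME d. (\<Sum>j\<in>A. lagrange_wt A i j *s r j) = d *s r i)"

lemma sum_lagrange_wt_six:
  assumes "A \<subseteq> I" "card A = 6" "i \<in> A"
  shows "(\<Sum>j\<in>A. lagrange_wt A i j *s r j) = rel_coeff A i *s r i"
proof -
  have "\<exists>d. (\<Sum>j\<in>A. lagrange_wt A i j *s r j) = d *s r i"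
    using assms lagrange_wt_six_forms[OF assms] by (intro f_kernel) (auto simp: dot3_sum)
  then show ?thesis unfolding rel_coeff_def by (rule someI_ex)
qed

lemma sum_lagrange_wt_six_dot3:
  assumes "A \<subseteq> I" "card A = 6" "i \<in> A"
  shows "(\<Sum>j\<in>A. lagrange_wt A i j * dot3 w (r j)) = rel_coeff A i * dot3 w (r i)"
  using arg_cong[OF sum_lagrange_wt_six[OF assms], of "dot3 w"] by (simp add: dot3_sum)

end

section \<open>Conics through the points of an arc\<close>

lemma two_neq_zero:
  assumes "odd (CARD('a::{field,finite}))"
  shows "(2::'a) \<noteq> 0"
proof
  assume "(2::'a) = 0"
  then have "CHAR('a) dvd 2" by (simp flip: of_nat_eq_0_iff_char_dvd)
  moreover have "CHAR('a) \<noteq> 1" by simp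
  ultimately have "CHAR('a) = 2" using prime_nat_iff two_is_prime_nat by blast
  then show False using CHAR_dvd_CARD[where 'a='a] assms by simp
qed

lemma distinct_list_of_card:
  assumes "card A = n" "n > 0"
  obtains xs where "set xs = A" "distinct xs" "length xs = n"
  using assms finite_distinct_list[of A] by (metis card_ge_0_finite distinct_card)

context tangent_arc
begin

text \<open>Two line pairs through \<open>a\<close>, \<open>b\<close>, \<open>c\<close>,
  \<open>e\<close> span the conics through these points. The condition \<open>l \<noteq> 0\<close>
  serves below to exclude the zero member.\<close>

definition pencil :: "'a \<Rightarrow> 'a \<Rightarrow> 'i \<Rightarrow> 'i \<Rightarrow> 'i \<Rightarrow> 'i \<Rightarrow> 'i \<Rightarrow> 'a" where
  "pencil l m a b c e y = l * (br a b y * br c e y) + m * (br a c y * br b e y)"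

lemma pencil_base [simp]:
  "pencil l m a b c e a = 0" "pencil l m a b c e b = 0"
  "pencil l m a b c e c = 0" "pencil l m a b c e e = 0"
  by (simp_all add: pencil_def)

text \<open>The same conic read from \<open>b\<close> as leading base point, so that relations
  centred at two different points can be tested on one conic.\<close>

lemma pencil_swap: "pencil l m b a e c y = pencil l m a b c e y"
  by (simp add: pencil_def det3_swap(1)[of "r b" "r a"] det3_swap(1)[of "r e" "r c"])

text \<open>Inserting the six-point relations gives a double sum over an antisymmetric matrix, so
  exchanging \<open>v\<close> and \<open>w\<close> changes its sign; yet the sum is symmetric in
  \<open>v\<close> and \<open>w\<close>, and 2 is invertible. Since products of linear forms span
  the quadratic forms, the relation holds for every conic.\<close>

lemma sum_rel_coeff_forms:
  assumes odd: "odd (CARD('a))" and A: "A \<subseteq> I" "card A = 6"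
  shows "(\<Sum>i\<in>A. rel_coeff A i * (dot3 v (r i) * dot3 w (r i))) = 0"
proof -
  define T where "T v w = (\<Sum>i\<in>A. rel_coeff A i * (dot3 v (r i) * dot3 w (r i)))" for v w
  have T: "T v w = (\<Sum>i\<in>A. \<Sum>j\<in>A. lagrange_wt A i j * dot3 v (r j) * dot3 w (r i))" for v w
    unfolding T_def
    by (intro sum.cong refl)
      (use sum_lagrange_wt_six_dot3[OF A] in \<open>simp add: sum_distrib_right[symmetric] mult.assoc[symmetric]\<close>)
  have "T v w = (\<Sum>j\<in>A. \<Sum>i\<in>A. lagrange_wt A i j * dot3 v (r j) * dot3 w (r i))"
    unfolding T by (rule sum.swap)
  also have "\<dots> = (\<Sum>j\<in>A. \<Sum>i\<in>A. - (lagrange_wt A j i * dot3 w (r i) * dot3 v (r j)))"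
  proof (intro sum.cong refl)
    fix i j assume "i \<in> A" "j \<in> A"
    then have "lagrange_wt A j i = - lagrange_wt A i j" by (rule lagrange_wt_antisym[OF odd A])
    then show "lagrange_wt A i j * dot3 v (r j) * dot3 w (r i) = - (lagrange_wt A j i * dot3 w (r i) * dot3 v (r j))"
      by simp
  qed
  also have "\<dots> = - T w v" unfolding T by (simp add: sum_negf)
  also have "T w v = T v w" by (simp add: T_def mult.commute)
  finally have "T v w + T v w = 0" by (simp only: eq_neg_iff_add_eq_0)
  then have "2 * T v w = 0" by (simp only: mult_2)
  then show ?thesis using two_neq_zero[OF odd] by (simp add: T_def)
qed

lemma sum_rel_coeff_brackets:
  assumes "odd (CARD('a))" "A \<subseteq> I" "card A = 6"
  shows "(\<Sum>i\<in>A. rel_coeff A i * (br a b i * br c e i)) = 0"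
  using sum_rel_coeff_forms[OF assms] by (simp add: det3_dot3)

text \<open>The conic isolates the coefficient of the point \<open>k\<close> that it misses. With
  this coefficient gone, a pair of lines through four of the other points isolates the coefficient
  of the fifth.\<close>

lemma rel_coeff_zero:
  assumes odd: "odd (CARD('a))" and A: "A \<subseteq> I" "card A = 6"
    and k: "k \<in> A" "pencil l m a b c e k \<noteq> 0"
    and vanish: "\<And>j. j \<in> A - {k} \<Longrightarrow> pencil l m a b c e j = 0"
    and i: "i \<in> A"
  shows "rel_coeff A i = 0"
proof -
  have fA: "finite A" using A by (simp add: card_ge_0_finite)
  have "0 = l * (\<Sum>j\<in>A. rel_coeff A j * (br a b j * br c e j)) + m * (\<Sum>j\<in>A. rel_coeff A j * (br a c j * br b e j))"
    using sum_rel_coeff_brackets[OF odd A] by simp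
  also have "\<dots> = (\<Sum>j\<in>A. rel_coeff A j * pencil l m a b c e j)"
    by (simp add: pencil_def sum_distrib_left sum.distrib[symmetric] algebra_simps)
  also have "\<dots> = (\<Sum>j\<in>{k}. rel_coeff A j * pencil l m a b c e j)"
    using fA k(1) vanish by (intro sum.mono_neutral_right) auto
  finally have k0: "rel_coeff A k = 0" using k(2) by simp
  show ?thesis
  proof (cases "i = k")
    case False
    then have "card (A - {i, k}) = 4" using A i k fA by (simp add: card_Diff_subset)
    then obtain xs where xs: "set xs = A - {i, k}" "distinct xs" "length xs = 4"
      by (rule distinct_list_of_card) simp_all
    then obtain p q s t where "xs = [p, q, s, t]"
      by (auto simp: eval_nat_numeral length_Suc_conv)
    then have pqst: "A - {i, k} = {p, q, s, t}" "distinct [p, q, s, t]" using xs by auto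
    then have mem: "{p, q, s, t} \<subseteq> A - {i, k}" by blast
    have "0 = (\<Sum>j\<in>A. rel_coeff A j * (br p q j * br s t j))" using sum_rel_coeff_brackets[OF odd A] by simp
    also have "\<dots> = (\<Sum>j\<in>{i}. rel_coeff A j * (br p q j * br s t j))"
    proof (intro sum.mono_neutral_right ballI)
      fix j assume "j \<in> A - {i}"
      then have "j = k \<or> j \<in> {p, q, s, t}" using pqst by blast
      then show "rel_coeff A j * (br p q j * br s t j) = 0" using k0 by auto
    qed (use i fA in auto)
    finally have "rel_coeff A i * (br p q i * br s t i) = 0" by simp
    moreover have "br p q i \<noteq> 0" "br s t i \<noteq> 0"
      using mem pqst(2) A i by (intro no_three; auto)+
    ultimately show ?thesis by simp
  qed (use k0 in simp)
qed

text \<open>Dropping \<open>b\<close> multiplies each weight by a bracket with \<open>b\<close>, so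
  the relation of the remaining six points extends to all seven with a zero term at
  \<open>b\<close>.\<close>

lemma sum_lagrange_wt_seven:
  assumes A: "A \<subseteq> I" "card A = 7" and x: "x \<in> A" "b \<in> A" "b \<noteq> x" and d: "rel_coeff (A - {b}) x = 0"
  shows "(\<Sum>y\<in>A. lagrange_wt A x y * (br x b y * dot3 w (r y))) = 0"
proof -
  have fA: "finite A" using A by (simp add: card_ge_0_finite)
  have "(\<Sum>y\<in>A. lagrange_wt A x y * (br x b y * dot3 w (r y))) =
    (\<Sum>y\<in>A - {b}. lagrange_wt A x y * (br x b y * dot3 w (r y)))"
    using fA x by (intro sum.mono_neutral_right) auto
  also have "\<dots> = (\<Sum>y\<in>A - {b}. - (lagrange_wt (A - {b}) x y * dot3 w (r y)))"
  proof (intro sum.cong refl)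
    fix y assume y: "y \<in> A - {b}"
    have "lagrange_wt (A - {b}) x y = lagrange_wt A x y * br x y b" using A x y by (intro lagrange_wt_remove) auto
    then show "lagrange_wt A x y * (br x b y * dot3 w (r y)) = - (lagrange_wt (A - {b}) x y * dot3 w (r y))"
      by (simp add: det3_swap(2)[of "r x" "r b" "r y"])
  qed
  also have "\<dots> = - (rel_coeff (A - {b}) x * dot3 w (r x))"
    unfolding sum_negf using A x by (subst sum_lagrange_wt_six_dot3) auto
  finally show ?thesis by (simp add: d)
qed

text \<open>One line pair contains the bracket that comes from dropping \<open>b\<close>, the other
  the one from dropping \<open>c\<close>; the remaining line of each pair is the free linear
  form.\<close>

lemma sum_lagrange_wt_pencil:
  assumes "A \<subseteq> I" "card A = 7" "x \<in> A" "b \<in> A" "b \<noteq> x" "c \<in> A" "c \<noteq> x"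
    and "rel_coeff (A - {b}) x = 0" "rel_coeff (A - {c}) x = 0"
  shows "(\<Sum>y\<in>A. lagrange_wt A x y * pencil l m x b c e y) = 0"
proof -
  have "(\<Sum>y\<in>A. lagrange_wt A x y * pencil l m x b c e y) =
    l * (\<Sum>y\<in>A. lagrange_wt A x y * (br x b y * dot3 (crs (r c) (r e)) (r y))) +
    m * (\<Sum>y\<in>A. lagrange_wt A x y * (br x c y * dot3 (crs (r b) (r e)) (r y)))"
    by (simp add: pencil_def det3_dot3[of "r c" "r e"] det3_dot3[of "r b" "r e"]
        sum_distrib_left sum.distrib[symmetric] algebra_simps)
  then show ?thesis using assms by (simp add: sum_lagrange_wt_seven)
qed

text \<open>If \<open>w\<close> were off the conic, it would be the one point missed by the conic
  even after \<open>b\<close> or \<open>c\<close> is dropped, so both coefficients at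
  \<open>a\<close> vanish. The relation at \<open>a\<close> tested on the conic then consists of the
  nonzero term at \<open>w\<close>.\<close>

lemma pencil_seven:
  assumes odd: "odd (CARD('a))" and I: "{a, b, c, e, u, v, w} \<subseteq> I"
    and dist: "distinct [a, b, c, e, u, v, w]"
    and uv: "pencil l m a b c e u = 0" "pencil l m a b c e v = 0"
  shows "pencil l m a b c e w = 0"
proof (rule ccontr)
  let ?A = "{a, b, c, e, u, v, w}"
  assume w: "pencil l m a b c e w \<noteq> 0"
  have zero: "pencil l m a b c e j = 0" if "j \<in> ?A - {w}" for j
    using that uv by auto
  have card: "card ?A = 7" using dist by simp
  have d: "rel_coeff (?A - {z}) a = 0" if z: "z \<in> {b, c}" for z
  proof (rule rel_coeff_zero[OF odd _ _ _ w])
    show "?A - {z} \<subseteq> I" using I by blast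
    have "z \<in> ?A" using z by blast
    then show "card (?A - {z}) = 6" using card by (simp add: card_Diff_singleton)
    show "w \<in> ?A - {z}" "a \<in> ?A - {z}" using z dist by auto
    show "\<And>j. j \<in> ?A - {z} - {w} \<Longrightarrow> pencil l m a b c e j = 0" using zero by blast
  qed
  have "0 = (\<Sum>y\<in>?A. lagrange_wt ?A a y * pencil l m a b c e y)"
    using dist by (intro sum_lagrange_wt_pencil[symmetric] I card d) auto
  also have "\<dots> = (\<Sum>y\<in>{w}. lagrange_wt ?A a y * pencil l m a b c e y)"
    using zero by (intro sum.mono_neutral_right) auto
  finally have "lagrange_wt ?A a w = 0" using w by simp
  then show False using lagrange_wt_nonzero[OF I, of a w] dist by auto
qed

text \<open>If no six arc points are on a conic, every \<open>rel_coeff\<close> vanishes. The conic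
  through \<open>x\<close>, \<open>x'\<close>, \<open>p\<close>, \<open>q\<close>, \<open>s\<close>
  leaves only the terms at \<open>y\<close> and \<open>y'\<close> in the relations at
  \<open>x\<close> and \<open>x'\<close>, and eliminating its two values gives a 2 by 2
  minor.\<close>

lemma lagrange_wt_exchange:
  assumes A: "{x, x', y, y', p, q, s} \<subseteq> I" and dist: "distinct [x, x', y, y', p, q, s]"
    and none: "\<And>a b c e u v l m. distinct [a, b, c, e, u, v] \<Longrightarrow> {a, b, c, e, u, v} \<subseteq> I \<Longrightarrow>
      pencil l m a b c e u = 0 \<Longrightarrow> pencil l m a b c e v = 0 \<Longrightarrow> l = 0"
    and odd: "odd (CARD('a))"
  shows "lagrange_wt {x, x', y, y', p, q, s} x y * lagrange_wt {x, x', y, y', p, q, s} x' y' =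
    lagrange_wt {x, x', y, y', p, q, s} x y' * lagrange_wt {x, x', y, y', p, q, s} x' y"
proof -
  let ?A = "{x, x', y, y', p, q, s}"
  have card: "card ?A = 7" using dist by simp
  have d: "rel_coeff B i = 0" if B: "B \<subseteq> I" "card B = 6" "i \<in> B" for B i
  proof -
    obtain xs where xs: "set xs = B" "distinct xs" "length xs = 6"
      using B(2) by (rule distinct_list_of_card) simp_all
    then obtain a b c e u v where "xs = [a, b, c, e, u, v]"
      by (auto simp: eval_nat_numeral length_Suc_conv)
    then have abc: "B = {a, b, c, e, u, v}" "distinct [a, b, c, e, u, v]" using xs by auto
    define l where "l = br a c u * br b e u"
    define m where "m = - (br a b u * br c e u)"
    have "br a c u \<noteq> 0" "br b e u \<noteq> 0"
      using abc B(1) by (intro no_three; auto)+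
    then have l: "l \<noteq> 0" by (simp add: l_def)
    have u: "pencil l m a b c e u = 0" by (simp add: pencil_def l_def m_def)
    have v: "pencil l m a b c e v \<noteq> 0" using none[of a b c e u v l m] abc B(1) u l by blast
    show ?thesis
      by (rule rel_coeff_zero[OF odd B(1,2) _ v _ B(3)]) (use u abc in auto)
  qed
  define l where "l = br x p s * br x' q s"
  define m where "m = - (br x x' s * br p q s)"
  have "br x p s \<noteq> 0" "br x' q s \<noteq> 0"
    using A dist by (intro no_three; auto)+
  then have l: "l \<noteq> 0" by (simp add: l_def)
  let ?C = "pencil l m x x' p q"
  have s: "?C s = 0" by (simp add: pencil_def l_def m_def)
  have y: "?C y \<noteq> 0" and y': "?C y' \<noteq> 0"
    using none[of x x' p q s y l m] none[of x x' p q s y' l m] A dist s l by auto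
  have two: "lagrange_wt ?A i y * ?C y + lagrange_wt ?A i y' * ?C y' = 0"
    if "(\<Sum>z\<in>?A. lagrange_wt ?A i z * ?C z) = 0" for i
  proof -
    have "(\<Sum>z\<in>?A. lagrange_wt ?A i z * ?C z) = (\<Sum>z\<in>{y, y'}. lagrange_wt ?A i z * ?C z)"
      using s by (intro sum.mono_neutral_right) auto
    then show ?thesis using that dist by simp
  qed
  have dA: "rel_coeff (?A - {z}) i = 0" if "z \<in> ?A" "i \<in> ?A" "z \<noteq> i" for z i
    using that A card by (intro d) (auto simp: card_Diff_singleton)
  have 1: "lagrange_wt ?A x y * ?C y + lagrange_wt ?A x y' * ?C y' = 0"
    using dist by (intro two sum_lagrange_wt_pencil A card dA) auto
  have "(\<Sum>z\<in>?A. lagrange_wt ?A x' z * pencil l m x' x q p z) = 0"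
    using dist by (intro sum_lagrange_wt_pencil A card dA) auto
  then have 2: "lagrange_wt ?A x' y * ?C y + lagrange_wt ?A x' y' * ?C y' = 0"
    by (intro two) (simp only: pencil_swap)
  have "(lagrange_wt ?A x y * lagrange_wt ?A x' y') * (?C y * ?C y') = (lagrange_wt ?A x y * ?C y) * (lagrange_wt ?A x' y' * ?C y')"
    by (simp only: ac_simps)
  also have "\<dots> = (- (lagrange_wt ?A x y' * ?C y')) * (- (lagrange_wt ?A x' y * ?C y))"
    using eq_neg_iff_add_eq_0[THEN iffD2, OF 1]
      eq_neg_iff_add_eq_0[THEN iffD2, OF 2[unfolded add.commute[of "lagrange_wt ?A x' y * ?C y"]]]
    by (simp only:)
  also have "\<dots> = (lagrange_wt ?A x y' * lagrange_wt ?A x' y) * (?C y * ?C y')" by (simp only: minus_mult_minus ac_simps)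
  finally show ?thesis using y y' by simp
qed

text \<open>If no six points lay on a conic, the exchange relation for the sets \<open>A - {z}\<close> with
  \<open>card A = 8\<close> would give the points \<open>z\<close> one and the same cross ratio on \<open>x, x', y, y'\<close>,
  which puts six points on a conic.\<close>

lemma six_on_conic:
  assumes odd: "odd (CARD('a))" and big: "8 \<le> CARD('a)"
  shows "\<exists>a b c e u v l m. distinct [a, b, c, e, u, v] \<and> {a, b, c, e, u, v} \<subseteq> I \<and>
    pencil l m a b c e u = 0 \<and> pencil l m a b c e v = 0 \<and> l \<noteq> 0" (is ?ex)
proof (rule ccontr)
  assume "\<not> ?ex"
  have none: "l = 0" if "distinct [a, b, c, e, u, v]" "{a, b, c, e, u, v} \<subseteq> I"
    "pencil l m a b c e u = 0" "pencil l m a b c e v = 0" for a b c e u v l m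
  proof (rule ccontr)
    assume "l \<noteq> 0"
    with that have ?ex
      by (intro exI[of _ a] exI[of _ b] exI[of _ c] exI[of _ e] exI[of _ u] exI[of _ v]
        exI[of _ l] exI[of _ m] conjI)
    with \<open>\<not> ?ex\<close> show False by contradiction
  qed
  obtain A where A: "A \<subseteq> I" "card A = 8"
    using obtain_subset_with_card_n[of 8 I] big card_I by auto
  obtain ys where ys: "set ys = A" "distinct ys" "length ys = 8"
    using A(2) by (rule distinct_list_of_card) simp_all
  then obtain x x' y y' z w p q where "ys = [x, x', y, y', z, w, p, q]"
    by (auto simp: eval_nat_numeral length_Suc_conv)
  then have xs: "A = {x, x', y, y', z, w, p, q}" "distinct [x, x', y, y', z, w, p, q]"
    using ys by auto
  have ex: "lagrange_wt A x y * br x y z * (lagrange_wt A x' y' * br x' y' z) =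
      lagrange_wt A x y' * br x y' z * (lagrange_wt A x' y * br x' y z)"
    if z: "A = {x, x', y, y', z, w, p, q}" "distinct [x, x', y, y', z, w, p, q]" for z w p q
  proof -
    have B: "{x, x', y, y', w, p, q} = A - {z}" using z by auto
    have "lagrange_wt (A - {z}) x y * lagrange_wt (A - {z}) x' y' = lagrange_wt (A - {z}) x y' * lagrange_wt (A - {z}) x' y"
      unfolding B[symmetric]
    proof (rule lagrange_wt_exchange[OF _ _ none odd])
      show "{x, x', y, y', w, p, q} \<subseteq> I" using B A(1) by blast
      show "distinct [x, x', y, y', w, p, q]" using z(2) by simp
    qed
    moreover have "lagrange_wt (A - {z}) i j = lagrange_wt A i j * br i j z" if "i \<in> {x, x'}" "j \<in> {y, y'}" for i j
      using that z A by (intro lagrange_wt_remove) auto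
    ultimately show ?thesis by simp
  qed
  have "A = {x, x', y, y', w, z, p, q}" "distinct [x, x', y, y', w, z, p, q]" using xs by auto
  note e = ex[OF xs] ex[OF this]
  have mem: "x \<in> A" "x' \<in> A" "y \<in> A" "y' \<in> A" "z \<in> A" "w \<in> A"
    unfolding xs(1) by simp_all
  have ne: "x \<noteq> y" "x' \<noteq> y'" "x \<noteq> y'" "x' \<noteq> y" "x \<noteq> z" "y \<noteq> z" "x' \<noteq> z" "y' \<noteq> z"
    and dist: "distinct [x, y, y', x', z, w]"
    using xs(2) by auto
  let ?P = "lagrange_wt A x y * lagrange_wt A x' y'" and ?Q = "lagrange_wt A x y' * lagrange_wt A x' y"
  have nz: "?P \<noteq> 0" "?Q \<noteq> 0"
    using lagrange_wt_nonzero[OF A(1)] mem ne by simp_all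
  \<comment> \<open>The relation for \<open>z\<close> is multiplied by the relation for
    \<open>w\<close> read backwards; then all weights stand on both sides and cancel.\<close>
  have "?P * ?Q * ((br x y z * br x' y' z) * (br x y' w * br x' y w)) =
    (lagrange_wt A x y * br x y z * (lagrange_wt A x' y' * br x' y' z)) * (lagrange_wt A x y' * br x y' w * (lagrange_wt A x' y * br x' y w))"
    by (simp only: ac_simps)
  also have "\<dots> = (lagrange_wt A x y' * br x y' z * (lagrange_wt A x' y * br x' y z)) * (lagrange_wt A x y * br x y w * (lagrange_wt A x' y' * br x' y' w))"
    by (simp only: e)
  also have "\<dots> = ?P * ?Q * ((br x y w * br x' y' w) * (br x y' z * br x' y z))"
    by (simp only: ac_simps)
  finally have "?P * ?Q * ((br x y z * br x' y' z) * (br x y' w * br x' y w)) =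
    ?P * ?Q * ((br x y w * br x' y' w) * (br x y' z * br x' y z))" .
  then have cross: "(br x y z * br x' y' z) * (br x y' w * br x' y w) =
    (br x y w * br x' y' w) * (br x y' z * br x' y z)"
    using nz by simp
  \<comment> \<open>This choice puts \<open>z\<close> on the conic with base points
    \<open>x\<close>, \<open>y\<close>, \<open>y'\<close>, \<open>x'\<close>; equality of the cross
    ratios puts \<open>w\<close> on it as well.\<close>
  define l where "l = br x y' z * br x' y z"
  define m where "m = - (br x y z * br x' y' z)"
  have swap: "br y' x' k = - br x' y' k" "br y x' k = - br x' y k" for k
    by (rule det3_swap)+
  have "pencil l m x y y' x' z = 0" by (simp add: pencil_def l_def m_def swap)
  moreover have "pencil l m x y y' x' w = 0" using cross by (simp add: pencil_def l_def m_def swap)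
  moreover have "l \<noteq> 0"
  proof -
    have "br x y' z \<noteq> 0" "br x' y z \<noteq> 0"
      using mem ne A(1) by (simp_all add: no_three subset_iff)
    then show ?thesis by (simp add: l_def)
  qed
  moreover have "{x, y, y', x', z, w} \<subseteq> I" using mem A(1) by blast
  ultimately show False using none[OF dist] by blast
qed

lemma all_on_pencil:
  assumes odd: "odd (CARD('a))" and big: "8 \<le> CARD('a)"
  shows "\<exists>a b c e u l m. distinct [a, b, c, e, u] \<and> {a, b, c, e, u} \<subseteq> I \<and> l \<noteq> 0 \<and>
    (\<forall>i\<in>I. pencil l m a b c e i = 0)"
proof -
  obtain a b c e u v l m where 1: "distinct [a, b, c, e, u, v]" "{a, b, c, e, u, v} \<subseteq> I"
    "pencil l m a b c e u = 0" "pencil l m a b c e v = 0" "l \<noteq> 0"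
    using six_on_conic[OF assms] by (elim exE conjE) (rule that)
  have "pencil l m a b c e i = 0" if "i \<in> I" for i
  proof (cases "i \<in> {a, b, c, e, u, v}")
    case False
    then show ?thesis using 1 that by (intro pencil_seven[OF odd, of a b c e u v i]) auto
  qed (use 1 in auto)
  moreover have "distinct [a, b, c, e, u]" "{a, b, c, e, u} \<subseteq> I" using 1(1,2) by simp_all
  ultimately show ?thesis using 1(5)
    by (intro exI[of _ a] exI[of _ b] exI[of _ c] exI[of _ e] exI[of _ u] exI[of _ l] exI[of _ m]
      conjI ballI)
qed

end

text \<open>The 2 by 2 minors of the frame coordinates of \<open>e\<close> and \<open>u\<close> are
  brackets of these points with one frame vector, so noncollinearity makes the minors
  nonzero.\<close>

lemma det3_minors:
  shows "det3 a e c * det3 a b u - det3 a b e * det3 a u c = det3 a b c * det3 a e u"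
    and "det3 e b c * det3 a b u - det3 a b e * det3 u b c = det3 a b c * det3 e b u"
    and "det3 e b c * det3 a u c - det3 a e c * det3 u b c = det3 a b c * det3 e u c"
  by (simp_all add: vec3_defs algebra_simps)

lemma det3_expand_right:
  "det3 a b c * det3 u v w = det3 w b c * det3 u v a + det3 a w c * det3 u v b + det3 a b w * det3 u v c"
proof -
  have "det3 a b c * det3 u v w = dot3 (crs u v) (det3 a b c *s w)" by (simp add: det3_dot3)
  also have "det3 a b c *s w = det3 w b c *s a + det3 a w c *s b + det3 a b w *s c"
    by (rule det3_expand)
  finally show ?thesis by (simp add: det3_dot3)
qed

text \<open>With four points of a 7-arc in the positions \<open>(1,0,0)\<close>, \<open>(0,1,0)\<close>, \<open>(0,0,1)\<close>, \<open>(1,1,1)\<close>, the other three are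
  \<open>(a\<^sub>i, b\<^sub>i, 1)\<close>. The third divisibility below says that the first two of them lie on a conic with the frame;
  the remaining ones exclude collinear triples.\<close>

lemma frame_seven_int:
  "list_all (\<lambda>a1. list_all (\<lambda>b1. a1 = b1 \<or> list_all (\<lambda>a2. a1 = a2 \<or> list_all (\<lambda>b2. b1 = b2 \<or> a2 = b2 \<or>
    7 dvd a1 * b2 - a2 * b1 \<or> 7 dvd (a1 - 1) * (b2 - 1) - (a2 - 1) * (b1 - 1) \<or>
    7 dvd (1 - a1) * a2 * (1 - b2) * b1 - (1 - a2) * a1 * (1 - b1) * b2 \<or>
    list_all (\<lambda>a3. a1 = a3 \<or> a2 = a3 \<or> list_all (\<lambda>b3. b1 = b3 \<or> b2 = b3 \<or> a3 = b3 \<or>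
      7 dvd a1 * b3 - a3 * b1 \<or> 7 dvd (a1 - 1) * (b3 - 1) - (a3 - 1) * (b1 - 1) \<or>
      7 dvd a2 * b3 - a3 * b2 \<or> 7 dvd (a2 - 1) * (b3 - 1) - (a3 - 1) * (b2 - 1) \<or>
      7 dvd a1 * (b2 - b3) - b1 * (a2 - a3) + (a2 * b3 - b2 * a3))
    [2..6]) [2..6]) [2..6]) [2..6]) [2..6]) [2..6::int]"
  by code_simp

lemma frame_seven_mod:
  fixes a1 a2 a3 b1 b2 b3 :: int
  assumes "a1 \<in> {2..6}" "a2 \<in> {2..6}" "a3 \<in> {2..6}" "b1 \<in> {2..6}" "b2 \<in> {2..6}" "b3 \<in> {2..6}"
    and "distinct [a1, a2, a3]" "distinct [b1, b2, b3]" "a1 \<noteq> b1" "a2 \<noteq> b2" "a3 \<noteq> b3"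
    and "\<not> 7 dvd a1 * b2 - a2 * b1" "\<not> 7 dvd (a1 - 1) * (b2 - 1) - (a2 - 1) * (b1 - 1)"
    and "\<not> 7 dvd a1 * b3 - a3 * b1" "\<not> 7 dvd (a1 - 1) * (b3 - 1) - (a3 - 1) * (b1 - 1)"
    and "\<not> 7 dvd a2 * b3 - a3 * b2" "\<not> 7 dvd (a2 - 1) * (b3 - 1) - (a3 - 1) * (b2 - 1)"
    and "\<not> 7 dvd a1 * (b2 - b3) - b1 * (a2 - a3) + (a2 * b3 - b2 * a3)"
  shows "7 dvd (1 - a1) * a2 * (1 - b2) * b1 - (1 - a2) * a1 * (1 - b1) * b2"
proof (rule ccontr)
  assume neg: "\<not> ?thesis"
  have dis: "P \<or> Q \<Longrightarrow> \<not> P \<Longrightarrow> Q" for P Q by blast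
  have ne: "a1 \<noteq> a2" "a1 \<noteq> a3" "a2 \<noteq> a3" "b1 \<noteq> b2" "b1 \<noteq> b3" "b2 \<noteq> b3" using assms(7,8) by auto
  \<comment> \<open>The quantifiers and alternatives of the checked statement are discharged one at
    a time, in the order of their nesting.\<close>
  note 1 = bspec[OF bspec[OF frame_seven_int[unfolded list_all_iff set_upto] assms(1)] assms(4)]
  note 2 = bspec[OF dis[OF bspec[OF dis[OF 1 assms(9)] assms(2)] ne(1)] assms(5)]
  note 3 = dis[OF dis[OF dis[OF dis[OF dis[OF 2 ne(4)] assms(10)] assms(12)] assms(13)] neg]
  note 4 = bspec[OF dis[OF dis[OF bspec[OF 3 assms(3)] ne(2)] ne(3)] assms(6)]
  note 5 = dis[OF dis[OF dis[OF 4 ne(5)] ne(6)] assms(11)]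
  note 6 = dis[OF dis[OF dis[OF dis[OF 5 assms(14)] assms(15)] assms(16)] assms(17)]
  from 6 assms(18) show False by contradiction
qed

lemma of_int_zero_card_seven:
  assumes "CARD('a::{field,finite}) = 7"
  shows "of_int n = (0::'a) \<longleftrightarrow> 7 dvd n"
proof -
  have "CHAR('a) dvd 7" using CHAR_dvd_CARD[where 'a='a] assms by simp
  moreover have "prime (7::nat)" by simp
  moreover have "CHAR('a) \<noteq> 1" by simp
  ultimately have "CHAR('a) = 7" using prime_nat_iff by blast
  then show ?thesis by (simp add: of_int_eq_0_iff_char_dvd)
qed

lemma of_int_surj_card_seven:
  fixes x :: "'a::{field,finite}"
  assumes "CARD('a) = 7"
  shows "\<exists>k\<in>{0..6}. x = of_int k"
proof -
  have "inj_on (of_int :: int \<Rightarrow> 'a) {0..6}"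
  proof (rule inj_onI)
    fix k l :: int assume kl: "k \<in> {0..6}" "l \<in> {0..6}" "of_int k = (of_int l :: 'a)"
    then have "of_int (k - l) = (0 :: 'a)" by simp
    then have "7 dvd k - l" using of_int_zero_card_seven[OF assms] by blast
    then show "k = l" using kl(1,2) unfolding atLeastAtMost_iff by presburger
  qed
  then have "(of_int :: int \<Rightarrow> 'a) ` {0..6} = UNIV"
    using assms by (intro card_subset_eq) (simp_all add: card_image)
  then have "x \<in> of_int ` {0..6}" by simp
  then show ?thesis by (rule imageE) blast
qed

lemma frame_seven:
  fixes a1 a2 a3 b1 b2 b3 :: "'a::{field,finite}"
  assumes "CARD('a) = 7"
    and "{a1, a2, a3, b1, b2, b3} \<inter> {0, 1} = {}" "distinct [a1, a2, a3]" "distinct [b1, b2, b3]"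
    and "a1 \<noteq> b1" "a2 \<noteq> b2" "a3 \<noteq> b3"
    and "a1 * b2 - a2 * b1 \<noteq> 0" "(a1 - 1) * (b2 - 1) - (a2 - 1) * (b1 - 1) \<noteq> 0"
    and "a1 * b3 - a3 * b1 \<noteq> 0" "(a1 - 1) * (b3 - 1) - (a3 - 1) * (b1 - 1) \<noteq> 0"
    and "a2 * b3 - a3 * b2 \<noteq> 0" "(a2 - 1) * (b3 - 1) - (a3 - 1) * (b2 - 1) \<noteq> 0"
    and "a1 * (b2 - b3) - b1 * (a2 - a3) + (a2 * b3 - b2 * a3) \<noteq> 0"
  shows "(1 - a1) * a2 * (1 - b2) * b1 - (1 - a2) * a1 * (1 - b1) * b2 = 0"
proof -
  have "\<exists>k\<in>{2..6}. x = of_int k" if "x \<notin> {0, 1}" for x :: 'a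
  proof -
    obtain k where k: "k \<in> {0..6}" "x = of_int k" using of_int_surj_card_seven[OF assms(1)] by blast
    then have "k \<noteq> 0" "k \<noteq> 1" using that by auto
    then show ?thesis using k by auto
  qed
  note ex = this
  obtain k1 where k1: "k1 \<in> {2..6}" "a1 = of_int k1" using ex[of a1] assms(2) by auto
  obtain k2 where k2: "k2 \<in> {2..6}" "a2 = of_int k2" using ex[of a2] assms(2) by auto
  obtain k3 where k3: "k3 \<in> {2..6}" "a3 = of_int k3" using ex[of a3] assms(2) by auto
  obtain l1 where l1: "l1 \<in> {2..6}" "b1 = of_int l1" using ex[of b1] assms(2) by auto
  obtain l2 where l2: "l2 \<in> {2..6}" "b2 = of_int l2" using ex[of b2] assms(2) by auto
  obtain l3 where l3: "l3 \<in> {2..6}" "b3 = of_int l3" using ex[of b3] assms(2) by auto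
  note eq = k1(2) k2(2) k3(2) l1(2) l2(2) l3(2)
  note zero = of_int_zero_card_seven[OF assms(1), symmetric]
  have "7 dvd (1 - k1) * k2 * (1 - l2) * l1 - (1 - k2) * k1 * (1 - l1) * l2"
  proof (rule frame_seven_mod[OF k1(1) k2(1) k3(1) l1(1) l2(1) l3(1)])
    show "distinct [k1, k2, k3]" "distinct [l1, l2, l3]" "k1 \<noteq> l1" "k2 \<noteq> l2" "k3 \<noteq> l3"
      using assms(3-7) by (auto simp: eq)
  qed (use assms(8-14) in \<open>simp_all add: zero eq\<close>)
  then show ?thesis by (simp add: zero eq)
qed

section \<open>Arcs of odd order are conics\<close>

context tangent_arc
begin

text \<open>With frame coordinates x, y, z given by \<open>br i b c\<close>,
  \<open>br a i c\<close>, \<open>br a b i\<close>, this is A y z + B x z + C x y, the general conic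
  through the frame points. In odd characteristic it is nondegenerate just if \<open>A\<close>,
  \<open>B\<close>, \<open>C\<close> are all nonzero.\<close>

definition triangle_conic :: "'a \<Rightarrow> 'a \<Rightarrow> 'a \<Rightarrow> 'i \<Rightarrow> 'i \<Rightarrow> 'i \<Rightarrow> 'i \<Rightarrow> 'a" where
  "triangle_conic A B C a b c i =
     A * (br a i c * br a b i) + B * (br i b c * br a b i) + C * (br i b c * br a i c)"

lemma triangle_conic_base [simp]:
  "triangle_conic A B C a b c a = 0" "triangle_conic A B C a b c b = 0"
  "triangle_conic A B C a b c c = 0"
  by (simp_all add: triangle_conic_def)

text \<open>Expanding \<open>br c e i\<close> and \<open>br b e i\<close> in the frame
  \<open>a\<close>, \<open>b\<close>, \<open>c\<close> brings a conic of the pencil into the form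
  that is shared by all values of \<open>q\<close>.\<close>

lemma pencil_triangle_conic:
  "br a b c * pencil l m a b c e i =
    triangle_conic ((l + m) * br c e b) (l * br c e a) (- m * br b e a) a b c i"
proof -
  have 1: "br a b c * br c e i = br i b c * br c e a + br a i c * br c e b"
    and 2: "br a b c * br b e i = br i b c * br b e a - br a b i * br c e b"
    using det3_expand_right[of "r a" "r b" "r c" "r c" "r e" "r i"]
      det3_expand_right[of "r a" "r b" "r c" "r b" "r e" "r i"]
    by (simp_all add: vec3_defs algebra_simps)
  have "br a b c * pencil l m a b c e i =
    l * (br a b i * (br a b c * br c e i)) - m * (br a i c * (br a b c * br b e i))"
    by (simp add: pencil_def det3_swap(2)[of "r a" "r c" "r i"] algebra_simps)
  then show ?thesis unfolding 1 2 by (simp add: triangle_conic_def algebra_simps)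
qed

lemma triangle_conic_large:
  assumes "odd (CARD('a))" "8 \<le> CARD('a)"
  shows "\<exists>a b c A B C. distinct [a, b, c] \<and> {a, b, c} \<subseteq> I \<and> A \<noteq> 0 \<and> B \<noteq> 0 \<and> C \<noteq> 0 \<and>
    (\<forall>i\<in>I. triangle_conic A B C a b c i = 0)"
proof -
  obtain a b c e u l m where 1: "distinct [a, b, c, e, u]" "{a, b, c, e, u} \<subseteq> I" "l \<noteq> 0"
    and p: "\<forall>i\<in>I. pencil l m a b c e i = 0"
    using all_on_pencil[OF assms] by (elim exE conjE) (rule that)
  have nz: "br i j k \<noteq> 0" if "{i, j, k} \<subseteq> {a, b, c, e, u}" "distinct [i, j, k]" for i j k
    using that 1(2) by (intro no_three) auto
  have u: "l * (br a b u * br c e u) + m * (br a c u * br b e u) = 0"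
    using p 1(2) by (auto simp: pencil_def)
  have nzs: "br a b u \<noteq> 0" "br c e u \<noteq> 0" "br a e u \<noteq> 0" "br b c u \<noteq> 0"
    "br c e b \<noteq> 0" "br c e a \<noteq> 0" "br b e a \<noteq> 0"
    using 1(1) by (intro nz; auto)+
  have "m \<noteq> 0" using u nzs 1(3) by auto
  \<comment> \<open>For \<open>m = - l\<close> the conic is the third line pair, \<open>a e\<close>
    and \<open>b c\<close>, and \<open>u\<close> lies on neither line.\<close>
  moreover have "l + m \<noteq> 0"
  proof
    assume "l + m = 0"
    then have "m = - l" by (simp add: eq_neg_iff_add_eq_0 add.commute)
    then have "l * (br a b u * br c e u - br a c u * br b e u) = 0" using u by (simp add: algebra_simps)
    then have "br a b u * br c e u - br a c u * br b e u = 0" using 1(3) by simp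
    then have "br a e u * br b c u = 0" using det3_plucker[of "r a" "r b" "r u" "r c" "r e"] by simp
    then show False using nzs by simp
  qed
  moreover have "triangle_conic ((l + m) * br c e b) (l * br c e a) (- m * br b e a) a b c i = 0"
    if "i \<in> I" for i
    unfolding pencil_triangle_conic[symmetric] using p that by simp
  ultimately show ?thesis using 1 nzs
    by (intro exI[of _ a] exI[of _ b] exI[of _ c] exI[of _ "(l + m) * br c e b"]
        exI[of _ "l * br c e a"] exI[of _ "- m * br b e a"]) simp
qed

text \<open>\<open>(A, B, C)\<close> is the cross product of the vectors (y z, x z, x y) of
  \<open>e\<close> and \<open>u\<close> in frame coordinates, so it is orthogonal to both.\<close>

lemma triangle_conic_five:
  assumes I: "{a, b, c, e, u} \<subseteq> I" and dist: "distinct [a, b, c, e, u]"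
    and A: "A = br e b c * br u b c * (br a b e * br a u c - br a e c * br a b u)"
    and B: "B = br a e c * br a u c * (br e b c * br a b u - br a b e * br u b c)"
    and C: "C = br a b e * br a b u * (br a e c * br u b c - br e b c * br a u c)"
  shows "A \<noteq> 0" "B \<noteq> 0" "C \<noteq> 0"
    "triangle_conic A B C a b c e = 0" "triangle_conic A B C a b c u = 0"
proof -
  have nz: "br i j k \<noteq> 0" if "{i, j, k} \<subseteq> {a, b, c, e, u}" "distinct [i, j, k]" for i j k
    using that I by (intro no_three) auto
  have nzs: "br e b c \<noteq> 0" "br u b c \<noteq> 0" "br a e c \<noteq> 0" "br a u c \<noteq> 0" "br a b e \<noteq> 0" "br a b u \<noteq> 0"
    "br a b c \<noteq> 0" "br a e u \<noteq> 0" "br e b u \<noteq> 0" "br e u c \<noteq> 0"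
    using dist by (intro nz; auto)+
  have "br a e c * br a b u - br a b e * br a u c \<noteq> 0"
    "br e b c * br a b u - br a b e * br u b c \<noteq> 0"
    "br e b c * br a u c - br a e c * br u b c \<noteq> 0"
    unfolding det3_minors using nzs by simp_all
  then show "A \<noteq> 0" "B \<noteq> 0" "C \<noteq> 0" using nzs by (simp_all add: A B C)
  show "triangle_conic A B C a b c e = 0" "triangle_conic A B C a b c u = 0"
    by (simp_all add: triangle_conic_def A B C algebra_simps)
qed

text \<open>\<open>g\<close> and \<open>h\<close> are affine coordinates in the frame scaled so that
  \<open>e\<close> is (1,1,1). Each bracket of the arc becomes, up to nonzero factors, one of the
  expressions in \<open>frame_seven\<close>; \<open>w\<close> is the seventh point that the finite
  check asks for.\<close>

lemma triangle_conic_seven: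
  assumes q: "CARD('a) = 7" and I: "{a, b, c, e, u, v, w} \<subseteq> I"
    and dist: "distinct [a, b, c, e, u, v, w]"
    and A: "A = br e b c * br u b c * (br a b e * br a u c - br a e c * br a b u)"
    and B: "B = br a e c * br a u c * (br e b c * br a b u - br a b e * br u b c)"
    and C: "C = br a b e * br a b u * (br a e c * br u b c - br e b c * br a u c)"
  shows "triangle_conic A B C a b c v = 0"
proof -
  define x where "x i = br i b c" for i
  define y where "y i = br a i c" for i
  define z where "z i = br a b i" for i
  define g where "g i = x i * z e / (x e * z i)" for i
  define h where "h i = y i * z e / (y e * z i)" for i
  let ?S = "{a, b, c, e, u, v, w}"
  have nz: "br i j k \<noteq> 0" if "{i, j, k} \<subseteq> ?S" "distinct [i, j, k]" for i j k
    using that I by (intro no_three) auto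
  have xyz: "x i \<noteq> 0" "y i \<noteq> 0" "z i \<noteq> 0" if "i \<in> {e, u, v, w}" for i
    unfolding x_def y_def z_def using that dist by (intro nz; auto)+
  have abc: "br a b c \<noteq> 0" using dist by (intro nz) auto
  have minors: "y i * z j - z i * y j \<noteq> 0" "x i * z j - z i * x j \<noteq> 0" "x i * y j - y i * x j \<noteq> 0"
    if "i \<in> {e, u, v, w}" "j \<in> {e, u, v, w}" "i \<noteq> j" for i j
  proof -
    have "br a i j \<noteq> 0" "br i b j \<noteq> 0" "br i j c \<noteq> 0"
      using that dist by (intro nz; auto)+
    then show "y i * z j - z i * y j \<noteq> 0" "x i * z j - z i * x j \<noteq> 0" "x i * y j - y i * x j \<noteq> 0"
      unfolding x_def y_def z_def det3_minors using abc by simp_all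
  qed
  have triple: "x i * (y j * z k - z j * y k) - y i * (x j * z k - z j * x k) + z i * (x j * y k - y j * x k) \<noteq> 0"
    if "i \<in> {e, u, v, w}" "j \<in> {e, u, v, w}" "k \<in> {e, u, v, w}" "distinct [i, j, k]" for i j k
  proof -
    have flip: "br j k a = br a j k" "br j k b = - br j b k"
      by (simp_all add: vec3_defs algebra_simps)
    have "br a b c * br a b c * br i j k = br a b c * (br a b c * br j k i)"
      by (simp add: vec3_defs algebra_simps)
    also have "br a b c * br j k i = x i * br j k a + y i * br j k b + z i * br j k c"
      unfolding x_def y_def z_def by (rule det3_expand_right)
    also have "br a b c * (x i * br j k a + y i * br j k b + z i * br j k c) =
      x i * (br a b c * br a j k) - y i * (br a b c * br j b k) + z i * (br a b c * br j k c)"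
      unfolding flip by (simp add: algebra_simps)
    also have "\<dots> = x i * (y j * z k - z j * y k) - y i * (x j * z k - z j * x k) + z i * (x j * y k - y j * x k)"
      unfolding x_def y_def z_def det3_minors ..
    finally have "\<dots> = br a b c * br a b c * br i j k" ..
    moreover have "br i j k \<noteq> 0" using that dist by (intro nz) auto
    ultimately show ?thesis using abc by simp
  qed
  note e = xyz[of e, simplified]
  have eq: "(1 - g u) * g v * (1 - h v) * h u - (1 - g v) * g u * (1 - h u) * h v = 0"
  proof (rule frame_seven[OF q, of _ _ "g w" _ _ "h w"])
    have g0: "g i \<noteq> 0" "h i \<noteq> 0" if "i \<in> {e, u, v, w}" for i
      using xyz[OF that] e by (auto simp: g_def h_def)
    have g1: "g i \<noteq> 1" "h i \<noteq> 1" "g i \<noteq> h i" if "i \<in> {u, v, w}" for i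
    proof -
      have "i \<in> {e, u, v, w}" "i \<noteq> e" using that dist by auto
      from minors[OF this(1) _ this(2)] xyz[OF this(1)] e
      show "g i \<noteq> 1" "h i \<noteq> 1" "g i \<noteq> h i"
        by (auto simp: g_def h_def field_simps)
    qed
    show "{g u, g v, g w, h u, h v, h w} \<inter> {0, 1} = {}"
      using g0 g1 by auto
    show "g u \<noteq> h u" "g v \<noteq> h v" "g w \<noteq> h w" using g1 by auto
    have g2: "g i \<noteq> g j" "h i \<noteq> h j" "g i * h j - g j * h i \<noteq> 0"
      "(g i - 1) * (h j - 1) - (g j - 1) * (h i - 1) \<noteq> 0"
      if "i \<in> {u, v, w}" "j \<in> {u, v, w}" "i \<noteq> j" for i j
    proof -
      have ij: "i \<in> {e, u, v, w}" "j \<in> {e, u, v, w}" "distinct [e, i, j]" using that dist by auto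
      note m = minors[OF ij(1,2) that(3)] and t = triple[OF _ ij] and nz = xyz[OF ij(1)] xyz[OF ij(2)] e
      show "g i \<noteq> g j" "h i \<noteq> h j"
        using m nz by (auto simp: g_def h_def field_simps)
      have "g i * h j - g j * h i = (x i * y j - y i * x j) * (z e * z e / (x e * y e * z i * z j))"
        using nz by (simp add: g_def h_def field_simps)
      then show "g i * h j - g j * h i \<noteq> 0" using m nz by simp
      have "(g i - 1) * (h j - 1) - (g j - 1) * (h i - 1) =
        (x e * (y i * z j - z i * y j) - y e * (x i * z j - z i * x j) + z e * (x i * y j - y i * x j)) *
        (z e / (x e * y e * z i * z j))"
        using nz by (simp add: g_def h_def field_simps)
      then show "(g i - 1) * (h j - 1) - (g j - 1) * (h i - 1) \<noteq> 0" using t nz by simp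
    qed
    show "distinct [g u, g v, g w]" "distinct [h u, h v, h w]" using g2 dist by auto
    show "g u * h v - g v * h u \<noteq> 0" "g u * h w - g w * h u \<noteq> 0" "g v * h w - g w * h v \<noteq> 0"
      "(g u - 1) * (h v - 1) - (g v - 1) * (h u - 1) \<noteq> 0"
      "(g u - 1) * (h w - 1) - (g w - 1) * (h u - 1) \<noteq> 0"
      "(g v - 1) * (h w - 1) - (g w - 1) * (h v - 1) \<noteq> 0"
      using g2 dist by auto
    have "g u * (h v - h w) - h u * (g v - g w) + (g v * h w - h v * g w) =
      (x u * (y v * z w - z v * y w) - y u * (x v * z w - z v * x w) + z u * (x v * y w - y v * x w)) *
        (z e * z e / (x e * y e * z u * z v * z w))"
      using e xyz[of u] xyz[of v] xyz[of w] by (simp add: g_def h_def field_simps)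
    then show "g u * (h v - h w) - h u * (g v - g w) + (g v * h w - h v * g w) \<noteq> 0"
      using triple[of u v w] dist e xyz[of u] xyz[of v] xyz[of w] by simp
  qed
  have "triangle_conic A B C a b c v = ((1 - g u) * g v * (1 - h v) * h u - (1 - g v) * g u * (1 - h u) * h v)
    * (x e * x e * y e * y e * z u * z u * z v * z v / (z e * z e)) "
    using e xyz[of u] xyz[of v]
    unfolding triangle_conic_def A B C x_def[symmetric] y_def[symmetric] z_def[symmetric] g_def h_def
    by (simp add: field_simps)
  then show ?thesis unfolding eq by simp
qed

end

context tangent_arc
begin

lemma triangle_conic_exists:
  assumes odd: "odd (CARD('a))"
  shows "\<exists>a b c A B C. distinct [a, b, c] \<and> {a, b, c} \<subseteq> I \<and> A \<noteq> 0 \<and> B \<noteq> 0 \<and> C \<noteq> 0 \<and>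
    (\<forall>i\<in>I. triangle_conic A B C a b c i = 0)"
proof -
  have "CARD('a) \<noteq> 2" "CARD('a) \<noteq> 4" "CARD('a) \<noteq> 6" using odd by (auto dest: arg_cong[of _ _ even])
  then consider "CARD('a) = 3" | "CARD('a) = 5" | "CARD('a) = 7" | "8 \<le> CARD('a)"
    using two_le_card by linarith
  then show ?thesis
  proof cases
    case 1
    then obtain xs where xs: "set xs = I" "distinct xs" "length xs = 3"
      using distinct_list_of_card[of I 3] card_I by auto
    then obtain a b c where "xs = [a, b, c]" by (auto simp: eval_nat_numeral length_Suc_conv)
    then have I: "I = {a, b, c}" "distinct [a, b, c]" using xs by auto
    \<comment> \<open>The arc consists of the three frame points, so any nonzero coefficients will
      do.\<close>
    then have "\<forall>i\<in>I. triangle_conic 1 1 1 a b c i = 0" by simp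
    then show ?thesis using I
      by (intro exI[of _ a] exI[of _ b] exI[of _ c] exI[of _ 1]) simp
  next
    case 2
    then obtain xs where xs: "set xs = I" "distinct xs" "length xs = 5"
      using distinct_list_of_card[of I 5] card_I by auto
    then obtain a b c e u where "xs = [a, b, c, e, u]" by (auto simp: eval_nat_numeral length_Suc_conv)
    then have I: "I = {a, b, c, e, u}" "distinct [a, b, c, e, u]" using xs by auto
    then have "{a, b, c, e, u} \<subseteq> I" by simp
    note five = triangle_conic_five[OF this I(2) refl refl refl]
    show ?thesis
      by (rule exI[of _ a], rule exI[of _ b], rule exI[of _ c], rule exI, rule exI, rule exI,
          intro conjI, use I(2) in simp, use I(1) in simp, rule five(1), rule five(2), rule five(3))
        (use I(1) five(4,5) in simp)
  next
    case 3
    then obtain xs where xs: "set xs = I" "distinct xs" "length xs = 7"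
      using distinct_list_of_card[of I 7] card_I by auto
    then obtain a b c e u v w where "xs = [a, b, c, e, u, v, w]"
      by (auto simp: eval_nat_numeral length_Suc_conv)
    then have I: "I = {a, b, c, e, u, v, w}" "distinct [a, b, c, e, u, v, w]" using xs by auto
    then have sub: "{a, b, c, e, u} \<subseteq> I" and dist: "distinct [a, b, c, e, u]"
      and sub7: "{a, b, c, e, u, v, w} \<subseteq> I" "{a, b, c, e, u, w, v} \<subseteq> I"
      and dist7: "distinct [a, b, c, e, u, w, v]"
      by auto
    note five = triangle_conic_five[OF sub dist refl refl refl]
    \<comment> \<open>The coefficients depend only on the five points up to \<open>u\<close>, so
      exchanging \<open>v\<close> and \<open>w\<close> puts both on the same conic.\<close>
    note seven = triangle_conic_seven[OF 3 sub7(1) I(2) refl refl refl]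
      triangle_conic_seven[OF 3 sub7(2) dist7 refl refl refl]
    show ?thesis
      by (rule exI[of _ a], rule exI[of _ b], rule exI[of _ c], rule exI, rule exI, rule exI,
          intro conjI, use I(2) in simp, use I(1) in simp, rule five(1), rule five(2), rule five(3))
        (use I(1) five(4,5) seven in simp)
  next
    case 4
    then show ?thesis by (rule triangle_conic_large[OF odd])
  qed
qed

end

section \<open>Rational parametrisation of the conic\<close>

context vec_arc
begin

lemma r_proportional:
  assumes "i \<in> I" "j \<in> I" "r i = k *s w" "r j = l *s w"
  shows "i = j"
proof (rule ccontr)
  assume "i \<noteq> j"
  then show False using indep[OF assms(1,2)] by (simp add: assms(3,4) vec3_defs)
qed

text \<open>Because no \<open>t i\<close> is 0, the \<open>q\<close> arc points have
  \<open>q\<close> distinct finite parameters, hence all field elements. Halving \<open>w2\<close>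
  yields the coefficient \<open>2 * \<sigma> i\<close> that occurs in the curves of AS(q).\<close>

lemma conic_parameter_affine:
  assumes w: "det3 w1 w2 w3 \<noteq> 0"
    and p: "\<And>i. i \<in> I \<Longrightarrow> k i \<noteq> 0 \<and> t i \<noteq> 0 \<and>
      r i = k i *s ((s i)\<^sup>2 *s w1 + (s i * t i) *s w2 + (t i)\<^sup>2 *s w3)"
    and odd: "odd (CARD('a))"
  shows "\<exists>u1 u2 u3 \<sigma>. det3 u1 u2 u3 \<noteq> 0 \<and> bij_betw \<sigma> I UNIV \<and>
    (\<forall>i\<in>I. \<exists>c. c \<noteq> 0 \<and> r i = c *s ((\<sigma> i)\<^sup>2 *s u1 + (2 * \<sigma> i) *s u2 + u3))"
proof -
  define \<sigma> where "\<sigma> i = s i / t i" for i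
  define u2 where "u2 = (1 / 2) *s w2"
  have two: "(2::'a) \<noteq> 0" by (rule two_neq_zero[OF odd])
  have r: "r i = (k i * (t i)\<^sup>2) *s ((\<sigma> i)\<^sup>2 *s w1 + (2 * \<sigma> i) *s u2 + w3)" if "i \<in> I" for i
    using p[OF that] two by (simp add: \<sigma>_def u2_def vec_eq_iff field_simps power2_eq_square)
  have "inj_on \<sigma> I"
  proof (rule inj_onI)
    fix i j assume ij: "i \<in> I" "j \<in> I" "\<sigma> i = \<sigma> j"
    show "i = j"
      by (rule r_proportional[OF ij(1,2) r[OF ij(1)] r[OF ij(2), folded ij(3)]])
  qed
  moreover from this have "\<sigma> ` I = UNIV"
    using card_I by (intro card_subset_eq) (simp_all add: card_image)
  ultimately have bij: "bij_betw \<sigma> I UNIV" by (simp add: bij_betw_def)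
  have d: "det3 w1 u2 w3 = 1 / 2 * det3 w1 w2 w3"
    by (simp add: u2_def vec3_defs algebra_simps)
  have "det3 w1 u2 w3 \<noteq> 0" unfolding d using w two by simp
  moreover have "\<exists>c. c \<noteq> 0 \<and> r i = c *s ((\<sigma> i)\<^sup>2 *s w1 + (2 * \<sigma> i) *s u2 + w3)" if "i \<in> I" for i
    using r[OF that] p[OF that] by (intro exI[of _ "k i * (t i)\<^sup>2"] conjI) simp_all
  ultimately show ?thesis using bij
    by (intro exI[of _ w1] exI[of _ u2] exI[of _ w3] exI[of _ \<sigma>] conjI ballI)
qed

text \<open>One of the \<open>q + 1\<close> parameters \<open>s/t\<close> is missed by the arc; it is moved to infinity.\<close>

lemma conic_parameter:
  assumes w: "det3 w1 w2 w3 \<noteq> 0"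
    and p: "\<And>i. i \<in> I \<Longrightarrow> k i \<noteq> 0 \<and>
      r i = k i *s ((s i)\<^sup>2 *s w1 + (s i * t i) *s w2 + (t i)\<^sup>2 *s w3)"
    and odd: "odd (CARD('a))"
  shows "\<exists>u1 u2 u3 \<sigma>. det3 u1 u2 u3 \<noteq> 0 \<and> bij_betw \<sigma> I UNIV \<and>
    (\<forall>i\<in>I. \<exists>c. c \<noteq> 0 \<and> r i = c *s ((\<sigma> i)\<^sup>2 *s u1 + (2 * \<sigma> i) *s u2 + u3))"
proof -
  define th where "th i = (if t i = 0 then None else Some (s i / t i))" for i
  have "card (th ` I) < card (UNIV :: 'a option set)"
    using card_image_le[OF fin, of th] card_I by simp
  then have "th ` I \<noteq> UNIV" by auto
  then obtain m where m: "m \<notin> th ` I" by blast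
  show ?thesis
  proof (cases m)
    case None
    then have "t i \<noteq> 0" if "i \<in> I" for i using m that by (force simp: th_def)
    then show ?thesis using p by (intro conic_parameter_affine[OF w _ odd, of k t s]) simp
  next
    case (Some m')
    have nz: "s i - m' * t i \<noteq> 0" if "i \<in> I" for i
    proof
      assume 0: "s i - m' * t i = 0"
      show False
      proof (cases "t i = 0")
        case True
        then have "r i = 0" using 0 p[OF that] by simp
        then show False using r_nonzero[OF that] by simp
      next
        case False
        then have "th i = m" using 0 Some by (simp add: th_def field_simps)
        then show False using m that by blast
      qed
    qed
    \<comment> \<open>Writing s as (s - m' t) + m' t in the quadratic expression gives these three
      vectors; in the new parameters \<open>t i\<close> and \<open>s i - m' * t i\<close> the missed
      value is infinity.\<close>
    have "det3 (m'\<^sup>2 *s w1 + m' *s w2 + w3) ((2 * m') *s w1 + w2) w1 = - det3 w1 w2 w3"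
      by (simp add: vec3_defs algebra_simps power2_eq_square)
    then have "det3 (m'\<^sup>2 *s w1 + m' *s w2 + w3) ((2 * m') *s w1 + w2) w1 \<noteq> 0" using w by simp
    moreover have "k i \<noteq> 0 \<and> s i - m' * t i \<noteq> 0 \<and>
      r i = k i *s ((t i)\<^sup>2 *s (m'\<^sup>2 *s w1 + m' *s w2 + w3) +
        (t i * (s i - m' * t i)) *s ((2 * m') *s w1 + w2) + (s i - m' * t i)\<^sup>2 *s w1)"
      if "i \<in> I" for i
      using p[OF that] nz[OF that] by (simp add: vec_eq_iff algebra_simps power2_eq_square)
    ultimately show ?thesis
      by (rule conic_parameter_affine[OF _ _ odd])
  qed
qed

end

context tangent_arc
begin

lemma conic_coordinates:
  assumes odd: "odd (CARD('a))"
  shows "\<exists>u1 u2 u3 \<sigma>. det3 u1 u2 u3 \<noteq> 0 \<and> bij_betw \<sigma> I UNIV \<and>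
    (\<forall>i\<in>I. \<exists>c. c \<noteq> 0 \<and> r i = c *s ((\<sigma> i)\<^sup>2 *s u1 + (2 * \<sigma> i) *s u2 + u3))"
proof -
  obtain a b c A B C where abc: "distinct [a, b, c]" "{a, b, c} \<subseteq> I"
    and ABC: "A \<noteq> 0" "B \<noteq> 0" "C \<noteq> 0" and con: "\<forall>i\<in>I. triangle_conic A B C a b c i = 0"
    using triangle_conic_exists[OF odd] by (elim exE conjE) (rule that)
  let ?D = "br a b c"
  have D: "?D \<noteq> 0" using abc by (intro no_three) auto
  \<comment> \<open>Projection from \<open>a\<close>: the line through \<open>a\<close> with y : z =
    s : t meets the conic again in (- A s t, s (B t + C s), t (B t + C s)). The vectors are the
    coefficients of s^2, s t and t^2.\<close>
  define w1 where "w1 = C *s r b"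
  define w2 where "w2 = (- A) *s r a + B *s r b + C *s r c"
  define w3 where "w3 = B *s r c"
  have "det3 w1 w2 w3 = A * B * C * ?D"
    by (simp add: w1_def w2_def w3_def vec3_defs algebra_simps)
  then have w: "det3 w1 w2 w3 \<noteq> 0" using ABC D by simp
  have "\<exists>k s t. k \<noteq> 0 \<and> r i = k *s (s\<^sup>2 *s w1 + (s * t) *s w2 + t\<^sup>2 *s w3)" if i: "i \<in> I" for i
  proof -
    define x where "x = br i b c"
    define y where "y = br a i c"
    define z where "z = br a b i"
    have exp: "?D *s r i = x *s r a + y *s r b + z *s r c"
      unfolding x_def y_def z_def by (rule det3_expand)
    have con_i: "A * (y * z) + B * (x * z) + C * (x * y) = 0"
      using con i by (simp add: triangle_conic_def x_def y_def z_def)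
    have param: "s\<^sup>2 *s w1 + (s * t) *s w2 + t\<^sup>2 *s w3 =
      (- A * s * t) *s r a + (s * (B * t + C * s)) *s r b + (t * (B * t + C * s)) *s r c" for s t
      by (simp add: w1_def w2_def w3_def vec_eq_iff algebra_simps power2_eq_square)
    have *: "\<exists>k s t. k \<noteq> 0 \<and> r i = k *s (s\<^sup>2 *s w1 + (s * t) *s w2 + t\<^sup>2 *s w3)"
      if "m \<noteq> 0" "s\<^sup>2 *s w1 + (s * t) *s w2 + t\<^sup>2 *s w3 = m *s (?D *s r i)" for m s t
    proof -
      have "r i = inverse (m * ?D) *s (s\<^sup>2 *s w1 + (s * t) *s w2 + t\<^sup>2 *s w3)"
      proof -
        have "inverse (m * ?D) * (m * ?D) = 1" using that(1) D by (intro left_inverse) simp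
        then show ?thesis unfolding that(2) by (simp only: vector_smult_assoc vector_smult_lid)
      qed
      then show ?thesis using that(1) D by (metis inverse_nonzero_iff_nonzero mult_eq_0_iff)
    qed
    show ?thesis
    proof (cases "y = 0 \<and> z = 0")
      case True
      then have "x \<noteq> 0" using exp D r_nonzero[OF i] by auto
      \<comment> \<open>The point is \<open>a\<close> itself. It belongs to the tangent direction s
        : t = B : - C, where B t + C s = 0.\<close>
      have "B\<^sup>2 *s w1 + (B * (- C)) *s w2 + (- C)\<^sup>2 *s w3 = (A * B * C / x) *s (?D *s r i)"
        unfolding param exp using True \<open>x \<noteq> 0\<close> by (simp add: algebra_simps)
      then show ?thesis using ABC \<open>x \<noteq> 0\<close> by (intro *[of "A * B * C / x" B "- C"]) auto
    next
      case False
      have x: "x * (B * z + C * y) = - A * y * z"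
        using con_i by (simp add: algebra_simps eq_neg_iff_add_eq_0)
      have "B * z + C * y \<noteq> 0"
      proof
        assume 0: "B * z + C * y = 0"
        then have "y = 0 \<or> z = 0" using x ABC by auto
        then show False using 0 False ABC by auto
      qed
      moreover have "y\<^sup>2 *s w1 + (y * z) *s w2 + z\<^sup>2 *s w3 = (B * z + C * y) *s (?D *s r i)"
        unfolding param exp x[symmetric] by (simp add: vec_eq_iff algebra_simps)
      ultimately show ?thesis by (rule *)
    qed
  qed
  then obtain k s t where "\<And>i. i \<in> I \<Longrightarrow> k i \<noteq> 0 \<and>
      r i = k i *s ((s i)\<^sup>2 *s w1 + (s i * t i) *s w2 + (t i)\<^sup>2 *s w3)"
    by metis
  then show ?thesis by (rule conic_parameter[OF w _ odd])
qed

end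

section \<open>The standard conic and the curves of AS(q)\<close>

definition as_point :: "'a::field \<Rightarrow> 'a ^ 3" where
  "as_point s = vector [s\<^sup>2, 2 * s, 1]"

text \<open>At \<open>as_point u\<close> the forms take the values (u - s)^2 and 2 (u - s): one is
  the tangent of the conic, the other the line to its missing point (1,0,0). At (a, b, c) they take
  the values c s^2 - b s + a and b - 2 c s, the leading coordinates of the curves of AS(q).\<close>

definition as_form :: "'a::field \<Rightarrow> bool \<Rightarrow> 'a ^ 3" where
  "as_form s b = (if b then vector [1, - s, s\<^sup>2] else vector [0, 1, - 2 * s])"

lemma tangent_arc_as:
  fixes \<sigma> :: "'i \<Rightarrow> 'a::{field,finite}"
  assumes \<sigma>: "bij_betw \<sigma> I UNIV" and odd: "odd (CARD('a))"
  shows "tangent_arc I (\<lambda>i. as_point (\<sigma> i)) (\<lambda>i. as_form (\<sigma> i))"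
proof
  note two = two_neq_zero[OF odd]
  show "finite I" "card I = CARD('a)"
    using \<sigma> bij_betw_finite[OF \<sigma>] bij_betw_same_card[OF \<sigma>] by simp_all
  have ne: "\<sigma> i \<noteq> \<sigma> j" if "i \<in> I" "j \<in> I" "i \<noteq> j" for i j
    using \<sigma> that by (auto simp: bij_betw_def inj_on_def)
  fix i j assume ij: "i \<in> I" "j \<in> I" "i \<noteq> j"
  show "crs (as_point (\<sigma> i)) (as_point (\<sigma> j)) \<noteq> 0"
    using ne[OF ij] two by (simp add: as_point_def vec3_defs)
  show "dot3 (as_form (\<sigma> i) s) (as_point (\<sigma> j)) \<noteq> 0" for s
  proof (cases s)
    case True
    then have "dot3 (as_form (\<sigma> i) s) (as_point (\<sigma> j)) = (\<sigma> j - \<sigma> i)\<^sup>2"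
      by (simp add: as_form_def as_point_def vec3_defs power2_eq_square algebra_simps)
    then show ?thesis using ne[OF ij] by simp
  next
    case False
    then have "dot3 (as_form (\<sigma> i) s) (as_point (\<sigma> j)) = 2 * (\<sigma> j - \<sigma> i)"
      by (simp add: as_form_def as_point_def vec3_defs algebra_simps)
    then show ?thesis using ne[OF ij] two by simp
  qed
  fix k assume k: "k \<in> I" "i \<noteq> k" "j \<noteq> k"
  have "det3 (as_point (\<sigma> i)) (as_point (\<sigma> j)) (as_point (\<sigma> k)) =
    2 * ((\<sigma> i - \<sigma> j) * (\<sigma> i - \<sigma> k) * (\<sigma> j - \<sigma> k))"
    by (simp add: as_point_def vec3_defs power2_eq_square algebra_simps)
  then show "det3 (as_point (\<sigma> i)) (as_point (\<sigma> j)) (as_point (\<sigma> k)) \<noteq> 0"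
    using ne[OF ij] ne[OF ij(1) k(1,2)] ne[OF ij(2) k(1,3)] two by simp
next
  fix i
  show "crs (as_form (\<sigma> i) True) (as_form (\<sigma> i) False) = as_point (\<sigma> i)"
    by (simp add: as_form_def as_point_def vec3_defs power2_eq_square algebra_simps)
qed

text \<open>\<open>(i, a, b)\<close> goes to \<open>(a, b, \<sigma> i)\<close>. An affine point
  \<open>h\<close> becomes the curve with coefficients \<open>h\<close>, and the tangent planes
  become the two families on which the last coordinate is constant.\<close>

lemma model_isomorphic_ahrens_szekeres:
  fixes \<sigma> :: "'i \<Rightarrow> 'a::{field,finite}"
  assumes \<sigma>: "bij_betw \<sigma> I UNIV" and odd: "odd (CARD('a))"
  shows "isomorphic_structures (arc_model I (\<lambda>i. as_form (\<sigma> i)))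
    (ahrens_szekeres :: ('a \<times> 'a \<times> 'a, ('a \<times> 'a \<times> 'a) set) incidence_structure)"
proof -
  let ?M = "arc_model I (\<lambda>i. as_form (\<sigma> i))"
  let ?AS = "ahrens_szekeres :: ('a \<times> 'a \<times> 'a, ('a \<times> 'a \<times> 'a) set) incidence_structure"
  note two = two_neq_zero[OF odd]
  define F where "F = (\<lambda>(i, a :: 'a, b :: 'a). (a, b, \<sigma> i))"
  define curve where "curve h = range (\<lambda>s. (h $ 3 * s\<^sup>2 - h $ 2 * s + h $ 1, - 2 * h $ 3 * s + h $ 2, s))"
    for h :: "'a ^ 3"
  define axis where "axis = (\<lambda>(i, b, c :: 'a). range (\<lambda>s. if b then (c, s, \<sigma> i) else (s, c, \<sigma> i)))"
  have \<sigma>_eq: "\<sigma> i = \<sigma> j \<longleftrightarrow> i = j" if "i \<in> I" "j \<in> I" for i j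
    using \<sigma> that by (auto simp: bij_betw_def inj_on_def)
  have \<sigma>_surj: "\<exists>i\<in>I. s = \<sigma> i" for s using \<sigma> by (auto simp: bij_betw_def)
  have curve_iff: "(a, b, s) \<in> curve h \<longleftrightarrow> dot3 (as_form s True) h = a \<and> dot3 (as_form s False) h = b"
    for a b s h
    by (auto simp: curve_def as_form_def dot3_def image_iff algebra_simps)
  have axis_iff: "(a, b, s) \<in> axis (i, t, c) \<longleftrightarrow> s = \<sigma> i \<and> (if t then a else b) = c" for a b s i t c
    by (auto simp: axis_def)
  have "bij_betw F (points ?M) (points ?AS)"
    unfolding bij_betw_def
  proof
    show "inj_on F (points ?M)" by (auto simp: inj_on_def F_def \<sigma>_eq)
    show "F ` points ?M = points ?AS"
    proof (intro equalityI subsetI)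
      fix p :: "'a \<times> 'a \<times> 'a"
      obtain a b s where p: "p = (a, b, s)" by (cases p)
      obtain i where "i \<in> I" "s = \<sigma> i" using \<sigma>_surj by blast
      then show "p \<in> F ` points ?M" by (intro image_eqI[of _ _ "(i, a, b)"]) (auto simp: F_def p)
    qed (simp add: ahrens_szekeres_def)
  qed
  moreover have "bij_betw (case_sum curve axis) (blocks ?M) (blocks ?AS)"
    unfolding bij_betw_def
  proof
    have curve_inj: "h = k" if "curve h = curve k" for h k
    proof -
      have eq: "dot3 (as_form s True) h = dot3 (as_form s True) k \<and>
        dot3 (as_form s False) h = dot3 (as_form s False) k" for s
        using curve_iff[of _ _ s h] curve_iff[of _ _ s k] that by metis
      \<comment> \<open>The forms at 0 recover the first two coordinates of \<open>h\<close>, those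
        at 1 the third.\<close>
      from eq[of 0] eq[of 1] show ?thesis
        using two by (simp add: as_form_def vec3_defs)
    qed
    have curve_axis: "curve h \<noteq> axis (i, t, c)" for h i t c
    proof
      assume eq: "curve h = axis (i, t, c)"
      have "(dot3 (as_form (\<sigma> i + 1) True) h, dot3 (as_form (\<sigma> i + 1) False) h, \<sigma> i + 1) \<in> curve h"
        by (simp add: curve_iff)
      then show False unfolding eq by (simp add: axis_iff)
    qed
    have axis_inj: "(i, t, c) = (j, u, d)" if "axis (i, t, c) = axis (j, u, d)" "i \<in> I" "j \<in> I" for i t c j u d
    proof -
      have mem: "s = \<sigma> i \<and> (if t then a else b) = c \<longleftrightarrow> s = \<sigma> j \<and> (if u then a else b) = d" for a b s
        by (simp only: axis_iff[symmetric] that(1))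
      have "i = j" "c = d" using mem[where s = "\<sigma> i" and a = c and b = c] \<sigma>_eq that(2,3) by auto
      moreover have "t = u"
        using mem[where s = "\<sigma> i" and a = c and b = "c + 1"] \<open>i = j\<close> \<open>c = d\<close> by (cases t; cases u) simp_all
      ultimately show ?thesis by simp
    qed
    show "inj_on (case_sum curve axis) (blocks ?M)"
    proof (rule inj_onI)
      fix L M assume L: "L \<in> blocks ?M" and M: "M \<in> blocks ?M"
        and eq: "case_sum curve axis L = case_sum curve axis M"
      show "L = M"
      proof (cases L)
        case (Inl h)
        show ?thesis
        proof (cases M)
          case (Inl k)
          then show ?thesis using \<open>L = Inl h\<close> eq curve_inj[of h k] by simp
        next
          case (Inr q)
          then show ?thesis using \<open>L = Inl h\<close> eq curve_axis by (cases q) simp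
        qed
      next
        case (Inr p)
        obtain i t c where p: "p = (i, t, c)" by (cases p)
        show ?thesis
        proof (cases M)
          case (Inl k)
          then show ?thesis using Inr p eq curve_axis[of k i t c] by simp
        next
          case (Inr q)
          obtain j u d where q: "q = (j, u, d)" by (cases q)
          show ?thesis
            using axis_inj[of i t c j u d] eq L M p q Inr \<open>L = Inr p\<close> by (simp add: image_iff)
        qed
      qed
    qed
    have "case_sum curve axis ` blocks ?M = range curve \<union> axis ` (I \<times> UNIV)"
      by (simp add: image_Un image_image)
    also have "axis ` (I \<times> UNIV) = {range (\<lambda>s. (s, a, b)) | a b. True} \<union> {range (\<lambda>s. (a, s, b)) | a b. True}"
    proof (intro equalityI subsetI)
      fix X assume "X \<in> axis ` (I \<times> UNIV)"
      then obtain i t c where X: "X = axis (i, t, c)" by auto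
      show "X \<in> {range (\<lambda>s. (s, a, b)) | a b. True} \<union> {range (\<lambda>s. (a, s, b)) | a b. True}"
      proof (cases t)
        case True
        then have "X = range (\<lambda>s. (c, s, \<sigma> i))" by (simp add: X axis_def)
        then show ?thesis by blast
      next
        case False
        then have "X = range (\<lambda>s. (s, c, \<sigma> i))" by (simp add: X axis_def)
        then show ?thesis by blast
      qed
    next
      fix X :: "('a \<times> 'a \<times> 'a) set" assume "X \<in> {range (\<lambda>s. (s, a, b)) | a b. True} \<union> {range (\<lambda>s. (a, s, b)) | a b. True}"
      then obtain a b where X: "X = range (\<lambda>s. (s, a, b)) \<or> X = range (\<lambda>s. (a, s, b))" by blast
      obtain i where "i \<in> I" "b = \<sigma> i" using \<sigma>_surj by blast
      with X have "X = axis (i, False, a) \<or> X = axis (i, True, a)" by (auto simp: axis_def)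
      then show "X \<in> axis ` (I \<times> UNIV)" using \<open>i \<in> I\<close> by blast
    qed
    also have "range curve = {range (\<lambda>s. (c * s\<^sup>2 - b * s + a, - 2 * c * s + b, s)) | a b c. True}"
    proof (intro equalityI subsetI)
      fix X :: "('a \<times> 'a \<times> 'a) set" assume "X \<in> {range (\<lambda>s. (c * s\<^sup>2 - b * s + a, - 2 * c * s + b, s)) | a b c. True}"
      then obtain a b c where "X = range (\<lambda>s. (c * s\<^sup>2 - b * s + a, - 2 * c * s + b, s))" by blast
      then have "X = curve (vector [a, b, c])" by (simp add: curve_def)
      then show "X \<in> range curve" by blast
    qed (auto simp: curve_def)
    finally show "case_sum curve axis ` blocks ?M = blocks ?AS"
      by (simp add: ahrens_szekeres_def Un_commute)
  qed
  moreover have "incident ?M p L \<longleftrightarrow> incident ?AS (F p) (case_sum curve axis L)"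
    if "p \<in> points ?M" "L \<in> blocks ?M" for p L
    using that by (auto simp: ahrens_szekeres_def F_def curve_iff axis_iff \<sigma>_eq)
  ultimately show ?thesis unfolding isomorphic_structures_def by blast
qed

section \<open>From an arc in a plane to vectors\<close>

lemma plane_embedding:
  fixes H :: "('a::{field,finite} ^ 'd) set"
  assumes "proj_plane H"
  shows "\<exists>emb :: 'a ^ 3 \<Rightarrow> 'a ^ 'd. (\<forall>x y. emb (x + y) = emb x + emb y) \<and>
    (\<forall>c x. emb (c *s x) = c *s emb x) \<and> inj emb \<and> range emb = H"
proof -
  have H: "vec.subspace H" "card H = CARD('a) ^ 3" using assms by (simp_all add: proj_card_iff)
  obtain B where B: "B \<subseteq> H" "H \<subseteq> vec.span B" "card B = 3"
    using vec.basis_exists[of H] assms by (metis proj_plane_def)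
  obtain xs where xs: "set xs = B" "length xs = 3" using B(3) by (rule distinct_list_of_card) simp_all
  then obtain u v w where "xs = [u, v, w]" by (auto simp: eval_nat_numeral length_Suc_conv)
  then have B_eq: "B = {u, v, w}" using xs by auto
  define emb :: "'a ^ 3 \<Rightarrow> 'a ^ 'd" where "emb x = x $ 1 *s u + x $ 2 *s v + x $ 3 *s w" for x
  have add: "emb (x + y) = emb x + emb y" for x y
    by (simp add: emb_def vec.scale_left_distrib)
  have scale: "emb (c *s x) = c *s emb x" for c x
    by (simp add: emb_def vec.scale_right_distrib)
  have "vec.subspace (range emb)"
  proof (rule vec.subspaceI)
    have "emb 0 = 0" by (simp add: emb_def)
    then show "0 \<in> range emb" by (metis rangeI)
    show "x + y \<in> range emb" if "x \<in> range emb" "y \<in> range emb" for x y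
      using that by (auto simp flip: add)
    show "c *s x \<in> range emb" if "x \<in> range emb" for c x
      using that by (auto simp flip: scale)
  qed
  moreover have "B \<subseteq> range emb"
  proof -
    have "u = emb (vector [1, 0, 0])" "v = emb (vector [0, 1, 0])" "w = emb (vector [0, 0, 1])"
      by (simp_all add: emb_def)
    then show ?thesis unfolding B_eq by blast
  qed
  ultimately have "H \<subseteq> range emb" using B(2) vec.span_minimal by blast
  moreover have "emb x \<in> H" for x
    using B(1) H(1) unfolding B_eq emb_def by (simp add: vec.subspace_add vec.subspace_scale)
  ultimately have range: "range emb = H" by blast
  then have "inj emb" using H(2) by (intro eq_card_imp_inj_on) simp_all
  then show ?thesis using add scale range by blast
qed

lemma proj_point_eq_range:
  fixes P :: "('a::{field,finite} ^ 'd) set"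
  assumes P: "proj_point P" and v: "v \<in> P" "v \<noteq> 0"
  shows "P = range (\<lambda>c. c *s v)"
proof -
  have "range (\<lambda>c. c *s v) = P"
  proof (rule card_subset_eq)
    show "range (\<lambda>c. c *s v) \<subseteq> P"
      using P v by (auto simp: proj_point_def vec.subspace_scale)
    have "inj (\<lambda>c. c *s v)" using v by (auto simp: inj_def)
    then show "card (range (\<lambda>c. c *s v)) = card P"
      using P by (simp add: card_image proj_card_iff)
  qed simp
  then show ?thesis ..
qed

text \<open>If the determinant vanished, the kernel of the form \<open>crs (r P) (r Q)\<close> would
  be a line through all three points. For this kernel to be a line, the cross product has to be
  nonzero, which is why independence of pairs is settled beforehand.\<close>

lemma arc_vectors:
  fixes H :: "('a::{field,finite} ^ 4) set" and emb :: "'a ^ 3 \<Rightarrow> 'a ^ 4"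
  assumes arc: "arc_in_plane (CARD('a)) H K"
    and add: "\<And>x y. emb (x + y) = emb x + emb y" and scale: "\<And>c x. emb (c *s x) = c *s emb x"
    and inj: "inj emb" and range: "range emb = H"
  shows "\<exists>r. vec_arc K r \<and> (\<forall>P\<in>K. P = range (\<lambda>c. emb (c *s r P)))"
proof -
  have K: "proj_point P" "P \<subseteq> H" if "P \<in> K" for P
    using arc that by (auto simp: arc_in_plane_def)
  have emb0: "emb 0 = 0" using scale[of 0 0] by simp
  have "\<exists>x. x \<noteq> 0 \<and> P = range (\<lambda>c. emb (c *s x))" if "P \<in> K" for P
  proof -
    have "card P \<noteq> 1" using K(1)[OF that] card_field_ge_2[where 'a='a] by (simp add: proj_card_iff)
    then have "P \<noteq> {0}" by auto
    moreover have "0 \<in> P" using K(1)[OF that] by (simp add: proj_point_def vec.subspace_0)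
    ultimately obtain v where v: "v \<in> P" "v \<noteq> 0" by blast
    then have "v \<in> range emb" using K(2)[OF \<open>P \<in> K\<close>] range by blast
    then obtain x where x: "v = emb x" by blast
    have "P = range (\<lambda>c. emb (c *s x))"
      using proj_point_eq_range[OF K(1)[OF that] v] by (simp add: scale x)
    moreover have "x \<noteq> 0" using v x emb0 by auto
    ultimately show ?thesis by blast
  qed
  then have "\<forall>P\<in>K. \<exists>x. x \<noteq> 0 \<and> P = range (\<lambda>c. emb (c *s x))" by blast
  from bchoice[OF this] obtain r where r: "\<forall>P\<in>K. r P \<noteq> 0 \<and> P = range (\<lambda>c. emb (c *s r P))"
    by (rule exE)
  have r0: "r P \<noteq> 0" and r_eq: "P = range (\<lambda>c. emb (c *s r P))" if "P \<in> K" for P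
    using bspec[OF r that] by (rule conjunct1, rule conjunct2)
  have r_mem: "y \<in> P \<longleftrightarrow> (\<exists>c. y = emb (c *s r P))" if "P \<in> K" for P y
    using arg_cong[OF r_eq[OF that], of "\<lambda>X. y \<in> X"] by (simp only: image_iff bex_UNIV)
  have "vec_arc K r"
  proof
    show "finite K" "card K = CARD('a)" using arc by (simp_all add: arc_in_plane_def)
  next
    fix P Q assume PQ: "P \<in> K" "Q \<in> K" "P \<noteq> Q"
    show w: "crs (r P) (r Q) \<noteq> 0"
    proof
      assume "crs (r P) (r Q) = 0"
      then obtain c where c: "r Q = c *s r P" using crs_eq_0[OF _ r0[OF PQ(1)]] by blast
      have "emb (r Q) \<in> P" unfolding r_mem[OF PQ(1)] c by blast
      moreover have "emb (r Q) \<noteq> 0" using r0[OF PQ(2)] inj emb0 by (metis injD)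
      ultimately have "P = range (\<lambda>d. d *s emb (r Q))" by (intro proj_point_eq_range K(1) PQ)
      also have "\<dots> = range (\<lambda>d. emb (d *s r Q))" by (simp only: scale)
      also have "\<dots> = Q" by (rule r_eq[OF PQ(2), symmetric])
      finally show False using PQ(3) by contradiction
    qed
    fix R assume R: "R \<in> K" "P \<noteq> R" "Q \<noteq> R"
    show "det3 (r P) (r Q) (r R) \<noteq> 0"
    proof
      assume 0: "det3 (r P) (r Q) (r R) = 0"
      let ?w = "crs (r P) (r Q)"
      let ?l = "emb ` {x. dot3 ?w x = 0}"
      have "vec.subspace ?l"
      proof (rule vec.subspaceI)
        show "0 \<in> ?l" using emb0 by (intro image_eqI[of _ _ 0]) simp_all
        show "x + y \<in> ?l" if "x \<in> ?l" "y \<in> ?l" for x y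
          using that by (auto simp flip: add)
        show "c *s x \<in> ?l" if "x \<in> ?l" for c x
          using that by (auto simp flip: scale)
      qed
      moreover have "card ?l = CARD('a) ^ 2"
        using card_dot3_kernel[OF w, of 0] card_image[OF inj_on_subset[OF inj]] by simp
      ultimately have "proj_line ?l" by (simp add: proj_card_iff)
      moreover have "S \<subseteq> ?l" if "S \<in> {P, Q, R}" for S
      proof -
        have w: "dot3 ?w (r S) = 0" and "S \<in> K" using that 0 PQ R by (auto simp flip: det3_dot3)
        show ?thesis
        proof
          fix y assume "y \<in> S"
          then obtain c where "y = emb (c *s r S)" using r_mem[OF \<open>S \<in> K\<close>] by blast
          then show "y \<in> ?l" using w by simp
        qed
      qed
      ultimately have "\<exists>l. proj_line l \<and> P \<subseteq> l \<and> Q \<subseteq> l \<and> R \<subseteq> l" by blast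
      then show False using arc PQ R unfolding arc_in_plane_def by blast
    qed
  qed
  then show ?thesis using r_eq by blast
qed

theorem theorem3p1:
  fixes q :: nat
    and H :: "('a::{field,finite} ^ 4) set"
    and K :: "('a ^ 4) set set"
  assumes "primepow q" and "CARD('a) = q"
    and "proj_plane H"
    and "arc_in_plane q H K"
  shows "generalised_quadrangle (q - 1) (q + 1) (arc_structure H K) \<and>
         (odd q \<longrightarrow>
            isomorphic_structures (arc_structure H K)
              (ahrens_szekeres :: ('a \<times> 'a \<times> 'a, ('a \<times> 'a \<times> 'a) set) incidence_structure))"
proof -
  obtain emb :: "'a ^ 3 \<Rightarrow> 'a ^ 4" where add: "\<And>x y. emb (x + y) = emb x + emb y"
    and scale: "\<And>c x. emb (c *s x) = c *s emb x" and inj: "inj emb" and range: "range emb = H"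
    using plane_embedding[OF assms(3)] by blast
  have "H \<noteq> UNIV"
  proof
    assume "H = UNIV"
    then have "CARD('a) ^ 3 = CARD('a) ^ 4" using assms(3) by (simp add: proj_card_iff)
    then show False using card_field_ge_2[where 'a='a] by simp
  qed
  then obtain n where n: "n \<notin> H" by blast
  obtain r where va: "vec_arc K r" and r: "\<forall>P\<in>K. P = range (\<lambda>c. emb (c *s r P))"
    using arc_vectors[OF _ add scale inj range] assms(2,4) by blast
  interpret vec_arc K r by (rule va)
  have "\<forall>i\<in>K. \<exists>g. crs (g True) (g False) = r i \<and> (\<forall>j\<in>K - {i}. \<forall>s. dot3 (g s) (r j) \<noteq> 0)"
  proof
    fix i assume "i \<in> K"
    then obtain a b where "crs a b = r i" "\<forall>j\<in>K - {i}. dot3 a (r j) \<noteq> 0 \<and> dot3 b (r j) \<noteq> 0"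
      using tangent_forms by blast
    then show "\<exists>g. crs (g True) (g False) = r i \<and> (\<forall>j\<in>K - {i}. \<forall>s. dot3 (g s) (r j) \<noteq> 0)"
      by (intro exI[of _ "\<lambda>s. if s then a else b"]) simp
  qed
  then obtain f where f: "\<forall>i\<in>K. crs (f i True) (f i False) = r i \<and>
    (\<forall>j\<in>K - {i}. \<forall>s. dot3 (f i s) (r j) \<noteq> 0)"
    by (rule bchoice[THEN exE])
  have tan: "tangent_arc K r f"
    by unfold_locales (use f in auto)
  interpret ac: arc_coords K r f emb H n
    by (intro arc_coords.intro arc_coords_axioms.intro tan add scale inj range n bspec[OF r])
  have gq: "generalised_quadrangle (q - 1) (q + 1) (arc_structure H K)"
    using generalised_quadrangle_isomorphic[OF ac.isomorphic_model ac.generalised_quadrangle_model]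
    by (simp add: assms(2))
  have "isomorphic_structures (arc_structure H K)
    (ahrens_szekeres :: ('a \<times> 'a \<times> 'a, ('a \<times> 'a \<times> 'a) set) incidence_structure)"
    if "odd q"
  proof -
    have odd: "odd (CARD('a))" using that assms(2) by simp
    obtain u1 u2 u3 \<sigma> where u: "det3 u1 u2 u3 \<noteq> 0" and \<sigma>: "bij_betw \<sigma> K UNIV"
      and p: "\<forall>i\<in>K. \<exists>c. c \<noteq> 0 \<and> r i = c *s ((\<sigma> i)\<^sup>2 *s u1 + (2 * \<sigma> i) *s u2 + u3)"
      using ac.conic_coordinates[OF odd] by (elim exE conjE) (rule that)
    \<comment> \<open>The change of coordinates to the standard conic: it sends
      \<open>as_point (\<sigma> i)\<close> to a multiple of \<open>r i\<close>.\<close>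
    define U where "U x = x $ 1 *s u1 + x $ 2 *s u2 + x $ 3 *s u3" for x :: "'a ^ 3"
    have U_add: "U (x + y) = U x + U y" and U_scale: "U (c *s x) = c *s U x" for x y c
      by (simp_all add: U_def vec.scale_left_distrib vec.scale_right_distrib)
    have "inj U"
    proof (rule injI)
      fix x y assume eq: "U x = U y"
      have D: "det3 (U x) u2 u3 = x $ 1 * det3 u1 u2 u3" "det3 u1 (U x) u3 = x $ 2 * det3 u1 u2 u3"
        "det3 u1 u2 (U x) = x $ 3 * det3 u1 u2 u3" for x
        by (simp_all add: U_def vec3_defs algebra_simps)
      show "x = y"
        using D[of x] D[of y] u unfolding eq by (simp add: vec_eq_iff forall_3)
    qed
    interpret as: tangent_arc K "\<lambda>i. as_point (\<sigma> i)" "\<lambda>i. as_form (\<sigma> i)"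
      by (rule tangent_arc_as[OF \<sigma> odd])
    \<comment> \<open>A second coordinate system for the same arc. It makes the isomorphism with the
      model available for \<open>as_form\<close> without comparing these forms with
      \<open>f\<close>.\<close>
    interpret as: arc_coords K "\<lambda>i. as_point (\<sigma> i)" "\<lambda>i. as_form (\<sigma> i)" "emb \<circ> U" H n
    proof
      show "inj (emb \<circ> U)" using inj \<open>inj U\<close> by (rule inj_compose)
      have "surj U" using \<open>inj U\<close> by (simp add: finite_UNIV_inj_surj)
      then show "range (emb \<circ> U) = H" using range by (metis image_comp)
    next
      fix P assume P: "P \<in> K"
      then obtain c where c: "c \<noteq> 0" "r P = c *s U (as_point (\<sigma> P))"
        using p by (auto simp: U_def as_point_def)
      \<comment> \<open>The unknown scalar \<open>c\<close> only reparametrises the projective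
        point.\<close>
      have "range (\<lambda>d. d * c) = UNIV" using c(1) by (intro surjI[of _ "\<lambda>d. d / c"]) simp
      have "P = range (\<lambda>d. emb (d *s r P))" by (rule bspec[OF r P])
      also have "\<dots> = range ((\<lambda>d. emb (d *s U (as_point (\<sigma> P)))) \<circ> (\<lambda>d. d * c))"
        by (simp add: c(2) comp_def)
      also have "\<dots> = range (\<lambda>d. (emb \<circ> U) (d *s as_point (\<sigma> P)))"
        by (simp only: image_comp[symmetric] \<open>range (\<lambda>d. d * c) = UNIV\<close>) (simp add: U_scale)
      finally show "P = range (\<lambda>d. (emb \<circ> U) (d *s as_point (\<sigma> P)))" .
    qed (use add scale n in \<open>simp_all add: U_add U_scale\<close>)
    show ?thesis
      using isomorphic_trans[OF isomorphic_sym[OF as.isomorphic_model]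
          model_isomorphic_ahrens_szekeres[OF \<sigma> odd]] .
  qed
  then show ?thesis using gq by blast
qed

end
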